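(* (i) $\widetilde{\Omega}^n_D(\mathcal{A}_f)=0$ for $n\ge 2$. (ii) $\widetilde{\Omega}^n_D(\mathcal{A}_f)\cong\mathbb{C}[z,z^{-1}]$ for $n=0,1$ (isomorphism of $\mathcal{A}_f$-bimodules), and the differential $d:\mathcal{A}_f\to\widetilde{\Omega}^1_D(\mathcal{A}_f)\cong\mathbb{C}[z,z^{-1}]$ induced by $\delta$ is given by $$d(\alpha_i\beta^j\beta^{*k})=\begin{cases}-i\,z^i & \text{if } j=k=0,\\ 0&\text{otherwise,}\end{cases}\qquad i\in\mathbb{Z},\ j,k\in\mathbb{N}.$$
   Context: Let $0<q<1$. Let $\mathcal{A}$ be the universal $C^*$-algebra (continuous functions on the quantum $SU(2)$ group) generated by $\alpha,\beta$ with relations $\alpha^*\alpha+\beta^*\beta=I$, $\alpha\alpha^*+q^2\beta\beta^*=I$, $\alpha\beta=q\beta\alpha$, $\alpha\beta^*=q\beta^*\alpha$, $\beta^*\beta=\beta\beta^*$. Let $\mathcal{H}=L_2(\mathbb{N})\otimes L_2(\mathbb{Z})$ with $\mathbb{N}=\{0,1,2,\ldots\}$, canonical orthonormal basis $e_{ij}=e_i\otimes e_j$. On $L_2(\mathbb{N})$ or $L_2(\mathbb{Z})$, $N$ denotes the operator $e_k\mapsto ke_k$ and $\ell$ the operator $e_k\mapsto e_{k-1}$ (with $\ell e_0=0$ on $L_2(\mathbb{N})$). The faithful representation $\pi$ of $\mathcal{A}$ on $\mathcal{H}$ is $\pi(\alpha)=\ell\sqrt{I-q^{2N}}\otimes I$,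 $\pi(\beta)=q^N\otimes\ell$. $\mathcal{A}_f$ is the $*$-subalgebra of $\mathcal{A}$ generated by $\alpha$ and $\beta$. Put $\alpha_i=\alpha^i$ for $i\ge 0$ and $\alpha_i=(\alpha^* )^{-i}$ for $i<0$; then $\{\alpha_i\beta^j\beta^{*k}:i\in\mathbb{Z},\,j,k\in\mathbb{N}\}$ is a basis of $\mathcal{A}_f$. Let $\sigma:\mathcal{A}_f\to\mathbb{C}[z,z^{-1}]$ be the surjective $*$-homomorphism with $\sigma(\alpha)=z$, $\sigma(\beta)=0$ (with $z^*=z^{-1}$); $\mathbb{C}[z,z^{-1}]$ is an $\mathcal{A}_f$-bimodule through $\sigma$. Let $S$ be the operator on $L_2(\mathbb{Z})$ with $Se_j=e_j$ for $j\ge 0$ and $Se_j=-e_j$ for $j<0$, and $D=N\otimes S+I\otimes N$ on $\mathcal{H}$. For $a\in\mathcal{A}_f$, $[D,\pi(a)]$ extends to a bounded operator. Let $\Omega^\bullet(\mathcal{A}_f)$ be the universal graded differential algebra over $\mathcal{A}_f$ with differential $\delta$: $\Omega^0(\mathcal{A}_f)=\mathcal{A}_f$, $\Omega^n(\mathcal{A}_f)=\mathrm{span}\{a_0(\delta a_1)\cdots(\delta a_n):a_i\in\mathcal{A}_f\}$, $\delta(ab)=a(\delta b)+(\delta a)b$ for $a,b\in\mathcal{A}_f$. Extend $\pi$ to $\Omega^n(\mathcal{A}_f)$ by $\pi(a_0(\delta a_1)\cdots(\delta a_n))=\pi(a_0)[D,\pi(a_1)]\cdots[D,\pi(a_n)]$.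 Square integrable forms (Fröhlich et al.): on $\Omega^n(\mathcal{A}_f)$ let $$(\omega,\eta)_D=\mathop{\mathrm{Lim}}_{\varepsilon\to 0+}\frac{\mathrm{Tr}\big(\pi(\omega)^*\pi(\eta)e^{-\varepsilon D^2}\big)}{\mathrm{Tr}\big(e^{-\varepsilon D^2}\big)},$$ where $\mathrm{Lim}$ is a fixed generalized limit (positive normalized linear functional on bounded functions of $\varepsilon$ extending the ordinary limit at $0+$). Put $\mathfrak{K}_n=\{\omega\in\Omega^n(\mathcal{A}_f):(\omega,\omega)_D=0\}$, $\mathfrak{K}_{-1}=0$, and $\widetilde{\Omega}^n_D(\mathcal{A}_f)=\Omega^n(\mathcal{A}_f)/(\mathfrak{K}_n+\delta\mathfrak{K}_{n-1})$. *)

theory Defs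
  imports "HOL-Analysis.Analysis" "HOL-Library.Poly_Mapping"
    "HOL-Algebra.QuotRing" "HOL-Algebra.Generated_Groups"
begin

section \<open>Complex normed spaces and unital C*-algebras\<close>

class complex_normed_space = real_normed_vector +
  fixes scaleC :: "complex \<Rightarrow> 'a \<Rightarrow> 'a"  (infixr \<open>*\<^sub>C\<close> 75)
  assumes scaleC_add_right: "c *\<^sub>C (x + y) = c *\<^sub>C x + c *\<^sub>C y"
    and scaleC_add_left: "(c + d) *\<^sub>C x = c *\<^sub>C x + d *\<^sub>C x"
    and scaleC_scaleC: "c *\<^sub>C d *\<^sub>C x = (c * d) *\<^sub>C x"
    and scaleC_of_real: "complex_of_real r *\<^sub>C x = r *\<^sub>R x"
    and norm_scaleC: "norm (c *\<^sub>C x) = cmod c * norm x"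

class cstar_algebra = complex_normed_space + real_normed_algebra_1 + banach +
  fixes star :: "'a \<Rightarrow> 'a"
  assumes scaleC_mult_left: "(c *\<^sub>C x) * y = c *\<^sub>C (x * y)"
    and scaleC_mult_right: "x * (c *\<^sub>C y) = c *\<^sub>C (x * y)"
    and star_star: "star (star x) = x"
    and star_add: "star (x + y) = star x + star y"
    and star_scaleC: "star (c *\<^sub>C x) = cnj c *\<^sub>C star x"
    and star_mult: "star (x * y) = star y * star x"
    and cstar_identity: "norm (star x * x) = (norm x)\<^sup>2"

section \<open>The Hilbert space of square summable families\<close>

definition square_summable :: "('i \<Rightarrow> complex) \<Rightarrow> bool" where
  "square_summable f \<longleftrightarrow> (\<lambda>i. (cmod (f i))\<^sup>2) summable_on UNIV"

lemma square_summable_cinner: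
  assumes "square_summable f" "square_summable g"
  shows "(\<lambda>i. cnj (f i) * g i) summable_on UNIV"
proof -
  have "(\<lambda>i. (cmod (f i))\<^sup>2 + (cmod (g i))\<^sup>2) summable_on UNIV"
    using assms by (simp add: square_summable_def summable_on_add)
  then have "(\<lambda>i. norm (cnj (f i) * g i)) summable_on UNIV"
  proof (rule summable_on_comparison_test)
    fix i
    have "2 * (cmod (f i) * cmod (g i)) \<le> (cmod (f i))\<^sup>2 + (cmod (g i))\<^sup>2"
      using sum_squares_bound[of "cmod (f i)" "cmod (g i)"] by (simp add: mult.assoc)
    moreover have "0 \<le> cmod (f i) * cmod (g i)" by simp
    ultimately show "norm (cnj (f i) * g i) \<le> (cmod (f i))\<^sup>2 + (cmod (g i))\<^sup>2"
      by (simp only: norm_mult complex_mod_cnj)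
  qed auto
  then show ?thesis by (rule abs_summable_summable)
qed

lemma square_summable_0: "square_summable (\<lambda>_. 0)"
  by (simp add: square_summable_def)

lemma square_summable_add:
  assumes "square_summable f" "square_summable g"
  shows "square_summable (\<lambda>i. f i + g i)"
proof -
  have "(\<lambda>i. 2 * (cmod (f i))\<^sup>2 + 2 * (cmod (g i))\<^sup>2) summable_on UNIV"
    using assms by (auto simp: square_summable_def intro!: summable_on_add summable_on_cmult_right)
  then show ?thesis
    unfolding square_summable_def
  proof (rule summable_on_comparison_test)
    fix i
    have "(cmod (f i + g i))\<^sup>2 \<le> (cmod (f i) + cmod (g i))\<^sup>2"
      by (intro power_mono norm_triangle_ineq) auto
    also have "\<dots> \<le> 2 * (cmod (f i))\<^sup>2 + 2 * (cmod (g i))\<^sup>2"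
      using sum_squares_bound[of "cmod (f i)" "cmod (g i)"] by (simp add: power2_sum)
    finally show "(cmod (f i + g i))\<^sup>2 \<le> 2 * (cmod (f i))\<^sup>2 + 2 * (cmod (g i))\<^sup>2" .
  qed auto
qed

lemma square_summable_cmult:
  assumes "square_summable f"
  shows "square_summable (\<lambda>i. c * f i)"
  using assms by (auto simp: square_summable_def norm_mult power_mult_distrib intro!: summable_on_cmult_right)

typedef 'i ell2 = "{f :: 'i \<Rightarrow> complex. square_summable f}"
  morphisms coord Abs_ell2
  using square_summable_0 by blast

setup_lifting type_definition_ell2

lemma square_summable_coord: "square_summable (coord v)"
  using coord by blast

instantiation ell2 :: (type) real_vector
begin

lift_definition zero_ell2 :: "'i ell2" is "\<lambda>_. 0"
  by (rule square_summable_0)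

lift_definition plus_ell2 :: "'i ell2 \<Rightarrow> 'i ell2 \<Rightarrow> 'i ell2" is "\<lambda>f g i. f i + g i"
  by (rule square_summable_add)

lift_definition uminus_ell2 :: "'i ell2 \<Rightarrow> 'i ell2" is "\<lambda>f i. - f i"
  by (simp add: square_summable_def)

lift_definition minus_ell2 :: "'i ell2 \<Rightarrow> 'i ell2 \<Rightarrow> 'i ell2" is "\<lambda>f g i. f i - g i"
  using square_summable_add[of _ "\<lambda>i. - g i" for g] by (simp add: square_summable_def)

lift_definition scaleR_ell2 :: "real \<Rightarrow> 'i ell2 \<Rightarrow> 'i ell2" is "\<lambda>r f i. complex_of_real r * f i"
  by (rule square_summable_cmult)

instance
  by standard (transfer; simp add: algebra_simps)+

end

lift_definition cinner :: "'i ell2 \<Rightarrow> 'i ell2 \<Rightarrow> complex" is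
  "\<lambda>f g. \<Sum>\<^sub>\<infinity>i. cnj (f i) * g i" .

lemma cinner_add_left: "cinner (u + v) w = cinner u w + cinner v w"
  by transfer (simp add: distrib_left distrib_right square_summable_cinner infsum_add)

lemma cinner_add_right: "cinner u (v + w) = cinner u v + cinner u w"
  by transfer (simp add: distrib_left distrib_right square_summable_cinner infsum_add)

lemma cinner_commute: "cinner u v = cnj (cinner v u)"
  by transfer (simp flip: infsum_cnj add: mult.commute)

lemma cinner_scaleR_left: "cinner (r *\<^sub>R u) v = complex_of_real r * cinner u v"
  by transfer (simp add: mult.assoc infsum_cmult_right')

lemma cinner_self: "cinner u u = complex_of_real (\<Sum>\<^sub>\<infinity>i. (cmod (coord u i))\<^sup>2)"
proof -
  have "cnj (coord u i) * coord u i = complex_of_real ((cmod (coord u i))\<^sup>2)" for i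
    using complex_norm_square[of "coord u i"] by (simp add: mult.commute)
  then show ?thesis
    using infsumI[OF has_sum_of_real[OF has_sum_infsum], of "\<lambda>i. (cmod (coord u i))\<^sup>2" UNIV]
      square_summable_coord[of u]
    unfolding cinner.rep_eq square_summable_def by simp
qed

instantiation ell2 :: (type) real_inner
begin

definition inner_ell2 :: "'i ell2 \<Rightarrow> 'i ell2 \<Rightarrow> real" where
  "inner_ell2 u v = Re (cinner u v)"

definition norm_ell2 :: "'i ell2 \<Rightarrow> real" where
  "norm_ell2 u = sqrt (inner u u)"

definition dist_ell2 :: "'i ell2 \<Rightarrow> 'i ell2 \<Rightarrow> real" where
  "dist_ell2 u v = norm (u - v)"

definition sgn_ell2 :: "'i ell2 \<Rightarrow> 'i ell2" where
  "sgn_ell2 u = u /\<^sub>R norm u"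

definition uniformity_ell2 :: "('i ell2 \<times> 'i ell2) filter" where
  "uniformity_ell2 = (INF e\<in>{0<..}. principal {(x, y). dist x y < e})"

definition open_ell2 :: "'i ell2 set \<Rightarrow> bool" where
  "open_ell2 U \<longleftrightarrow> (\<forall>x\<in>U. \<forall>\<^sub>F (x', y) in uniformity. x' = x \<longrightarrow> y \<in> U)"

instance
proof
  fix u v w :: "'i ell2" and r :: real
  show "inner u v = inner v u"
    unfolding inner_ell2_def by (subst cinner_commute) simp
  show "inner (u + v) w = inner u w + inner v w"
    by (simp add: inner_ell2_def cinner_add_left)
  show "inner (r *\<^sub>R u) v = r * inner u v"
    by (simp add: inner_ell2_def cinner_scaleR_left)
  have sq: "inner u u = (\<Sum>\<^sub>\<infinity>i. (cmod (coord u i))\<^sup>2)"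
    by (simp add: inner_ell2_def cinner_self)
  show "0 \<le> inner u u"
    unfolding sq by (rule infsum_nonneg) simp
  show "inner u u = 0 \<longleftrightarrow> u = 0"
  proof
    assume "inner u u = 0"
    then have "(cmod (coord u i))\<^sup>2 = 0" for i
      using nonneg_infsum_le_0D[of "\<lambda>i. (cmod (coord u i))\<^sup>2" UNIV i]
        square_summable_coord[of u] by (simp add: sq square_summable_def)
    then show "u = 0"
      by transfer auto
  next
    assume "u = 0"
    then show "inner u u = 0"
      unfolding sq by (simp add: zero_ell2.rep_eq)
  qed
qed (simp_all add: norm_ell2_def dist_ell2_def sgn_ell2_def uniformity_ell2_def open_ell2_def)

end

lemma norm_ell2_square: "(norm u)\<^sup>2 = (\<Sum>\<^sub>\<infinity>i. (cmod (coord u i))\<^sup>2)"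
  by (simp add: power2_norm_eq_inner inner_ell2_def cinner_self)

lemma sum_coord_le: "finite F \<Longrightarrow> (\<Sum>i\<in>F. (cmod (coord u i))\<^sup>2) \<le> (norm u)\<^sup>2"
  unfolding norm_ell2_square
  by (rule finite_sum_le_infsum) (use square_summable_coord[of u] in \<open>auto simp: square_summable_def\<close>)

lemma norm_coord_le: "cmod (coord u i) \<le> norm u"
  using sum_coord_le[of "{i}" u] by (simp add: power2_le_iff_abs_le)

lemma bounded_sums_ell2:
  assumes "\<And>F. finite F \<Longrightarrow> (\<Sum>i\<in>F. (cmod (f i))\<^sup>2) \<le> C\<^sup>2" and "0 \<le> C"
  shows "square_summable f" and "norm (Abs_ell2 f) \<le> C"
proof -
  show s: "square_summable f"
    unfolding square_summable_def
    by (rule nonneg_bounded_partial_sums_imp_summable_on[where C="C\<^sup>2"]) (use assms in auto)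
  have "(norm (Abs_ell2 f))\<^sup>2 \<le> C\<^sup>2"
    unfolding norm_ell2_square using s
    by (auto simp: Abs_ell2_inverse square_summable_def intro!: infsum_le_finite_sums assms)
  then show "norm (Abs_ell2 f) \<le> C"
    using assms(2) by (rule power2_le_imp_le)
qed

instance ell2 :: (type) banach
proof
  fix X :: "nat \<Rightarrow> 'i ell2"
  assume X: "Cauchy X"
  have "Cauchy (\<lambda>n. coord (X n) i)" for i
  proof (rule CauchyI)
    fix e :: real assume "0 < e"
    then obtain N where N: "\<forall>m\<ge>N. \<forall>n\<ge>N. norm (X m - X n) < e"
      using X CauchyD by blast
    have "norm (coord (X m) i - coord (X n) i) \<le> norm (X m - X n)" for m n
      using norm_coord_le[of "X m - X n" i] by (simp add: minus_ell2.rep_eq)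
    with N show "\<exists>M. \<forall>m\<ge>M. \<forall>n\<ge>M. norm (coord (X m) i - coord (X n) i) < e"
      by (meson le_less_trans)
  qed
  then have "\<exists>l. (\<lambda>n. coord (X n) i) \<longlonglongrightarrow> l" for i
    by (metis Cauchy_convergent convergent_def)
  then obtain l where l: "\<And>i. (\<lambda>n. coord (X n) i) \<longlonglongrightarrow> l i"
    by metis
  have tail: "(\<Sum>i\<in>F. (cmod (coord (X n) i - l i))\<^sup>2) \<le> e\<^sup>2"
    if N: "\<forall>m\<ge>N. \<forall>n\<ge>N. norm (X m - X n) < e" and n: "n \<ge> N" and F: "finite F" for F N n e
  proof (rule LIMSEQ_le_const2)
    show "(\<lambda>m. \<Sum>i\<in>F. (cmod (coord (X n) i - coord (X m) i))\<^sup>2)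
        \<longlonglongrightarrow> (\<Sum>i\<in>F. (cmod (coord (X n) i - l i))\<^sup>2)"
      by (intro tendsto_intros l)
    have "(\<Sum>i\<in>F. (cmod (coord (X n) i - coord (X m) i))\<^sup>2) \<le> e\<^sup>2" if "m \<ge> N" for m
    proof -
      have "(\<Sum>i\<in>F. (cmod (coord (X n) i - coord (X m) i))\<^sup>2) \<le> (norm (X n - X m))\<^sup>2"
        using sum_coord_le[OF F, of "X n - X m"] by (simp add: minus_ell2.rep_eq)
      also have "\<dots> \<le> e\<^sup>2"
        using N n that by (intro power_mono) (auto intro: less_imp_le)
      finally show ?thesis .
    qed
    then show "\<exists>N. \<forall>m\<ge>N. (\<Sum>i\<in>F. (cmod (coord (X n) i - coord (X m) i))\<^sup>2) \<le> e\<^sup>2"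
      by blast
  qed
  obtain N1 where N1: "\<forall>m\<ge>N1. \<forall>n\<ge>N1. norm (X m - X n) < 1"
    using X CauchyD zero_less_one by blast
  have "square_summable (\<lambda>i. coord (X N1) i - l i)"
    by (rule bounded_sums_ell2(1)[where C=1]) (use tail[OF N1] in auto)
  then have "square_summable (\<lambda>i. coord (X N1) i + - 1 * (coord (X N1) i - l i))"
    by (intro square_summable_add square_summable_cmult square_summable_coord)
  then have sl: "square_summable l"
    by simp
  have "X \<longlonglongrightarrow> Abs_ell2 l"
  proof (rule LIMSEQ_I)
    fix r :: real assume "0 < r"
    then obtain N where N: "\<forall>m\<ge>N. \<forall>n\<ge>N. norm (X m - X n) < r/2"
      using X CauchyD half_gt_zero by blast
    have "norm (X n - Abs_ell2 l) < r" if "n \<ge> N" for n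
    proof -
      have "norm (Abs_ell2 (\<lambda>i. coord (X n) i - l i)) \<le> r/2"
        by (rule bounded_sums_ell2(2)) (use tail[OF N that] \<open>0 < r\<close> in auto)
      moreover have "X n - Abs_ell2 l = Abs_ell2 (\<lambda>i. coord (X n) i - l i)"
        using sl by (simp add: Abs_ell2_inverse minus_ell2.rep_eq flip: coord_inject)
          (subst Abs_ell2_inverse; use square_summable_coord[of "X n - Abs_ell2 l"] in
            \<open>simp add: Abs_ell2_inverse minus_ell2.rep_eq\<close>)
      ultimately show ?thesis
        using \<open>0 < r\<close> by simp
    qed
    then show "\<exists>N. \<forall>n\<ge>N. norm (X n - Abs_ell2 l) < r"
      by blast
  qed
  then show "convergent X"
    by (auto simp: convergent_def)
qed

instantiation ell2 :: (type) complex_normed_space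
begin

lift_definition scaleC_ell2 :: "complex \<Rightarrow> 'i ell2 \<Rightarrow> 'i ell2" is "\<lambda>c f i. c * f i"
  by (rule square_summable_cmult)

instance
proof
  fix c d :: complex and u v :: "'i ell2" and r :: real
  show "c *\<^sub>C (u + v) = c *\<^sub>C u + c *\<^sub>C v" "(c + d) *\<^sub>C u = c *\<^sub>C u + d *\<^sub>C u"
    "c *\<^sub>C d *\<^sub>C u = (c * d) *\<^sub>C u" "complex_of_real r *\<^sub>C u = r *\<^sub>R u"
    by (transfer; simp add: algebra_simps)+
  have "(norm (c *\<^sub>C u))\<^sup>2 = (cmod c * norm u)\<^sup>2"
    unfolding power_mult_distrib norm_ell2_square
    by (simp add: scaleC_ell2.rep_eq norm_mult power_mult_distrib infsum_cmult_right')
  then show "norm (c *\<^sub>C u) = cmod c * norm u"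
    by (simp add: power2_eq_iff_nonneg)
qed

end

lemma cinner_scaleC_right: "cinner u (c *\<^sub>C v) = c * cinner u v"
  by transfer (simp add: mult.left_commute infsum_cmult_right')

lemma cinner_scaleC_left: "cinner (c *\<^sub>C u) v = cnj c * cinner u v"
  by transfer (simp add: mult.assoc infsum_cmult_right')

lemma cmod_cinner_le: "cmod (cinner u v) \<le> norm u * norm v"
proof (cases "cinner u v = 0")
  case False
  define c where "c = cnj (cinner u v) / cmod (cinner u v)"
  have "cinner u (c *\<^sub>C v) = complex_of_real (cmod (cinner u v))"
    using False complex_norm_square[of "cinner u v"]
    by (simp add: cinner_scaleC_right c_def power2_eq_square divide_simps mult.commute)
  then have "cmod (cinner u v) = inner u (c *\<^sub>C v)"
    by (simp add: inner_ell2_def)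
  also have "\<dots> \<le> norm u * norm (c *\<^sub>C v)"
    by (rule norm_cauchy_schwarz)
  also have "norm (c *\<^sub>C v) = norm v"
    using False by (simp add: norm_scaleC c_def norm_divide)
  finally show ?thesis .
qed simp

lift_definition ket :: "'i \<Rightarrow> 'i ell2" is "\<lambda>i k. if k = i then 1 else 0"
proof -
  fix i :: 'i
  show "square_summable (\<lambda>k. if k = i then 1 else 0)"
    unfolding square_summable_def
    by (rule finite_nonzero_values_imp_summable_on) (auto intro: finite_subset[of _ "{i}"])
qed


lemma coord_zero [simp]: "coord 0 i = 0"
  and coord_add [simp]: "coord (u + v) i = coord u i + coord v i"
  and coord_diff [simp]: "coord (u - v) i = coord u i - coord v i"
  and coord_scaleC [simp]: "coord (c *\<^sub>C u) i = c * coord u i"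
  and coord_ket: "coord (ket k) i = (if i = k then 1 else 0)"
  by (simp_all add: zero_ell2.rep_eq plus_ell2.rep_eq minus_ell2.rep_eq scaleC_ell2.rep_eq ket.rep_eq)

lemma coord_sum [simp]: "coord (sum f F) i = (\<Sum>k\<in>F. coord (f k) i)"
  by (induction F rule: infinite_finite_induct) auto

lemma cinner_zero_right [simp]: "cinner u 0 = 0"
  using cinner_add_right[of u 0 0] by simp

lemma cinner_zero_left [simp]: "cinner 0 u = 0"
  by (subst cinner_commute) simp

lemma cinner_sum_right: "cinner u (sum f F) = (\<Sum>k\<in>F. cinner u (f k))"
  by (induction F rule: infinite_finite_induct) (auto simp: cinner_add_right)

lemma cinner_ket_left: "cinner (ket i) u = coord u i"
proof -
  have "cinner (ket i) u = (\<Sum>\<^sub>\<infinity>k. if k = i then coord u i else 0)"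
    unfolding cinner.rep_eq by (intro infsum_cong) (simp add: coord_ket)
  also have "\<dots> = (\<Sum>\<^sub>\<infinity>k\<in>{i}. coord u i)"
    by (rule infsum_cong_neutral) auto
  finally show ?thesis by simp
qed

lemma cinner_ext: "(\<And>w. cinner u w = cinner v w) \<Longrightarrow> u = v"
proof -
  assume "\<And>w. cinner u w = cinner v w"
  then have "cinner w u = cinner w v" for w
    using cinner_commute by metis
  then have "coord u i = coord v i" for i
    by (metis cinner_ket_left)
  then show "u = v"
    by (auto simp flip: coord_inject)
qed

lemma finite_approx:
  fixes u :: "'i ell2"
  assumes "0 < e"
  obtains F where "finite F" "norm (u - (\<Sum>i\<in>F. coord u i *\<^sub>C ket i)) < e"
proof -
  let ?f = "\<lambda>i. (cmod (coord u i))\<^sup>2"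
  have su: "?f summable_on UNIV"
    using square_summable_coord[of u] by (simp add: square_summable_def)
  obtain F where F: "finite F" "dist (sum ?f F) (infsum ?f UNIV) \<le> e\<^sup>2 / 2"
    using infsum_finite_approximation[OF su, of "e\<^sup>2 / 2"] assms by auto
  define v where "v = u - (\<Sum>i\<in>F. coord u i *\<^sub>C ket i)"
  have c: "coord v i = (if i \<in> F then 0 else coord u i)" for i
    using F(1) by (simp add: v_def coord_ket if_distrib cong: if_cong)
  have "(norm v)\<^sup>2 = (\<Sum>\<^sub>\<infinity>i\<in>-F. ?f i)"
    unfolding norm_ell2_square by (rule infsum_cong_neutral) (auto simp: c)
  also have "\<dots> = infsum ?f UNIV - sum ?f F"
    using infsum_Diff[OF su summable_on_finite[OF F(1)]] F(1) by (simp add: Compl_eq_Diff_UNIV)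
  also have "\<dots> \<le> e\<^sup>2 / 2"
    using F(2) unfolding dist_real_def by linarith
  also have "\<dots> < e\<^sup>2"
    using assms by simp
  finally have "norm v < e"
    using assms by (simp add: power_less_imp_less_base)
  then show ?thesis
    using that F(1) by (simp add: v_def)
qed

lifting_forget ell2.lifting

lemma scaleC_zero_right [simp]: "c *\<^sub>C (0 :: 'a::complex_normed_space) = 0"
  using scaleC_add_right[of c "0::'a" 0] by simp

lemma scaleC_minus_right: "c *\<^sub>C (- x) = - (c *\<^sub>C (x :: 'a::complex_normed_space))"
  using scaleC_add_right[of c x "- x"] by (simp add: add_eq_0_iff2)

lemma scaleC_diff_right: "c *\<^sub>C (x - y) = c *\<^sub>C x - c *\<^sub>C (y :: 'a::complex_normed_space)"
  using scaleC_add_right[of c x "- y"] by (simp add: scaleC_minus_right)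

section \<open>Bounded operators as a C*-algebra\<close>

typedef 'i bounded_op = "{T :: 'i ell2 \<Rightarrow>\<^sub>L 'i ell2. \<forall>c v. blinfun_apply T (c *\<^sub>C v) = c *\<^sub>C blinfun_apply T v}"
  morphisms blinfun_of Abs_bounded_op
  by (rule exI[of _ id_blinfun]) simp

setup_lifting type_definition_bounded_op

lift_definition apply_op :: "'i bounded_op \<Rightarrow> 'i ell2 \<Rightarrow> 'i ell2"  (infixr \<open>\<cdot>\<^sub>o\<close> 70) is blinfun_apply .

lemma bounded_op_eqI: "(\<And>v. S \<cdot>\<^sub>o v = T \<cdot>\<^sub>o v) \<Longrightarrow> S = T"
  by transfer (rule blinfun_eqI)

lemma apply_op_scaleC: "T \<cdot>\<^sub>o (c *\<^sub>C v) = c *\<^sub>C (T \<cdot>\<^sub>o v)"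
  by transfer simp

lemma apply_op_add: "T \<cdot>\<^sub>o (u + v) = T \<cdot>\<^sub>o u + T \<cdot>\<^sub>o v"
  by transfer (simp add: blinfun.add_right)

lemma apply_op_diff: "T \<cdot>\<^sub>o (u - v) = T \<cdot>\<^sub>o u - T \<cdot>\<^sub>o v"
  by transfer (simp add: blinfun.diff_right)

lemma apply_op_zero: "T \<cdot>\<^sub>o 0 = 0"
  by transfer simp

lemma apply_op_sum: "T \<cdot>\<^sub>o sum f F = (\<Sum>k\<in>F. T \<cdot>\<^sub>o f k)"
  by transfer (simp add: blinfun.sum_right)

instantiation bounded_op :: (type) real_vector
begin

lift_definition zero_bounded_op :: "'i bounded_op" is 0
  by simp

lift_definition plus_bounded_op :: "'i bounded_op \<Rightarrow> 'i bounded_op \<Rightarrow> 'i bounded_op" is "(+)"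
  by (simp add: blinfun.add_left scaleC_add_right)

lift_definition minus_bounded_op :: "'i bounded_op \<Rightarrow> 'i bounded_op \<Rightarrow> 'i bounded_op" is "(-)"
  by (simp add: blinfun.diff_left scaleC_diff_right)

lift_definition uminus_bounded_op :: "'i bounded_op \<Rightarrow> 'i bounded_op" is uminus
  by (simp add: blinfun.minus_left scaleC_minus_right)

lift_definition scaleR_bounded_op :: "real \<Rightarrow> 'i bounded_op \<Rightarrow> 'i bounded_op" is "(*\<^sub>R)"
  by (simp add: blinfun.scaleR_left scaleC_scaleC mult.commute flip: scaleC_of_real)

instance
  by standard (transfer; simp add: add.assoc add.left_commute scaleR_add_right scaleR_add_left; fail)+

end

instantiation bounded_op :: (type) real_normed_vector
begin

lift_definition norm_bounded_op :: "'i bounded_op \<Rightarrow> real" is norm .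

definition dist_bounded_op :: "'i bounded_op \<Rightarrow> 'i bounded_op \<Rightarrow> real" where
  "dist_bounded_op S T = norm (S - T)"

definition sgn_bounded_op :: "'i bounded_op \<Rightarrow> 'i bounded_op" where
  "sgn_bounded_op T = T /\<^sub>R norm T"

definition uniformity_bounded_op :: "('i bounded_op \<times> 'i bounded_op) filter" where
  "uniformity_bounded_op = (INF e\<in>{0<..}. principal {(x, y). dist x y < e})"

definition open_bounded_op :: "'i bounded_op set \<Rightarrow> bool" where
  "open_bounded_op U \<longleftrightarrow> (\<forall>x\<in>U. \<forall>\<^sub>F (x', y) in uniformity. x' = x \<longrightarrow> y \<in> U)"

instance
proof
  fix S T :: "'i bounded_op" and a :: real
  show "norm (S + T) \<le> norm S + norm T"
    by transfer (rule norm_triangle_ineq)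
  show "norm T = 0 \<longleftrightarrow> T = 0" "norm (a *\<^sub>R T) = \<bar>a\<bar> * norm T"
    by (transfer; simp)+
qed (simp_all add: dist_bounded_op_def sgn_bounded_op_def uniformity_bounded_op_def open_bounded_op_def)

end

instance bounded_op :: (type) banach
proof
  fix X :: "nat \<Rightarrow> 'i bounded_op"
  assume "Cauchy X"
  then have "Cauchy (\<lambda>n. blinfun_of (X n))"
    by (simp add: Cauchy_iff flip: minus_bounded_op.rep_eq norm_bounded_op.rep_eq)
  then obtain L where L: "(\<lambda>n. blinfun_of (X n)) \<longlonglongrightarrow> L"
    using Cauchy_convergent convergent_def by blast
  have pw: "(\<lambda>n. blinfun_of (X n) v) \<longlonglongrightarrow> L v" for v
    by (intro blinfun.tendsto L tendsto_const)
  have lim_scaleC: "(\<lambda>n. c *\<^sub>C f n) \<longlonglongrightarrow> c *\<^sub>C l" if "f \<longlonglongrightarrow> l" for c l and f :: "nat \<Rightarrow> 'i ell2"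
  proof -
    have "(\<lambda>n. cmod c * norm (f n - l)) \<longlonglongrightarrow> cmod c * 0"
      using that by (intro tendsto_intros) (simp add: LIM_zero tendsto_norm_zero)
    then have "(\<lambda>n. norm (c *\<^sub>C f n - c *\<^sub>C l)) \<longlonglongrightarrow> 0"
      by (simp add: norm_scaleC flip: scaleC_diff_right)
    then show ?thesis
      using LIM_zero_iff tendsto_norm_zero_iff by blast
  qed
  have "L (c *\<^sub>C v) = c *\<^sub>C L v" for c v
  proof (rule LIMSEQ_unique)
    show "(\<lambda>n. blinfun_of (X n) (c *\<^sub>C v)) \<longlonglongrightarrow> L (c *\<^sub>C v)"
      by (rule pw)
    have "blinfun_of (X n) (c *\<^sub>C v) = c *\<^sub>C blinfun_of (X n) v" for n
      using blinfun_of[of "X n"] by simp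
    then show "(\<lambda>n. blinfun_of (X n) (c *\<^sub>C v)) \<longlonglongrightarrow> c *\<^sub>C L v"
      using lim_scaleC[OF pw] by simp
  qed
  then have "L = blinfun_of (Abs_bounded_op L)"
    by (simp add: Abs_bounded_op_inverse)
  with L have "(\<lambda>n. norm (blinfun_of (X n) - blinfun_of (Abs_bounded_op L))) \<longlonglongrightarrow> 0"
    using LIM_zero_iff tendsto_norm_zero by metis
  then have "(\<lambda>n. norm (X n - Abs_bounded_op L)) \<longlonglongrightarrow> 0"
    by (simp add: minus_bounded_op.rep_eq norm_bounded_op.rep_eq)
  then have "X \<longlonglongrightarrow> Abs_bounded_op L"
    using LIM_zero_iff tendsto_norm_zero_iff by blast
  then show "convergent X"
    by (auto simp: convergent_def)
qed

instantiation bounded_op :: (type) real_normed_algebra_1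
begin

lift_definition one_bounded_op :: "'i bounded_op" is id_blinfun
  by simp

lift_definition times_bounded_op :: "'i bounded_op \<Rightarrow> 'i bounded_op \<Rightarrow> 'i bounded_op" is "(o\<^sub>L)"
  by simp

lemma nontrivial_ell2: "(ket i :: 'i ell2) \<noteq> 0"
  by (metis coord_ket coord_zero zero_neq_one)

instance
proof
  fix S T U :: "'i bounded_op" and a :: real
  show "S * T * U = S * (T * U)" "(S + T) * U = S * U + T * U" "S * (T + U) = S * T + S * U"
    "1 * S = S" "S * 1 = S" "a *\<^sub>R S * T = a *\<^sub>R (S * T)" "S * a *\<^sub>R T = a *\<^sub>R (S * T)"
    by (transfer; auto intro!: blinfun_eqI simp: blinfun.bilinear_simps)+
  define v :: "'i ell2" where "v = ket undefined"
  have v: "v \<noteq> 0"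
    unfolding v_def by (rule nontrivial_ell2)
  have "(0 :: 'i ell2 \<Rightarrow>\<^sub>L 'i ell2) \<noteq> id_blinfun"
  proof
    assume "(0 :: 'i ell2 \<Rightarrow>\<^sub>L 'i ell2) = id_blinfun"
    then have "blinfun_apply 0 v = blinfun_apply id_blinfun v"
      by (rule arg_cong)
    with v show False by simp
  qed
  then show "(0::'i bounded_op) \<noteq> 1"
    by transfer
  show "norm (S * T) \<le> norm S * norm T"
    by transfer (rule norm_blinfun_compose)
  have "norm (id_blinfun :: 'i ell2 \<Rightarrow>\<^sub>L 'i ell2) = 1"
  proof (rule antisym)
    show "norm (id_blinfun :: 'i ell2 \<Rightarrow>\<^sub>L 'i ell2) \<le> 1"
      by (rule norm_blinfun_bound) auto
    show "1 \<le> norm (id_blinfun :: 'i ell2 \<Rightarrow>\<^sub>L 'i ell2)"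
      using norm_blinfun[of id_blinfun v] v by simp
  qed
  then show "norm (1::'i bounded_op) = 1"
    by transfer
qed

end

lemma apply_op_simps [simp]:
  "(0 :: 'i bounded_op) \<cdot>\<^sub>o v = 0"
  "(1 :: 'i bounded_op) \<cdot>\<^sub>o v = v"
  "(S + T) \<cdot>\<^sub>o v = S \<cdot>\<^sub>o v + T \<cdot>\<^sub>o v"
  "(S - T) \<cdot>\<^sub>o v = S \<cdot>\<^sub>o v - T \<cdot>\<^sub>o v"
  "(S * T) \<cdot>\<^sub>o v = S \<cdot>\<^sub>o T \<cdot>\<^sub>o v"
  by (transfer; simp add: blinfun.bilinear_simps)+

lemma norm_apply_op_le: "norm (T \<cdot>\<^sub>o v) \<le> norm T * norm v"
  by transfer (rule norm_blinfun)

lemma norm_op_bound: "0 \<le> b \<Longrightarrow> (\<And>v. norm (T \<cdot>\<^sub>o v) \<le> b * norm v) \<Longrightarrow> norm T \<le> b"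
  by transfer (rule norm_blinfun_bound)

lemma op_of_bounded_linear:
  fixes f :: "'i ell2 \<Rightarrow> 'i ell2"
  assumes "\<And>u v. f (u + v) = f u + f v" "\<And>c v. f (c *\<^sub>C v) = c *\<^sub>C f v"
    and "\<And>v. norm (f v) \<le> b * norm v"
  shows "\<exists>T. \<forall>v. T \<cdot>\<^sub>o v = f v"
proof -
  have "bounded_linear f"
    by (rule bounded_linear_intro[where K=b])
       (use assms in \<open>simp_all add: mult.commute flip: scaleC_of_real\<close>)
  then have "blinfun_apply (Blinfun f) = f"
    by (rule bounded_linear_Blinfun_apply)
  with assms(2) have "apply_op (Abs_bounded_op (Blinfun f)) v = f v" for v
    by (simp add: apply_op.rep_eq Abs_bounded_op_inverse)
  then show ?thesis by blast
qed

lemma adjoint_exists: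
  fixes T :: "'i bounded_op"
  shows "\<exists>S. \<forall>v w. cinner (S \<cdot>\<^sub>o v) w = cinner v (T \<cdot>\<^sub>o w)"
proof -
  define g where "g v i = cinner (T \<cdot>\<^sub>o ket i) v" for v i
  have bnd: "(\<Sum>i\<in>F. (cmod (g v i))\<^sup>2) \<le> (norm T * norm v)\<^sup>2" if F: "finite F" for F v
  proof -
    define s where "s = (\<Sum>i\<in>F. (cmod (g v i))\<^sup>2)"
    define h where "h = (\<Sum>i\<in>F. g v i *\<^sub>C ket i)"
    have ch: "coord h i = (if i \<in> F then g v i else 0)" for i
      using F by (simp add: h_def coord_ket if_distrib cong: if_cong)
    have nh: "(norm h)\<^sup>2 = s"
    proof -
      have "(norm h)\<^sup>2 = (\<Sum>\<^sub>\<infinity>i\<in>F. (cmod (g v i))\<^sup>2)"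
        unfolding norm_ell2_square by (rule infsum_cong_neutral) (auto simp: ch)
      then show ?thesis using F by (simp add: s_def)
    qed
    have "cinner v (T \<cdot>\<^sub>o h) = (\<Sum>i\<in>F. g v i * cinner v (T \<cdot>\<^sub>o ket i))"
      by (simp add: h_def apply_op_sum cinner_sum_right apply_op_scaleC cinner_scaleC_right)
    also have "\<dots> = complex_of_real s"
    proof -
      have "cinner v (T \<cdot>\<^sub>o ket i) = cnj (g v i)" for i
        unfolding g_def by (rule cinner_commute)
      then show ?thesis
        unfolding s_def of_real_sum by (intro sum.cong) (simp_all add: complex_norm_square[symmetric])
    qed
    finally have "cmod (cinner v (T \<cdot>\<^sub>o h)) = \<bar>s\<bar>"
      by (simp only: norm_of_real)
    then have "s = cmod (cinner v (T \<cdot>\<^sub>o h))"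
      by (simp add: s_def sum_nonneg)
    also have "\<dots> \<le> norm v * norm (T \<cdot>\<^sub>o h)"
      by (rule cmod_cinner_le)
    also have "\<dots> \<le> norm v * (norm T * norm h)"
      by (intro mult_left_mono norm_apply_op_le) simp
    finally have le: "(norm h)\<^sup>2 \<le> (norm T * norm v) * norm h"
      by (simp add: nh mult_ac)
    have "norm h \<le> norm T * norm v"
    proof (cases "norm h = 0")
      case False
      then have "0 < norm h" by simp
      with le show ?thesis by (simp add: power2_eq_square)
    qed simp
    then have "(norm h)\<^sup>2 \<le> (norm T * norm v)\<^sup>2"
      by (intro power_mono) auto
    then show ?thesis
      by (simp add: nh s_def)
  qed
  define f where "f v = Abs_ell2 (g v)" for v
  have f: "coord (f v) i = g v i" "norm (f v) \<le> norm T * norm v" for v i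
    using bounded_sums_ell2[OF bnd] by (auto simp: f_def Abs_ell2_inverse)
  have "\<exists>S. \<forall>v. S \<cdot>\<^sub>o v = f v"
  proof (rule op_of_bounded_linear[where b="norm T"])
    show "f (u + v) = f u + f v" "f (c *\<^sub>C v) = c *\<^sub>C f v" for u v c
      by (simp_all flip: coord_inject add: fun_eq_iff f g_def cinner_add_right cinner_scaleC_right)
  qed (rule f)
  then obtain S where S: "\<And>v. S \<cdot>\<^sub>o v = f v"
    by blast
  have "cinner (f v) w = cinner v (T \<cdot>\<^sub>o w)" for v w
  proof -
    define h where "h w = cinner (f v) w - cinner v (T \<cdot>\<^sub>o w)" for w
    have hk: "h (ket i) = 0" for i
    proof -
      have "cinner (f v) (ket i) = cnj (g v i)"
        by (subst cinner_commute) (simp add: cinner_ket_left f)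
      then show ?thesis
        unfolding h_def g_def by (subst (2) cinner_commute) simp
    qed
    have hb: "cmod (h u) \<le> 2 * norm T * norm v * norm u" for u
    proof -
      have "cmod (cinner (f v) u) \<le> norm T * norm v * norm u"
        by (rule order_trans[OF cmod_cinner_le]) (intro mult_right_mono f, simp)
      moreover have "cmod (cinner v (T \<cdot>\<^sub>o u)) \<le> norm v * (norm T * norm u)"
        by (rule order_trans[OF cmod_cinner_le]) (intro mult_left_mono norm_apply_op_le, simp)
      ultimately show ?thesis
        unfolding h_def using norm_triangle_ineq4[of "cinner (f v) u" "cinner v (T \<cdot>\<^sub>o u)"]
        by (simp add: mult_ac)
    qed
    have "cmod (h w) \<le> 0 + e" if "0 < e" for e
    proof -
      define C where "C = 2 * norm T * norm v + 1"
      have C: "0 < C" by (simp add: C_def add_nonneg_pos)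
      obtain F where F: "finite F" "norm (w - (\<Sum>i\<in>F. coord w i *\<^sub>C ket i)) < e / C"
        using finite_approx[of "e / C"] C \<open>0 < e\<close> by auto
      let ?s = "\<Sum>i\<in>F. coord w i *\<^sub>C ket i"
      have "h ?s = (\<Sum>i\<in>F. coord w i * cinner (f v) (ket i)) - (\<Sum>i\<in>F. coord w i * cinner v (T \<cdot>\<^sub>o ket i))"
        by (simp add: h_def apply_op_sum apply_op_scaleC cinner_sum_right cinner_scaleC_right)
      also have "\<dots> = (\<Sum>i\<in>F. coord w i * h (ket i))"
        by (simp only: h_def right_diff_distrib sum_subtractf)
      finally have "h ?s = (\<Sum>i\<in>F. coord w i * h (ket i))" .
      then have "h ?s = 0" by (simp add: hk)
      moreover have "h w = h (w - ?s) + h ?s"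
        using cinner_add_right[of "f v" "w - ?s" ?s] cinner_add_right[of v "T \<cdot>\<^sub>o (w - ?s)" "T \<cdot>\<^sub>o ?s"]
        by (simp add: h_def flip: apply_op_add)
      ultimately have "cmod (h w) \<le> 2 * norm T * norm v * norm (w - ?s)"
        using hb[of "w - ?s"] by simp
      also have "\<dots> \<le> C * norm (w - ?s)"
        by (intro mult_right_mono) (auto simp: C_def)
      also have "\<dots> \<le> e"
        using F(2) C by (simp add: pos_less_divide_eq mult.commute less_imp_le)
      finally show ?thesis by simp
    qed
    then have "cmod (h w) \<le> 0"
      by (rule field_le_epsilon)
    then show ?thesis by (simp add: h_def)
  qed
  then have "\<forall>v w. cinner (S \<cdot>\<^sub>o v) w = cinner v (T \<cdot>\<^sub>o w)"
    by (simp add: S)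
  then show ?thesis ..
qed

instantiation bounded_op :: (type) complex_normed_space
begin

definition scaleC_bounded_op :: "complex \<Rightarrow> 'i bounded_op \<Rightarrow> 'i bounded_op" where
  "scaleC_bounded_op c T = (THE S. \<forall>v. S \<cdot>\<^sub>o v = c *\<^sub>C (T \<cdot>\<^sub>o v))"

lemma scaleC_op_apply [simp]: "(c *\<^sub>C T :: 'i bounded_op) \<cdot>\<^sub>o v = c *\<^sub>C (T \<cdot>\<^sub>o v)"
proof -
  have "\<exists>S. \<forall>v. S \<cdot>\<^sub>o v = c *\<^sub>C (T \<cdot>\<^sub>o v)"
  proof (rule op_of_bounded_linear[where b="cmod c * norm T"])
    show "norm (c *\<^sub>C (T \<cdot>\<^sub>o v)) \<le> cmod c * norm T * norm v" for v
      using mult_left_mono[OF norm_apply_op_le[of T v], of "cmod c"] by (simp add: norm_scaleC mult_ac)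
  qed (simp_all add: apply_op_add apply_op_scaleC scaleC_add_right scaleC_scaleC mult.commute)
  then have "\<exists>!S. \<forall>v. S \<cdot>\<^sub>o v = c *\<^sub>C (T \<cdot>\<^sub>o v)"
    by (metis bounded_op_eqI)
  from theI'[OF this] show ?thesis
    unfolding scaleC_bounded_op_def by blast
qed

lemma scaleR_op_apply: "(r *\<^sub>R T :: 'i bounded_op) \<cdot>\<^sub>o v = r *\<^sub>R (T \<cdot>\<^sub>o v)"
  by transfer (simp add: blinfun.scaleR_left)

instance
proof
  fix c d :: complex and S T :: "'i bounded_op" and r :: real
  show "c *\<^sub>C (S + T) = c *\<^sub>C S + c *\<^sub>C T" "(c + d) *\<^sub>C S = c *\<^sub>C S + d *\<^sub>C S"
    "c *\<^sub>C d *\<^sub>C S = (c * d) *\<^sub>C S" "complex_of_real r *\<^sub>C S = r *\<^sub>R S"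
    by (rule bounded_op_eqI;
        simp add: scaleC_add_right scaleC_add_left scaleC_scaleC scaleC_of_real scaleR_op_apply)+
  have le: "norm (c *\<^sub>C S) \<le> cmod c * norm S" for c and S :: "'i bounded_op"
  proof (rule norm_op_bound)
    show "norm ((c *\<^sub>C S) \<cdot>\<^sub>o v) \<le> cmod c * norm S * norm v" for v
      using mult_left_mono[OF norm_apply_op_le[of S v], of "cmod c"] by (simp add: norm_scaleC mult_ac)
  qed simp
  show "norm (c *\<^sub>C S) = cmod c * norm S"
  proof (cases "c = 0")
    case True
    then show ?thesis using le[of 0 S] by simp
  next
    case False
    have "inverse c *\<^sub>C c *\<^sub>C S = S"
      using False by (intro bounded_op_eqI) (simp add: scaleC_scaleC scaleC_of_real[of 1, simplified])
    then have "norm S \<le> inverse (cmod c) * norm (c *\<^sub>C S)"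
      using le[of "inverse c" "c *\<^sub>C S"] by (simp add: norm_inverse)
    then have "cmod c * norm S \<le> norm (c *\<^sub>C S)"
      using False by (simp add: field_simps)
    then show ?thesis using le[of c S] by simp
  qed
qed

end

instantiation bounded_op :: (type) cstar_algebra
begin

definition star_bounded_op :: "'i bounded_op \<Rightarrow> 'i bounded_op" where
  "star_bounded_op T = (THE S. \<forall>v w. cinner (S \<cdot>\<^sub>o v) w = cinner v (T \<cdot>\<^sub>o w))"

lemma cinner_star_left: "cinner (star T \<cdot>\<^sub>o v) w = cinner v ((T :: 'i bounded_op) \<cdot>\<^sub>o w)"
proof -
  have "\<exists>!S. \<forall>v w. cinner (S \<cdot>\<^sub>o v) w = cinner v (T \<cdot>\<^sub>o w)"
    using adjoint_exists[of T] by (metis bounded_op_eqI cinner_ext)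
  from theI'[OF this] show ?thesis
    unfolding star_bounded_op_def by blast
qed

lemma cinner_star_right: "cinner v (star T \<cdot>\<^sub>o w) = cinner ((T :: 'i bounded_op) \<cdot>\<^sub>o v) w"
  by (metis cinner_commute cinner_star_left)

instance
proof
  fix S T :: "'i bounded_op" and c :: complex
  show "c *\<^sub>C S * T = c *\<^sub>C (S * T)" "S * c *\<^sub>C T = c *\<^sub>C (S * T)"
    by (rule bounded_op_eqI; simp add: apply_op_scaleC)+
  show "star (star T) = T" "star (S + T) = star S + star T" "star (c *\<^sub>C T) = cnj c *\<^sub>C star T"
    "star (S * T) = star T * star S"
    by (rule bounded_op_eqI, rule cinner_ext,
        simp add: cinner_star_left cinner_star_right cinner_add_left cinner_add_right
          cinner_scaleC_left cinner_scaleC_right)+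
  have le: "(norm T)\<^sup>2 \<le> norm (star T * T)" for T :: "'i bounded_op"
  proof -
    have "norm T \<le> sqrt (norm (star T * T))"
    proof (rule norm_op_bound)
      fix v :: "'i ell2"
      have "(norm (T \<cdot>\<^sub>o v))\<^sup>2 = Re (cinner v ((star T * T) \<cdot>\<^sub>o v))"
        by (simp add: power2_norm_eq_inner inner_ell2_def cinner_star_right)
      also have "\<dots> \<le> cmod (cinner v ((star T * T) \<cdot>\<^sub>o v))"
        by (rule complex_Re_le_cmod)
      also have "\<dots> \<le> norm v * norm ((star T * T) \<cdot>\<^sub>o v)"
        by (rule cmod_cinner_le)
      also have "\<dots> \<le> norm v * (norm (star T * T) * norm v)"
        by (intro mult_left_mono norm_apply_op_le) simp
      also have "\<dots> = (sqrt (norm (star T * T)) * norm v)\<^sup>2"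
        by (simp add: power_mult_distrib) (simp add: power2_eq_square)
      finally show "norm (T \<cdot>\<^sub>o v) \<le> sqrt (norm (star T * T)) * norm v"
        by (rule power2_le_imp_le) simp
    qed simp
    then have "(norm T)\<^sup>2 \<le> (sqrt (norm (star T * T)))\<^sup>2"
      by (rule power_mono) simp
    then show ?thesis by simp
  qed
  have star_le: "norm T \<le> norm (star T)" for T :: "'i bounded_op"
  proof (cases "norm T = 0")
    case False
    have "norm T * norm T \<le> norm (star T) * norm T"
      using le[of T] norm_mult_ineq[of "star T" T] by (simp add: power2_eq_square)
    with False show ?thesis
      by (simp add: mult_le_cancel_right)
  qed (metis norm_ge_zero)
  have "norm (star T) = norm T"
    using star_le[of T] star_le[of "star T"] \<open>star (star T) = T\<close> by simp
  then show "norm (star T * T) = (norm T)\<^sup>2"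
    using le[of T] norm_mult_ineq[of "star T" T] by (simp add: power2_eq_square)
qed

end

section \<open>The C*-algebra of the quantum group\<close>

definition star_hom :: "('a::cstar_algebra \<Rightarrow> 'b::cstar_algebra) \<Rightarrow> bool" where
  "star_hom \<phi> \<longleftrightarrow> (\<forall>x y. \<phi> (x + y) = \<phi> x + \<phi> y) \<and> (\<forall>x y. \<phi> (x * y) = \<phi> x * \<phi> y)
    \<and> (\<forall>c x. \<phi> (c *\<^sub>C x) = c *\<^sub>C \<phi> x) \<and> (\<forall>x. \<phi> (star x) = star (\<phi> x)) \<and> \<phi> 1 = 1"

inductive_set star_subalgebra :: "'a::cstar_algebra set \<Rightarrow> 'a set" for S where
  generator: "x \<in> S \<Longrightarrow> x \<in> star_subalgebra S"
| unit: "1 \<in> star_subalgebra S"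
| add: "x \<in> star_subalgebra S \<Longrightarrow> y \<in> star_subalgebra S \<Longrightarrow> x + y \<in> star_subalgebra S"
| mult: "x \<in> star_subalgebra S \<Longrightarrow> y \<in> star_subalgebra S \<Longrightarrow> x * y \<in> star_subalgebra S"
| scaleC: "x \<in> star_subalgebra S \<Longrightarrow> c *\<^sub>C x \<in> star_subalgebra S"
| star: "x \<in> star_subalgebra S \<Longrightarrow> star x \<in> star_subalgebra S"

definition SUq2_relations :: "real \<Rightarrow> 'a::cstar_algebra \<Rightarrow> 'a \<Rightarrow> bool" where
  "SUq2_relations q \<alpha> \<beta> \<longleftrightarrow>
     star \<alpha> * \<alpha> + star \<beta> * \<beta> = 1 \<and>
     \<alpha> * star \<alpha> + q\<^sup>2 *\<^sub>R (\<beta> * star \<beta>) = 1 \<and>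
     \<alpha> * \<beta> = q *\<^sub>R (\<beta> * \<alpha>) \<and>
     \<alpha> * star \<beta> = q *\<^sub>R (star \<beta> * \<alpha>) \<and>
     star \<beta> * \<beta> = \<beta> * star \<beta>"

text \<open>
  The universal property cannot quantify over all C*-algebras (types) as targets, and it does not
  have to: a C*-algebra generated by two elements is separable, hence is isomorphic to a C*-subalgebra
  of the bounded operators on a fixed infinite-dimensional separable Hilbert space. So it suffices to
  map into the bounded operators on the square summable families over \<open>nat \<times> int\<close>;
  uniqueness of the homomorphism follows from the density of the *-subalgebra.
\<close>

definition universal_SUq2 :: "real \<Rightarrow> 'a::cstar_algebra \<Rightarrow> 'a \<Rightarrow> bool" where
  "universal_SUq2 q \<alpha> \<beta> \<longleftrightarrow>
     SUq2_relations q \<alpha> \<beta> \<and> closure (star_subalgebra {\<alpha>, \<beta>}) = UNIV \<and>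
     (\<forall>a b :: (nat \<times> int) bounded_op. SUq2_relations q a b \<longrightarrow>
        (\<exists>\<phi>. star_hom \<phi> \<and> \<phi> \<alpha> = a \<and> \<phi> \<beta> = b))"

definition signed_power :: "'a::cstar_algebra \<Rightarrow> int \<Rightarrow> 'a" where
  "signed_power a i = (if 0 \<le> i then a ^ nat i else star a ^ nat (- i))"

text \<open>
  The basis vector \<open>e\<^sub>i \<otimes> e\<^sub>j\<close> of \<open>L\<^sub>2(\<nat>) \<otimes> L\<^sub>2(\<int>)\<close> is \<open>ket (i, j)\<close>, and the bounded operators
  \<open>\<ell>\<surd>(I - q\<^bsup>2N\<^esup>) \<otimes> I\<close> and \<open>q\<^sup>N \<otimes> \<ell>\<close> are determined by their values on these vectors.
\<close>

definition SUq2_representation ::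
    "real \<Rightarrow> 'a::cstar_algebra \<Rightarrow> 'a \<Rightarrow> ('a \<Rightarrow> (nat \<times> int) bounded_op) \<Rightarrow> bool" where
  "SUq2_representation q \<alpha> \<beta> \<pi> \<longleftrightarrow> star_hom \<pi> \<and> inj \<pi> \<and>
     (\<forall>i j. \<pi> \<alpha> \<cdot>\<^sub>o ket (i, j) =
        (if i = 0 then 0 else complex_of_real (sqrt (1 - q ^ (2 * i))) *\<^sub>C ket (i - 1, j))) \<and>
     (\<forall>i j. \<pi> \<beta> \<cdot>\<^sub>o ket (i, j) = complex_of_real (q ^ i) *\<^sub>C ket (i, j - 1))"

section \<open>Laurent polynomials\<close>

text \<open>The ring \<open>\<complex>[z, z\<^sup>-\<^sup>1]\<close> is \<^typ>\<open>int \<Rightarrow>\<^sub>0 complex\<close>; the monomial \<open>c z\<^sup>i\<close> is \<^term>\<open>Poly_Mapping.single i c\<close>.\<close>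

type_synonym laurent = "int \<Rightarrow>\<^sub>0 complex"

definition laurent_star :: "laurent \<Rightarrow> laurent" where
  "laurent_star p = (\<Sum>i\<in>Poly_Mapping.keys p. Poly_Mapping.single (- i) (cnj (Poly_Mapping.lookup p i)))"

definition circle_restriction :: "'a::cstar_algebra \<Rightarrow> 'a \<Rightarrow> ('a \<Rightarrow> laurent) \<Rightarrow> bool" where
  "circle_restriction \<alpha> \<beta> \<sigma> \<longleftrightarrow>
     (let A = star_subalgebra {\<alpha>, \<beta>} in
       (\<forall>a\<in>A. \<forall>b\<in>A. \<sigma> (a + b) = \<sigma> a + \<sigma> b \<and> \<sigma> (a * b) = \<sigma> a * \<sigma> b) \<and>
       (\<forall>a\<in>A. \<forall>c. \<sigma> (c *\<^sub>C a) = Poly_Mapping.single 0 c * \<sigma> a) \<and>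
       (\<forall>a\<in>A. \<sigma> (star a) = laurent_star (\<sigma> a)) \<and>
       \<sigma> 1 = 1 \<and> \<sigma> \<alpha> = Poly_Mapping.single 1 1 \<and> \<sigma> \<beta> = 0 \<and> \<sigma> ` A = UNIV)"

section \<open>The Dirac operator\<close>

definition dirac_eigenvalue :: "nat \<times> int \<Rightarrow> int" where
  "dirac_eigenvalue = (\<lambda>(i, j). int i * (if 0 \<le> j then 1 else - 1) + j)"

text \<open>\<open>D = N \<otimes> S + I \<otimes> N\<close> is the self-adjoint operator that is diagonal in the basis \<open>e\<^sub>i\<^sub>j\<close>.\<close>

definition dirac_coord :: "(nat \<times> int) ell2 \<Rightarrow> nat \<times> int \<Rightarrow> complex" where
  "dirac_coord v k = of_int (dirac_eigenvalue k) * coord v k"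

definition dirac_domain :: "(nat \<times> int) ell2 set" where
  "dirac_domain = {v. square_summable (dirac_coord v)}"

definition dirac :: "(nat \<times> int) ell2 \<Rightarrow> (nat \<times> int) ell2" where
  "dirac v = Abs_ell2 (dirac_coord v)"

text \<open>The bounded extension of \<open>[D, T]\<close> from its natural domain.\<close>

definition dirac_commutator :: "(nat \<times> int) bounded_op \<Rightarrow> (nat \<times> int) bounded_op" where
  "dirac_commutator T = (THE B. \<forall>v\<in>dirac_domain. T \<cdot>\<^sub>o v \<in> dirac_domain \<longrightarrow>
     B \<cdot>\<^sub>o v = dirac (T \<cdot>\<^sub>o v) - T \<cdot>\<^sub>o dirac v)"

text \<open>The operator \<open>e\<^bsup>-\<epsilon>D\<^sup>2\<^esup>\<close>, for \<open>\<epsilon> > 0\<close>.\<close>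

definition heat :: "real \<Rightarrow> (nat \<times> int) bounded_op" where
  "heat \<epsilon> = (THE T. \<forall>v k. coord (T \<cdot>\<^sub>o v) k =
     complex_of_real (exp (- \<epsilon> * (of_int (dirac_eigenvalue k))\<^sup>2)) * coord v k)"

definition op_trace :: "'i bounded_op \<Rightarrow> complex" where
  "op_trace T = (\<Sum>\<^sub>\<infinity>k. cinner (ket k) (T \<cdot>\<^sub>o ket k))"

definition generalized_limit :: "((real \<Rightarrow> complex) \<Rightarrow> complex) \<Rightarrow> bool" where
  "generalized_limit L \<longleftrightarrow>
     (\<forall>f g. bounded (f ` {0<..}) \<longrightarrow> bounded (g ` {0<..}) \<longrightarrow> L (\<lambda>\<epsilon>. f \<epsilon> + g \<epsilon>) = L f + L g) \<and>
     (\<forall>f c. bounded (f ` {0<..}) \<longrightarrow> L (\<lambda>\<epsilon>. c * f \<epsilon>) = c * L f) \<and>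
     (\<forall>h :: real \<Rightarrow> real. bounded (h ` {0<..}) \<longrightarrow> (\<forall>\<epsilon>>0. 0 \<le> h \<epsilon>) \<longrightarrow>
        (\<exists>r\<ge>0. L (\<lambda>\<epsilon>. complex_of_real (h \<epsilon>)) = complex_of_real r)) \<and>
     (\<forall>f l. bounded (f ` {0<..}) \<longrightarrow> (f \<longlongrightarrow> l) (at_right 0) \<longrightarrow> L f = l)"

section \<open>The universal graded differential algebra\<close>

text \<open>
  The universal differential graded algebra over a unital algebra \<open>A\<close> is presented by generators
  \<open>a\<close> and \<open>\<delta>a\<close> for \<open>a \<in> A\<close>, subject to the relations saying that \<open>A\<close> embeds as a unital algebra
  and that \<open>\<delta>\<close> is a linear derivation. Words in the generators form a free monoid under
  concatenation, so the finitely supported functions on them, with convolution, are the free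
  complex algebra.
\<close>

instantiation list :: (type) monoid_add
begin

definition zero_list :: "'a list" where "zero_list = []"
definition plus_list :: "'a list \<Rightarrow> 'a list \<Rightarrow> 'a list" where "plus_list = (@)"

instance
  by standard (simp_all add: zero_list_def plus_list_def)

end

datatype 'a letter = Elem 'a | Diff 'a

type_synonym 'a expr = "'a letter list \<Rightarrow>\<^sub>0 complex"

definition gen :: "'a letter \<Rightarrow> 'a expr" where
  "gen l = Poly_Mapping.single [l] 1"

definition scal :: "complex \<Rightarrow> 'a expr \<Rightarrow> 'a expr" where
  "scal c x = Poly_Mapping.single [] c * x"

definition free_ring :: "'a set \<Rightarrow> 'a expr ring" where
  "free_ring A = \<lparr>carrier = {x. \<forall>w\<in>Poly_Mapping.keys x. set w \<subseteq> Elem ` A \<union> Diff ` A},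
     mult = (*), one = 1, zero = 0, add = (+)\<rparr>"

inductive_set dga_relations :: "'a::cstar_algebra set \<Rightarrow> 'a expr set" for A where
  "a \<in> A \<Longrightarrow> b \<in> A \<Longrightarrow> gen (Elem (a + b)) - (gen (Elem a) + gen (Elem b)) \<in> dga_relations A"
| "a \<in> A \<Longrightarrow> gen (Elem (c *\<^sub>C a)) - scal c (gen (Elem a)) \<in> dga_relations A"
| "a \<in> A \<Longrightarrow> b \<in> A \<Longrightarrow> gen (Elem (a * b)) - gen (Elem a) * gen (Elem b) \<in> dga_relations A"
| "gen (Elem 1) - 1 \<in> dga_relations A"
| "a \<in> A \<Longrightarrow> b \<in> A \<Longrightarrow> gen (Diff (a + b)) - (gen (Diff a) + gen (Diff b)) \<in> dga_relations A"
| "a \<in> A \<Longrightarrow> gen (Diff (c *\<^sub>C a)) - scal c (gen (Diff a)) \<in> dga_relations A"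
| "a \<in> A \<Longrightarrow> b \<in> A \<Longrightarrow>
     gen (Diff (a * b)) - (gen (Elem a) * gen (Diff b) + gen (Diff a) * gen (Elem b)) \<in> dga_relations A"

definition dga_ideal :: "'a::cstar_algebra set \<Rightarrow> 'a expr set" where
  "dga_ideal A = Idl\<^bsub>free_ring A\<^esub> (dga_relations A)"

definition Omega :: "'a::cstar_algebra set \<Rightarrow> 'a expr set ring" where
  "Omega A = free_ring A Quot dga_ideal A"

definition expr_class :: "'a::cstar_algebra set \<Rightarrow> 'a expr \<Rightarrow> 'a expr set" where
  "expr_class A x = dga_ideal A +>\<^bsub>free_ring A\<^esub> x"

definition elem_form :: "'a::cstar_algebra set \<Rightarrow> 'a \<Rightarrow> 'a expr set" where
  "elem_form A a = expr_class A (gen (Elem a))"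

fun word_diff :: "'a letter list \<Rightarrow> 'a expr" where
  "word_diff [] = 0"
| "word_diff (Elem a # w) = gen (Diff a) * Poly_Mapping.single w 1 + gen (Elem a) * word_diff w"
| "word_diff (Diff a # w) = - (gen (Diff a) * word_diff w)"

definition expr_diff :: "'a expr \<Rightarrow> 'a expr" where
  "expr_diff x = (\<Sum>w\<in>Poly_Mapping.keys x. scal (Poly_Mapping.lookup x w) (word_diff w))"

text \<open>As for the product in \<^const>\<open>FactRing\<close>, the maps out of the quotient below are unions over all representatives.\<close>

definition delta :: "'a::cstar_algebra set \<Rightarrow> 'a expr set \<Rightarrow> 'a expr set" where
  "delta A \<omega> = (\<Union>x\<in>\<omega>. expr_class A (expr_diff x))"

definition elementary_form :: "'a::cstar_algebra set \<Rightarrow> 'a \<Rightarrow> 'a list \<Rightarrow> 'a expr set" where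
  "elementary_form A a0 as =
     foldl (\<lambda>\<omega> a. \<omega> \<otimes>\<^bsub>Omega A\<^esub> delta A (elem_form A a)) (elem_form A a0) as"

text \<open>Complex scalars can be absorbed into \<open>a\<^sub>0\<close>, so the complex span is the additive span.\<close>

definition Omega_deg :: "'a::cstar_algebra set \<Rightarrow> nat \<Rightarrow> 'a expr set set" where
  "Omega_deg A n = generate (add_monoid (Omega A))
     {elementary_form A a0 as | a0 as. a0 \<in> A \<and> set as \<subseteq> A \<and> length as = n}"

section \<open>Square integrable forms\<close>

fun letter_op :: "('a \<Rightarrow> (nat \<times> int) bounded_op) \<Rightarrow> 'a letter \<Rightarrow> (nat \<times> int) bounded_op" where
  "letter_op \<pi> (Elem a) = \<pi> a"
| "letter_op \<pi> (Diff a) = dirac_commutator (\<pi> a)"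

definition expr_op :: "('a \<Rightarrow> (nat \<times> int) bounded_op) \<Rightarrow> 'a expr \<Rightarrow> (nat \<times> int) bounded_op" where
  "expr_op \<pi> x = (\<Sum>w\<in>Poly_Mapping.keys x. Poly_Mapping.lookup x w *\<^sub>C prod_list (map (letter_op \<pi>) w))"

text \<open>
  On the word of \<open>a\<^sub>0 (\<delta>a\<^sub>1) \<cdots> (\<delta>a\<^sub>n)\<close> this is \<open>\<pi>(a\<^sub>0)[D, \<pi>(a\<^sub>1)] \<cdots> [D, \<pi>(a\<^sub>n)]\<close>; since commutators with \<open>D\<close>
  satisfy the Leibniz rule, the relations of the universal algebra are respected.
  The value on a class is the common value of \<^const>\<open>expr_op\<close> on its representatives.
\<close>

definition form_op :: "('a \<Rightarrow> (nat \<times> int) bounded_op) \<Rightarrow> 'a expr set \<Rightarrow> (nat \<times> int) bounded_op" where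
  "form_op \<pi> \<omega> = the_elem (expr_op \<pi> ` \<omega>)"

definition form_inner ::
    "('a \<Rightarrow> (nat \<times> int) bounded_op) \<Rightarrow> ((real \<Rightarrow> complex) \<Rightarrow> complex) \<Rightarrow> 'a expr set \<Rightarrow> 'a expr set \<Rightarrow> complex" where
  "form_inner \<pi> L \<omega> \<eta> =
     L (\<lambda>\<epsilon>. op_trace (star (form_op \<pi> \<omega>) * form_op \<pi> \<eta> * heat \<epsilon>) / op_trace (heat \<epsilon>))"

definition null_forms :: "'a::cstar_algebra set \<Rightarrow> ('a \<Rightarrow> (nat \<times> int) bounded_op) \<Rightarrow>
    ((real \<Rightarrow> complex) \<Rightarrow> complex) \<Rightarrow> nat \<Rightarrow> 'a expr set set" where
  "null_forms A \<pi> L n = {\<omega> \<in> Omega_deg A n. form_inner \<pi> L \<omega> \<omega> = 0}"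

text \<open>\<open>\<KK>\<^sub>n + \<delta>\<KK>\<^sub>n\<^sub>-\<^sub>1\<close>, where \<open>\<KK>\<^sub>-\<^sub>1 = 0\<close>.\<close>

definition junk_forms :: "'a::cstar_algebra set \<Rightarrow> ('a \<Rightarrow> (nat \<times> int) bounded_op) \<Rightarrow>
    ((real \<Rightarrow> complex) \<Rightarrow> complex) \<Rightarrow> nat \<Rightarrow> 'a expr set set" where
  "junk_forms A \<pi> L n = null_forms A \<pi> L n <+>\<^bsub>Omega A\<^esub>
     delta A ` (case n of 0 \<Rightarrow> {\<zero>\<^bsub>Omega A\<^esub>} | Suc m \<Rightarrow> null_forms A \<pi> L m)"

record ('r, 'm) bimodule = "'m partial_object" +
  bimod_zero :: 'm
  bimod_add :: "'m \<Rightarrow> 'm \<Rightarrow> 'm"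
  left_act :: "'r \<Rightarrow> 'm \<Rightarrow> 'm"
  right_act :: "'m \<Rightarrow> 'r \<Rightarrow> 'm"

text \<open>
  Compatibility with complex scalars is not listed separately: below, \<open>R\<close> contains the multiples
  of the unit, and these act as scalars.
\<close>

definition bimodule_iso :: "'r set \<Rightarrow> ('r, 'm) bimodule \<Rightarrow> ('r, 'n) bimodule \<Rightarrow> ('m \<Rightarrow> 'n) \<Rightarrow> bool" where
  "bimodule_iso R M N \<Phi> \<longleftrightarrow> bij_betw \<Phi> (carrier M) (carrier N) \<and>
     \<Phi> (bimod_zero M) = bimod_zero N \<and>
     (\<forall>x\<in>carrier M. \<forall>y\<in>carrier M. \<Phi> (bimod_add M x y) = bimod_add N (\<Phi> x) (\<Phi> y)) \<and>
     (\<forall>a\<in>R. \<forall>x\<in>carrier M. \<Phi> (left_act M a x) = left_act N a (\<Phi> x) \<and>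
        \<Phi> (right_act M x a) = right_act N (\<Phi> x) a)"

definition Omega_D :: "'a::cstar_algebra set \<Rightarrow> ('a \<Rightarrow> (nat \<times> int) bounded_op) \<Rightarrow>
    ((real \<Rightarrow> complex) \<Rightarrow> complex) \<Rightarrow> nat \<Rightarrow> ('a, 'a expr set set) bimodule" where
  "Omega_D A \<pi> L n =
     (let J = junk_forms A \<pi> L n in
      \<lparr>carrier = (\<lambda>\<omega>. J +>\<^bsub>Omega A\<^esub> \<omega>) ` Omega_deg A n,
       bimod_zero = J,
       bimod_add = set_add (Omega A),
       left_act = (\<lambda>a X. \<Union>\<omega>\<in>X. J +>\<^bsub>Omega A\<^esub> (elem_form A a \<otimes>\<^bsub>Omega A\<^esub> \<omega>)),
       right_act = (\<lambda>X a. \<Union>\<omega>\<in>X. J +>\<^bsub>Omega A\<^esub> (\<omega> \<otimes>\<^bsub>Omega A\<^esub> elem_form A a))\<rparr>)"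

definition induced_differential :: "'a::cstar_algebra set \<Rightarrow> ('a \<Rightarrow> (nat \<times> int) bounded_op) \<Rightarrow>
    ((real \<Rightarrow> complex) \<Rightarrow> complex) \<Rightarrow> 'a \<Rightarrow> 'a expr set set" where
  "induced_differential A \<pi> L a = junk_forms A \<pi> L 1 +>\<^bsub>Omega A\<^esub> delta A (elem_form A a)"

definition laurent_bimodule :: "('a \<Rightarrow> laurent) \<Rightarrow> ('a, laurent) bimodule" where
  "laurent_bimodule \<sigma> = \<lparr>carrier = UNIV, bimod_zero = 0, bimod_add = (+),
     left_act = (\<lambda>a p. \<sigma> a * p), right_act = (\<lambda>p a. p * \<sigma> a)\<rparr>"

end

theory Submission
  imports Defs
begin

text \<open>
  Far out in the first coordinate \<open>q\<^sup>N\<close> is negligible and \<open>\<alpha>\<close> acts as the shift \<open>\<ell>\<close>, while \<open>[D, \<alpha>] = - S \<alpha>\<close>.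
  Hence, up to operators that decay there, a form \<open>\<omega> = a\<^sub>0 \<delta>a\<^sub>1 \<cdots> \<delta>a\<^sub>n\<close> acts as \<open>S\<^sup>n\<close> followed by its symbol
  \<open>\<tau>(\<omega>) = \<sigma>(a\<^sub>0) \<partial>\<sigma>(a\<^sub>1) \<cdots> \<partial>\<sigma>(a\<^sub>n)\<close>, where \<open>\<partial> = - z d/dz\<close>. The heat kernel gives vanishing relative
  weight to each row of the lattice as \<open>\<epsilon> \<rightarrow> 0\<close>, because the row sums tend to be equal and there are
  infinitely many of them; so \<open>(\<omega>, \<omega>)\<^sub>D\<close> is the sum of the squared moduli of the coefficients of
  \<open>\<tau>(\<omega>)\<close>, and the null forms are the kernel of \<open>\<tau>\<close>. Differentials of null forms of degree 0 are null
  again, so in degrees 0 and 1 the symbol identifies the quotient with the Laurent polynomials. In degree \<open>n \<ge> 2\<close>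
  already the forms \<open>\<delta>\<eta>\<close> with \<open>\<tau>(\<eta>) = 0\<close> have arbitrary symbols, so nothing remains.
\<close>

text \<open>The calculus rests on two features of \<open>D\<close>. Lowering the first index by one
  changes the eigenvalue by \<open>-S\<close>, which depends on the second index only, while symbols
  move only the first; so powers of \<open>S\<close> pass through products and merely count
  commutators. Where \<open>S\<close> changes sign, between the second indices \<open>-1\<close> and
  \<open>0\<close>, a step of \<open>\<beta>\<close> changes the eigenvalue by
  \<open>2 * i + 1\<close>; the decay \<open>q ^ i\<close> absorbs this, so
  \<open>[D, \<beta>]\<close> is bounded and has symbol 0. All limits are uniform in the second
  index, because the heat kernel averages over entire rows. The collapse in high degree comes from
  the commutativity of symbols. The symbol of \<open>\<delta>a\<close> is determined by that of
  \<open>a\<close>, but the symbol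
  \<open>\<partial>\<sigma>(a\<^sub>0) \<partial>\<sigma>(a\<^sub>1)\<close> of
  \<open>\<delta>(a\<^sub>0 \<delta>a\<^sub>1)\<close> is not determined by the product
  \<open>\<sigma>(a\<^sub>0) \<partial>\<sigma>(a\<^sub>1)\<close>; the rule
  \<open>\<partial>(z\<^sup>2) = 2 z \<partial>z\<close> yields null forms whose differentials are
  not null. The algebra is done with representatives in the free algebra: operators and symbols are
  ring homomorphisms on it that kill the relations.\<close>

lemma ell2_eqI: "(\<And>i. coord u i = coord v i) \<Longrightarrow> u = v"
  by (simp add: fun_eq_iff flip: coord_inject)

lemma coord_apply_eq_cinner_star: "coord (T \<cdot>\<^sub>o v) k = cinner (star T \<cdot>\<^sub>o ket k) v"
  by (simp add: cinner_star_left cinner_ket_left)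

text \<open>Adjoints replace a density argument: equal values on basis vectors give equal matrix
  entries, hence equal adjoints on basis vectors, and the coordinates of
  \<open>S \<cdot>\<^sub>o v\<close> are inner products of these with \<open>v\<close>.\<close>

lemma op_ket_eqI:
  assumes "\<And>k. S \<cdot>\<^sub>o ket k = T \<cdot>\<^sub>o ket k"
  shows "S = T"
proof (rule bounded_op_eqI, rule ell2_eqI)
  fix v k
  have "star S \<cdot>\<^sub>o ket k = star T \<cdot>\<^sub>o ket k"
  proof (rule ell2_eqI)
    fix i
    show "coord (star S \<cdot>\<^sub>o ket k) i = coord (star T \<cdot>\<^sub>o ket k) i"
      by (simp add: coord_apply_eq_cinner_star star_star assms)
  qed
  then show "coord (S \<cdot>\<^sub>o v) k = coord (T \<cdot>\<^sub>o v) k"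
    by (simp add: coord_apply_eq_cinner_star)
qed

lemma norm_ket [simp]: "norm (ket i) = 1"
proof -
  have "(norm (ket i))\<^sup>2 = (\<Sum>\<^sub>\<infinity>j\<in>{i}. 1::real)"
    unfolding norm_ell2_square by (rule infsum_cong_neutral) (auto simp: coord_ket)
  then have "(norm (ket i))\<^sup>2 = 1\<^sup>2"
    by simp
  then show ?thesis
    by (rule power2_eq_imp_eq) auto
qed

text \<open>The concrete operators of the proof have this form: \<open>\<alpha>\<close>,
  \<open>\<beta>\<close>, their commutators with \<open>D\<close>, and the heat operator.
  Injectivity of \<open>g\<close> ensures that no coordinate of \<open>v\<close> is counted twice in
  the norm estimate.\<close>

lemma weighted_shift_exists:
  fixes w :: "'i \<Rightarrow> complex" and g :: "'i \<Rightarrow> 'i"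
  assumes g: "inj g" and w: "\<And>k. cmod (w k) \<le> b"
  shows "\<exists>T. \<forall>v k. coord (T \<cdot>\<^sub>o v) k = w k * coord v (g k)"
proof -
  have b: "0 \<le> b"
    using w[of undefined] norm_ge_zero order_trans by blast
  define f where "f v = Abs_ell2 (\<lambda>k. w k * coord v (g k))" for v
  have bnd: "(\<Sum>i\<in>F. (cmod (w i * coord v (g i)))\<^sup>2) \<le> (b * norm v)\<^sup>2" if F: "finite F" for F v
  proof -
    have "(\<Sum>i\<in>F. (cmod (w i * coord v (g i)))\<^sup>2) \<le> (\<Sum>i\<in>F. b\<^sup>2 * (cmod (coord v (g i)))\<^sup>2)"
      by (intro sum_mono) (simp add: norm_mult power_mult_distrib mult_right_mono power_mono w)
    also have "\<dots> = b\<^sup>2 * (\<Sum>i\<in>g ` F. (cmod (coord v i))\<^sup>2)"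
      using g by (simp add: sum_distrib_left sum.reindex inj_on_subset[OF g])
    also have "\<dots> \<le> b\<^sup>2 * (norm v)\<^sup>2"
      by (intro mult_left_mono sum_coord_le) (use F in auto)
    finally show ?thesis by (simp add: power_mult_distrib)
  qed
  have f: "coord (f v) k = w k * coord v (g k)" "norm (f v) \<le> b * norm v" for v k
    using bounded_sums_ell2[OF bnd] b by (auto simp: f_def Abs_ell2_inverse)
  have "\<exists>T. \<forall>v. T \<cdot>\<^sub>o v = f v"
    by (rule op_of_bounded_linear[where b=b])
      (auto intro!: ell2_eqI f simp: f(1) algebra_simps)
  then show ?thesis
    by (metis f(1))
qed

section \<open>Commutators with the Dirac operator\<close>

lemma coord_dirac: "v \<in> dirac_domain \<Longrightarrow> coord (dirac v) k = of_int (dirac_eigenvalue k) * coord v k"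
  by (simp add: dirac_domain_def dirac_def Abs_ell2_inverse dirac_coord_def)

text \<open>Membership in the domain then needs no summability estimate: it is enough to name the
  vector that \<open>D\<close> should produce, since that vector is already square summable.\<close>

lemma dirac_domainI:
  assumes "\<And>k. of_int (dirac_eigenvalue k) * coord v k = coord u k"
  shows "v \<in> dirac_domain" and "dirac v = u"
proof -
  have eq: "dirac_coord v = coord u"
    by (simp add: fun_eq_iff dirac_coord_def assms)
  show "v \<in> dirac_domain"
    by (simp add: dirac_domain_def eq square_summable_coord)
  show "dirac v = u"
    by (simp add: dirac_def eq coord_inverse)
qed

lemma ket_in_dirac_domain: "ket k \<in> dirac_domain"
  by (rule dirac_domainI(1)[where u = "of_int (dirac_eigenvalue k) *\<^sub>C ket k"]) (simp add: coord_ket)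

lemma dirac_add:
  assumes "u \<in> dirac_domain" "v \<in> dirac_domain"
  shows "u + v \<in> dirac_domain" "dirac (u + v) = dirac u + dirac v"
  using dirac_domainI[of "u + v" "dirac u + dirac v"] assms by (simp_all add: coord_dirac algebra_simps)

lemma dirac_scaleC:
  assumes "u \<in> dirac_domain"
  shows "c *\<^sub>C u \<in> dirac_domain" "dirac (c *\<^sub>C u) = c *\<^sub>C dirac u"
  using dirac_domainI[of "c *\<^sub>C u" "c *\<^sub>C dirac u"] assms by (simp_all add: coord_dirac algebra_simps)

lemma dirac_ket: "dirac (ket k) = of_int (dirac_eigenvalue k) *\<^sub>C ket k"
  by (rule ell2_eqI) (simp add: coord_dirac[OF ket_in_dirac_domain] coord_ket)

lemma dirac_symmetric:
  assumes "u \<in> dirac_domain" "v \<in> dirac_domain"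
  shows "cinner (dirac u) v = cinner u (dirac v)"
  unfolding cinner.rep_eq by (simp add: coord_dirac assms mult_ac)

text \<open>Invariance of the domain is part of the notion, whereas \<open>dirac_commutator\<close>
  tests only vectors that happen to stay in the domain. This makes the notion stable under
  products.\<close>

definition has_commutator :: "(nat \<times> int) bounded_op \<Rightarrow> (nat \<times> int) bounded_op \<Rightarrow> bool" where
  "has_commutator T B \<longleftrightarrow>
     (\<forall>v\<in>dirac_domain. T \<cdot>\<^sub>o v \<in> dirac_domain \<and> B \<cdot>\<^sub>o v = dirac (T \<cdot>\<^sub>o v) - T \<cdot>\<^sub>o dirac v)"

lemma has_commutatorI:
  assumes "\<And>v k. v \<in> dirac_domain \<Longrightarrow>
    of_int (dirac_eigenvalue k) * coord (T \<cdot>\<^sub>o v) k = coord (T \<cdot>\<^sub>o dirac v + B \<cdot>\<^sub>o v) k"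
  shows "has_commutator T B"
  unfolding has_commutator_def using dirac_domainI[OF assms] by simp

text \<open>Basis vectors lie in the domain and determine a bounded operator, so there is at most
  one bounded extension.\<close>

lemma dirac_commutator_eq:
  assumes "has_commutator T B"
  shows "dirac_commutator T = B"
  unfolding dirac_commutator_def
proof (rule the_equality)
  show "\<forall>v\<in>dirac_domain. T \<cdot>\<^sub>o v \<in> dirac_domain \<longrightarrow> B \<cdot>\<^sub>o v = dirac (T \<cdot>\<^sub>o v) - T \<cdot>\<^sub>o dirac v"
    using assms by (simp add: has_commutator_def)
  fix B' assume "\<forall>v\<in>dirac_domain. T \<cdot>\<^sub>o v \<in> dirac_domain \<longrightarrow> B' \<cdot>\<^sub>o v = dirac (T \<cdot>\<^sub>o v) - T \<cdot>\<^sub>o dirac v"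
  then show "B' = B"
    using assms ket_in_dirac_domain by (intro op_ket_eqI) (auto simp: has_commutator_def)
qed

lemma has_commutator_add:
  "has_commutator S B \<Longrightarrow> has_commutator T C \<Longrightarrow> has_commutator (S + T) (B + C)"
  by (simp add: has_commutator_def dirac_add apply_op_add)

lemma has_commutator_scaleC: "has_commutator S B \<Longrightarrow> has_commutator (c *\<^sub>C S) (c *\<^sub>C B)"
  by (simp add: has_commutator_def dirac_scaleC scaleC_diff_right)

lemma has_commutator_mult:
  "has_commutator S B \<Longrightarrow> has_commutator T C \<Longrightarrow> has_commutator (S * T) (S * C + B * T)"
  by (simp add: has_commutator_def apply_op_diff)

lemma has_commutator_one: "has_commutator 1 0"
  by (simp add: has_commutator_def)

lemma uminus_op_apply: "(- T :: 'i bounded_op) \<cdot>\<^sub>o v = - (T \<cdot>\<^sub>o v)"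
  using apply_op_simps(4)[of 0 T v] by simp

lemma coord_uminus [simp]: "coord (- v) i = - coord v i"
  using coord_diff[of 0 v i] by simp

text \<open>\<open>D\<close> is symmetric, so it can be moved across the inner product with a basis
  vector. The resulting coordinates belong to a genuine vector, which shows at the same time that
  \<open>star T\<close> preserves the domain.\<close>

lemma has_commutator_star:
  assumes "has_commutator T B"
  shows "has_commutator (star T) (- star B)"
proof (rule has_commutatorI)
  fix v k assume v: "v \<in> dirac_domain"
  have "of_int (dirac_eigenvalue k) * coord (star T \<cdot>\<^sub>o v) k = cinner (dirac (ket k)) (star T \<cdot>\<^sub>o v)"
    by (simp add: dirac_ket cinner_scaleC_left cinner_ket_left)
  also have "\<dots> = cinner (T \<cdot>\<^sub>o dirac (ket k)) v"
    by (simp add: cinner_star_right)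
  also have "T \<cdot>\<^sub>o dirac (ket k) = dirac (T \<cdot>\<^sub>o ket k) + (- 1) *\<^sub>C (B \<cdot>\<^sub>o ket k)"
    using assms ket_in_dirac_domain
    by (auto simp: has_commutator_def intro!: ell2_eqI)
  also have "cinner \<dots> v = cinner (T \<cdot>\<^sub>o ket k) (dirac v) - cinner (B \<cdot>\<^sub>o ket k) v"
    using assms ket_in_dirac_domain v
    by (simp add: cinner_add_left cinner_scaleC_left dirac_symmetric has_commutator_def del: scaleC_of_real)
  also have "\<dots> = coord (star T \<cdot>\<^sub>o dirac v + - star B \<cdot>\<^sub>o v) k"
    by (simp add: coord_apply_eq_cinner_star star_star uminus_op_apply)
  finally show "of_int (dirac_eigenvalue k) * coord (star T \<cdot>\<^sub>o v) k =
    coord (star T \<cdot>\<^sub>o dirac v + - star B \<cdot>\<^sub>o v) k" .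
qed

lemma has_commutator_weighted_shift:
  assumes "\<And>v k. coord (T \<cdot>\<^sub>o v) k = w k * coord v (g k)"
    and "\<And>v k. coord (B \<cdot>\<^sub>o v) k =
      of_int (dirac_eigenvalue k - dirac_eigenvalue (g k)) * w k * coord v (g k)"
  shows "has_commutator T B"
  by (rule has_commutatorI) (simp add: assms coord_dirac algebra_simps)

lemma coord_heat:
  assumes "0 < \<epsilon>"
  shows "coord (heat \<epsilon> \<cdot>\<^sub>o v) k = complex_of_real (exp (- \<epsilon> * (of_int (dirac_eigenvalue k))\<^sup>2)) * coord v k"
proof -
  let ?P = "\<lambda>T. \<forall>v k. coord (T \<cdot>\<^sub>o v) k =
     complex_of_real (exp (- \<epsilon> * (of_int (dirac_eigenvalue k))\<^sup>2)) * coord v k"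
  have "\<exists>T. ?P T"
    using weighted_shift_exists[of "\<lambda>k. k" "\<lambda>k. complex_of_real (exp (- \<epsilon> * (of_int (dirac_eigenvalue k))\<^sup>2))" 1]
      assms by simp
  then obtain T where T: "?P T" ..
  have "?P (heat \<epsilon>)"
    unfolding heat_def by (rule theI[of ?P, OF T]) (use T in \<open>auto intro!: bounded_op_eqI ell2_eqI\<close>)
  then show ?thesis by blast
qed

lemma heat_ket:
  assumes "0 < \<epsilon>"
  shows "heat \<epsilon> \<cdot>\<^sub>o ket k = complex_of_real (exp (- \<epsilon> * (of_int (dirac_eigenvalue k))\<^sup>2)) *\<^sub>C ket k"
  by (rule ell2_eqI) (simp add: coord_heat[OF assms] coord_ket)

text \<open>Turns a prescription on basis vectors, the form in which the representation is given,
  into a formula for the coordinates of every vector. The last assumption covers the bottom row,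
  which \<open>\<alpha>\<close> annihilates.\<close>

lemma weighted_shift_unique:
  assumes "inj g" and "\<And>k. cmod (w k) \<le> b"
    and "\<And>k. T \<cdot>\<^sub>o ket (g k) = w k *\<^sub>C ket k" and "\<And>k. k \<notin> range g \<Longrightarrow> T \<cdot>\<^sub>o ket k = 0"
  shows "coord (T \<cdot>\<^sub>o v) k = w k * coord v (g k)"
proof -
  obtain W where W: "\<And>v k. coord (W \<cdot>\<^sub>o v) k = w k * coord v (g k)"
    using weighted_shift_exists[of g w b] assms(1,2) by blast
  have "W = T"
  proof (rule op_ket_eqI, rule ell2_eqI)
    fix k i
    show "coord (W \<cdot>\<^sub>o ket k) i = coord (T \<cdot>\<^sub>o ket k) i"
      using assms(1,3,4) by (cases "k \<in> range g") (auto simp: W coord_ket inj_eq)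
  qed
  with W show ?thesis by simp
qed

section \<open>Laurent polynomials\<close>

text \<open>Zero is a monomial with coefficient 0, so no separate base case occurs; additive
  identities need only be checked on monomials.\<close>

lemma poly_mapping_additive_induct [case_names single add]:
  fixes x :: "'k \<Rightarrow>\<^sub>0 'c::comm_monoid_add"
  assumes "\<And>k c. P (Poly_Mapping.single k c)" and "\<And>x y. P x \<Longrightarrow> P y \<Longrightarrow> P (x + y)"
  shows "P x"
proof -
  have "P (\<Sum>k\<in>K. Poly_Mapping.single k (Poly_Mapping.lookup x k))" if "finite K" for K
    using that
  proof induction
    case empty
    then show ?case using assms(1)[of undefined 0] by simp
  qed (simp add: assms)
  moreover have "x = (\<Sum>k\<in>Poly_Mapping.keys x. Poly_Mapping.single k (Poly_Mapping.lookup x k))"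
    by (rule poly_mapping_eqI)
      (simp add: lookup_sum lookup_single when_def in_keys_iff if_distrib cong: if_cong)
  ultimately show ?thesis
    by (metis finite_keys)
qed

lemma lookup_laurent_star: "Poly_Mapping.lookup (laurent_star p) i = cnj (Poly_Mapping.lookup p (- i))"
proof -
  have "Poly_Mapping.lookup (laurent_star p) i =
      (\<Sum>k\<in>Poly_Mapping.keys p. if k = - i then cnj (Poly_Mapping.lookup p k) else 0)"
    unfolding laurent_star_def lookup_sum
    by (intro sum.cong) (auto simp: lookup_single when_def)
  then show ?thesis
    by (simp add: in_keys_iff)
qed

lemma laurent_star_add: "laurent_star (p + q) = laurent_star p + laurent_star q"
  by (rule poly_mapping_eqI) (simp add: lookup_laurent_star lookup_add)

lemma laurent_star_uminus: "laurent_star (- p) = - laurent_star p"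
  by (rule poly_mapping_eqI) (simp add: lookup_laurent_star)

lemma laurent_star_zero [simp]: "laurent_star 0 = 0"
  by (rule poly_mapping_eqI) (simp add: lookup_laurent_star)

lemma laurent_star_single [simp]:
  "laurent_star (Poly_Mapping.single i c) = Poly_Mapping.single (- i) (cnj c)"
  by (rule poly_mapping_eqI) (auto simp: lookup_laurent_star lookup_single when_def)

lemma laurent_star_star [simp]: "laurent_star (laurent_star p) = p"
  by (rule poly_mapping_eqI) (simp add: lookup_laurent_star)

lemma laurent_star_mult: "laurent_star (p * q) = laurent_star p * laurent_star q"
proof (induction p rule: poly_mapping_additive_induct)
  case (single k c)
  show ?case
    by (induction q rule: poly_mapping_additive_induct)
      (simp_all add: mult_single laurent_star_add distrib_left algebra_simps)
qed (simp add: distrib_right laurent_star_add)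

text \<open>Up to the factor \<open>S\<close>, the commutator with \<open>D\<close> acts on symbols as the derivation \<open>- z d/dz\<close>.\<close>

definition laurent_deriv :: "laurent \<Rightarrow> laurent" where
  "laurent_deriv p = (\<Sum>i\<in>Poly_Mapping.keys p. Poly_Mapping.single i (- of_int i * Poly_Mapping.lookup p i))"

lemma lookup_laurent_deriv:
  "Poly_Mapping.lookup (laurent_deriv p) i = - of_int i * Poly_Mapping.lookup p i"
proof -
  have "Poly_Mapping.lookup (laurent_deriv p) i =
      (\<Sum>k\<in>Poly_Mapping.keys p. if k = i then - of_int k * Poly_Mapping.lookup p k else 0)"
    unfolding laurent_deriv_def lookup_sum
    by (intro sum.cong) (auto simp: lookup_single when_def)
  then show ?thesis
    by (simp add: in_keys_iff)
qed

lemma laurent_deriv_add: "laurent_deriv (p + q) = laurent_deriv p + laurent_deriv q"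
  by (rule poly_mapping_eqI) (simp add: lookup_laurent_deriv lookup_add algebra_simps)

lemma laurent_deriv_zero [simp]: "laurent_deriv 0 = 0"
  by (rule poly_mapping_eqI) (simp add: lookup_laurent_deriv)

lemma laurent_deriv_single [simp]:
  "laurent_deriv (Poly_Mapping.single i c) = Poly_Mapping.single i (- of_int i * c)"
  by (rule poly_mapping_eqI) (auto simp: lookup_laurent_deriv lookup_single when_def)

lemma laurent_deriv_one [simp]: "laurent_deriv 1 = 0"
  using laurent_deriv_single[of 0 1] by simp

lemma laurent_deriv_mult: "laurent_deriv (p * q) = p * laurent_deriv q + laurent_deriv p * q"
proof (induction p rule: poly_mapping_additive_induct)
  case (single k c)
  show ?case
    by (induction q rule: poly_mapping_additive_induct)
      (simp_all add: mult_single laurent_deriv_add distrib_left algebra_simps flip: single_add)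
qed (simp add: distrib_right laurent_deriv_add)

lemma laurent_deriv_scale:
  "laurent_deriv (Poly_Mapping.single 0 c * p) = Poly_Mapping.single 0 c * laurent_deriv p"
  by (simp add: laurent_deriv_mult)

text \<open>The star inverts \<open>z\<close> and so reverses exponents; the sign matches
  \<open>[D, T\<^sup>*] = - [D, T]\<^sup>*\<close>.\<close>

lemma laurent_deriv_star: "laurent_deriv (laurent_star p) = - laurent_star (laurent_deriv p)"
  by (rule poly_mapping_eqI) (simp add: lookup_laurent_deriv lookup_laurent_star)

section \<open>Symbols of operators\<close>

definition ket_int :: "int \<times> int \<Rightarrow> (nat \<times> int) ell2" where
  "ket_int = (\<lambda>(i, j). if 0 \<le> i then ket (nat i, j) else 0)"

text \<open>\<open>z\<close> acts as \<open>\<ell>\<close>, which lowers the first index. The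
  argument is an index rather than a vector: integer shifts compose exactly, while
  \<open>\<ell>\<close> and its adjoint fail to be inverse to each other at the bottom row.\<close>

definition laurent_act :: "laurent \<Rightarrow> int \<times> int \<Rightarrow> (nat \<times> int) ell2" where
  "laurent_act p k =
     (\<Sum>m\<in>Poly_Mapping.keys p. Poly_Mapping.lookup p m *\<^sub>C ket_int (fst k - m, snd k))"

definition sign_int :: "int \<Rightarrow> complex" where
  "sign_int j = (if 0 \<le> j then 1 else - 1)"

text \<open>Only the first index goes to infinity, so a limit along this filter is uniform in the
  second.\<close>

definition deep :: "(int \<times> int) filter" where
  "deep = filtercomap fst at_top"

text \<open>
  \<open>F\<close> has symbol \<open>p S\<^sup>n\<close>: on basis vectors far out in the first coordinate, \<open>F\<close> acts like \<open>S\<^sup>n\<close>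
  followed by the Laurent polynomial \<open>p\<close> in \<open>\<ell>\<close>. Letting the first index range over \<open>\<int>\<close>, with zero
  vectors at the negative places, avoids truncated subtraction.
\<close>

definition has_symbol :: "(nat \<times> int) bounded_op \<Rightarrow> laurent \<Rightarrow> nat \<Rightarrow> bool" where
  "has_symbol F p n \<longleftrightarrow>
     ((\<lambda>k. F \<cdot>\<^sub>o ket_int k - sign_int (snd k) ^ n *\<^sub>C laurent_act p k) \<longlongrightarrow> 0) deep"

lemma scaleC_zero_left [simp]: "0 *\<^sub>C (x :: 'a::complex_normed_space) = 0"
  using scaleC_add_left[of 0 0 x] by simp

lemma scaleC_one [simp]: "1 *\<^sub>C (x :: 'a::complex_normed_space) = x"
  using scaleC_of_real[of 1 x] by simp

lemma scaleC_sum_right: "c *\<^sub>C sum f A = (\<Sum>x\<in>A. c *\<^sub>C (f x :: 'a::complex_normed_space))"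
  by (induction A rule: infinite_finite_induct) (auto simp: scaleC_add_right)

lemma cmod_sign_int [simp]: "cmod (sign_int j) = 1"
  by (simp add: sign_int_def)

lemma laurent_act_add: "laurent_act (p + q) k = laurent_act p k + laurent_act q k"
  unfolding laurent_act_def by (rule setsum_keys_plus_distrib) (auto simp: scaleC_add_left)

lemma laurent_act_zero [simp]: "laurent_act 0 k = 0"
  by (simp add: laurent_act_def)

lemma laurent_act_single: "laurent_act (Poly_Mapping.single m c) k = c *\<^sub>C ket_int (fst k - m, snd k)"
  by (cases "c = 0") (auto simp: laurent_act_def)

lemma laurent_act_mult:
  "laurent_act (p * q) k =
     (\<Sum>m\<in>Poly_Mapping.keys q. Poly_Mapping.lookup q m *\<^sub>C laurent_act p (fst k - m, snd k))"
    (is "_ = ?R p q")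
proof (induction q rule: poly_mapping_additive_induct)
  case (single m c)
  have "laurent_act (p * Poly_Mapping.single m c) k = c *\<^sub>C laurent_act p (fst k - m, snd k)"
    by (induction p rule: poly_mapping_additive_induct)
      (simp_all add: mult_single laurent_act_single distrib_right laurent_act_add scaleC_add_right
        scaleC_scaleC algebra_simps)
  then show ?case
    by (cases "c = 0") auto
next
  case (add x y)
  have "?R p (x + y) = ?R p x + ?R p y"
    by (rule setsum_keys_plus_distrib) (auto simp: scaleC_add_left)
  then show ?case
    using add by (simp add: distrib_left laurent_act_add)
qed

lemma tendsto_scaleC_zero:
  fixes f :: "'a \<Rightarrow> 'b::complex_normed_space"
  assumes "(f \<longlongrightarrow> 0) F" "\<And>x. cmod (c x) \<le> b"
  shows "((\<lambda>x. c x *\<^sub>C f x) \<longlongrightarrow> 0) F"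
proof (rule Lim_null_comparison)
  show "\<forall>\<^sub>F x in F. norm (c x *\<^sub>C f x) \<le> b * norm (f x)"
    using assms(2) by (simp add: norm_scaleC mult_right_mono)
  show "((\<lambda>x. b * norm (f x)) \<longlongrightarrow> 0) F"
    using assms(1) by (intro tendsto_mult_right_zero tendsto_norm_zero)
qed

lemma tendsto_apply_op_zero:
  assumes "(f \<longlongrightarrow> 0) F"
  shows "((\<lambda>x. T \<cdot>\<^sub>o f x) \<longlongrightarrow> 0) F"
proof (rule Lim_null_comparison)
  show "\<forall>\<^sub>F x in F. norm (T \<cdot>\<^sub>o f x) \<le> norm T * norm (f x)"
    by (simp add: norm_apply_op_le)
  show "((\<lambda>x. norm T * norm (f x)) \<longlongrightarrow> 0) F"
    using assms by (intro tendsto_mult_right_zero tendsto_norm_zero)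
qed

lemma filterlim_deep_shift: "filterlim (\<lambda>k. (fst k - m, snd k)) deep deep"
proof -
  have "filterlim (\<lambda>i::int. i - m) at_top at_top"
    unfolding filterlim_at_top
  proof
    fix Z :: int
    show "\<forall>\<^sub>F i in at_top. Z \<le> i - m"
      using eventually_ge_at_top[of "Z + m"] by eventually_elim simp
  qed
  then have "filterlim (\<lambda>k::int\<times>int. fst k - m) at_top deep"
    unfolding deep_def by (rule filterlim_compose) (rule filterlim_filtercomap)
  then show ?thesis
    unfolding deep_def by (simp add: filterlim_filtercomap_iff o_def)
qed

lemma has_symbol_zero: "has_symbol 0 0 n"
  by (simp add: has_symbol_def)

lemma has_symbol_one: "has_symbol 1 1 0"
  by (simp add: has_symbol_def laurent_act_single flip: single_one)

lemma has_symbol_add: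
  assumes "has_symbol F p n" "has_symbol G q n"
  shows "has_symbol (F + G) (p + q) n"
  using tendsto_add[OF assms[unfolded has_symbol_def]]
  by (simp add: has_symbol_def laurent_act_add scaleC_add_right algebra_simps)

lemma has_symbol_scaleC:
  assumes "has_symbol F p n"
  shows "has_symbol (c *\<^sub>C F) (Poly_Mapping.single 0 c * p) n"
proof -
  have "laurent_act (Poly_Mapping.single 0 c * p) k = c *\<^sub>C laurent_act p k" for k
    unfolding laurent_act_mult
    by (simp add: laurent_act_def laurent_act_single scaleC_scaleC scaleC_sum_right mult.commute)
  then show ?thesis
    using tendsto_scaleC_zero[OF assms[unfolded has_symbol_def], of "\<lambda>_. c" "cmod c"]
    by (simp add: has_symbol_def scaleC_diff_right scaleC_scaleC mult.commute)
qed

lemma has_symbol_uminus: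
  assumes "has_symbol F p n"
  shows "has_symbol (- F) (- p) n"
proof -
  have "- F = (- 1) *\<^sub>C F"
    by (rule bounded_op_eqI) (auto simp: uminus_op_apply intro!: ell2_eqI)
  then show ?thesis
    using has_symbol_scaleC[OF assms, of "- 1"] by (simp add: single_uminus)
qed

text \<open>The error splits in two: \<open>F\<close> applied to the error of \<open>G\<close>,
  small since \<open>F\<close> is bounded, and finitely many errors of \<open>F\<close> at first
  indices shifted by the exponents of \<open>q\<close>. The sign passes through because these shifts
  keep the second index.\<close>

lemma has_symbol_mult:
  assumes "has_symbol F p n" "has_symbol G q m"
  shows "has_symbol (F * G) (p * q) (n + m)"
proof -
  define r where "r k = F \<cdot>\<^sub>o ket_int k - sign_int (snd k) ^ n *\<^sub>C laurent_act p k" for k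
  have r: "(r \<longlongrightarrow> 0) deep"
    using assms(1) by (simp add: has_symbol_def r_def[abs_def])
  have s: "F \<cdot>\<^sub>o laurent_act q k - sign_int (snd k) ^ n *\<^sub>C laurent_act (p * q) k =
      (\<Sum>l\<in>Poly_Mapping.keys q. Poly_Mapping.lookup q l *\<^sub>C r (fst k - l, snd k))" for k
    unfolding laurent_act_mult
    by (simp add: laurent_act_def[of q] apply_op_sum apply_op_scaleC scaleC_sum_right r_def
        scaleC_diff_right sum_subtractf scaleC_scaleC mult.commute)
  have "(\<lambda>k. (F * G) \<cdot>\<^sub>o ket_int k - sign_int (snd k) ^ (n + m) *\<^sub>C laurent_act (p * q) k) =
    (\<lambda>k. F \<cdot>\<^sub>o (G \<cdot>\<^sub>o ket_int k - sign_int (snd k) ^ m *\<^sub>C laurent_act q k) + sign_int (snd k) ^ m *\<^sub>C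
      (\<Sum>l\<in>Poly_Mapping.keys q. Poly_Mapping.lookup q l *\<^sub>C r (fst k - l, snd k)))"
    unfolding s[symmetric]
    by (simp add: apply_op_diff apply_op_scaleC scaleC_diff_right scaleC_scaleC power_add mult.commute)
  moreover have "((\<lambda>k. G \<cdot>\<^sub>o ket_int k - sign_int (snd k) ^ m *\<^sub>C laurent_act q k) \<longlongrightarrow> 0) deep"
    using assms(2) by (simp add: has_symbol_def)
  moreover have "((\<lambda>k. \<Sum>l\<in>Poly_Mapping.keys q. Poly_Mapping.lookup q l *\<^sub>C r (fst k - l, snd k)) \<longlongrightarrow> 0) deep"
    by (intro tendsto_null_sum tendsto_scaleC_zero[OF filterlim_compose[OF r filterlim_deep_shift] order_refl])
  then have "((\<lambda>k. sign_int (snd k) ^ m *\<^sub>C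
      (\<Sum>l\<in>Poly_Mapping.keys q. Poly_Mapping.lookup q l *\<^sub>C r (fst k - l, snd k))) \<longlongrightarrow> 0) deep"
    by (rule tendsto_scaleC_zero[where b=1]) (simp add: norm_power)
  ultimately show ?thesis
    using tendsto_add[OF tendsto_apply_op_zero] by (fastforce simp: has_symbol_def)
qed

text \<open>Norm limits on basis vectors need not pass to adjoints, so both operators are carried
  along; this is what allows an induction over a *-algebra.\<close>

definition has_star_symbol :: "(nat \<times> int) bounded_op \<Rightarrow> laurent \<Rightarrow> nat \<Rightarrow> bool" where
  "has_star_symbol F p n \<longleftrightarrow> has_symbol F p n \<and> has_symbol (star F) (laurent_star p) n"

lemma star_zero_op: "star (0 :: 'i bounded_op) = 0"
  using star_add[of "0 :: 'i bounded_op" 0] by simp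

lemma star_uminus_op: "star (- F :: 'i bounded_op) = - star F"
  using star_add[of F "- F"] by (simp add: star_zero_op eq_neg_iff_add_eq_0 add.commute)

lemma star_one_op: "star (1 :: 'i bounded_op) = 1"
  using star_mult[of "star 1 :: 'i bounded_op" 1] by (simp add: star_star)

lemma has_star_symbol_add:
  "has_star_symbol F p n \<Longrightarrow> has_star_symbol G q n \<Longrightarrow> has_star_symbol (F + G) (p + q) n"
  by (simp add: has_star_symbol_def has_symbol_add star_add laurent_star_add)

lemma has_star_symbol_scaleC:
  assumes "has_star_symbol F p n"
  shows "has_star_symbol (c *\<^sub>C F) (Poly_Mapping.single 0 c * p) n"
  using assms has_symbol_scaleC[of F p n c] has_symbol_scaleC[of "star F" "laurent_star p" n "cnj c"]
  by (simp add: has_star_symbol_def star_scaleC laurent_star_mult)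

lemma has_star_symbol_mult:
  assumes "has_star_symbol F p n" "has_star_symbol G q m"
  shows "has_star_symbol (F * G) (p * q) (n + m)"
  using assms has_symbol_mult[of F p n G q m]
    has_symbol_mult[of "star G" "laurent_star q" m "star F" "laurent_star p" n]
  by (simp add: has_star_symbol_def star_mult laurent_star_mult mult.commute add.commute)

lemma has_star_symbol_star:
  "has_star_symbol F p n \<Longrightarrow> has_star_symbol (star F) (laurent_star p) n"
  by (simp add: has_star_symbol_def star_star)

lemma has_star_symbol_uminus: "has_star_symbol F p n \<Longrightarrow> has_star_symbol (- F) (- p) n"
  by (simp add: has_star_symbol_def has_symbol_uminus star_uminus_op laurent_star_uminus)

lemma has_star_symbol_zero: "has_star_symbol 0 0 n"
  by (simp add: has_star_symbol_def has_symbol_zero star_zero_op)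

lemma has_star_symbol_one: "has_star_symbol 1 1 0"
  using laurent_star_single[of 0 1]
  by (simp add: has_star_symbol_def has_symbol_one star_one_op)

section \<open>From symbols to norms of the images of basis vectors\<close>

definition deep_nat :: "(nat \<times> int) filter" where
  "deep_nat = filtercomap fst sequentially"

lemma filterlim_deep_nat: "filterlim (\<lambda>k. (int (fst k), snd k)) deep deep_nat"
proof -
  have "filterlim (\<lambda>k::nat\<times>int. int (fst k)) at_top deep_nat"
    unfolding deep_nat_def by (rule filterlim_compose[OF filterlim_int_sequentially filterlim_filtercomap])
  then show ?thesis
    unfolding deep_def by (simp add: filterlim_filtercomap_iff o_def)
qed

lemma norm_sum_ket:
  assumes "finite M" "inj_on l M"
  shows "(norm (\<Sum>m\<in>M. c m *\<^sub>C ket (l m)))\<^sup>2 = (\<Sum>m\<in>M. (cmod (c m))\<^sup>2)"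
proof -
  let ?v = "\<Sum>m\<in>M. c m *\<^sub>C ket (l m)"
  have c: "coord ?v (l m) = c m" if "m \<in> M" for m
  proof -
    have "coord ?v (l m) = (\<Sum>m'\<in>M. if m' = m then c m' else 0)"
      using that assms(2) by (auto simp: coord_ket inj_on_eq_iff intro!: sum.cong)
    then show ?thesis using that assms(1) by simp
  qed
  have "cinner ?v ?v = (\<Sum>m\<in>M. c m * cinner ?v (ket (l m)))"
    by (simp only: cinner_sum_right[of ?v] cinner_scaleC_right)
  also have "\<dots> = (\<Sum>m\<in>M. c m * cnj (c m))"
    using c by (intro sum.cong refl) (subst cinner_commute, simp add: cinner_ket_left)
  also have "\<dots> = complex_of_real (\<Sum>m\<in>M. (cmod (c m))\<^sup>2)"
    by (simp add: complex_norm_square del: of_real_power)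
  finally show ?thesis
    by (simp add: power2_norm_eq_inner inner_ell2_def)
qed

text \<open>By Parseval, the squared norm of \<open>p\<close> in \<open>L\<^sub>2\<close> of the
  unit circle.\<close>

definition laurent_norm2 :: "laurent \<Rightarrow> real" where
  "laurent_norm2 p = (\<Sum>m\<in>Poly_Mapping.keys p. (cmod (Poly_Mapping.lookup p m))\<^sup>2)"

lemma laurent_norm2_eq_0: "laurent_norm2 p = 0 \<longleftrightarrow> p = 0"
proof
  assume "laurent_norm2 p = 0"
  then have "Poly_Mapping.lookup p m = 0" if "m \<in> Poly_Mapping.keys p" for m
    using that by (simp add: laurent_norm2_def sum_nonneg_eq_0_iff)
  then show "p = 0"
    by (intro poly_mapping_eqI) (auto simp: in_keys_iff)
qed (simp add: laurent_norm2_def)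

text \<open>Once the first index is at least every exponent of \<open>p\<close>, no term falls off
  the bottom row and the basis vectors involved are distinct, hence orthonormal.\<close>

lemma eventually_norm_laurent_act:
  "\<forall>\<^sub>F k in deep. (norm (laurent_act p k))\<^sup>2 = laurent_norm2 p"
proof -
  \<comment> \<open>The inserted 0 keeps the maximum defined when \<open>p\<close> is zero.\<close>
  define I where "I = Max (insert 0 (Poly_Mapping.keys p))"
  have "\<forall>\<^sub>F k::int\<times>int in deep. I \<le> fst k"
    unfolding deep_def by (intro eventually_filtercomapI eventually_ge_at_top)
  then show ?thesis
  proof eventually_elim
    case (elim k)
    have le: "m \<le> fst k" if "m \<in> Poly_Mapping.keys p" for m
      using elim that by (auto simp: I_def)
    have inj: "inj_on (\<lambda>m. (nat (fst k - m), snd k)) (Poly_Mapping.keys p)"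
    proof (rule inj_onI)
      fix x y assume "x \<in> Poly_Mapping.keys p" "y \<in> Poly_Mapping.keys p"
        and "(nat (fst k - x), snd k) = (nat (fst k - y), snd k)"
      then show "x = y"
        using le[of x] le[of y] by (simp add: eq_nat_nat_iff)
    qed
    from le have "laurent_act p k =
      (\<Sum>m\<in>Poly_Mapping.keys p. Poly_Mapping.lookup p m *\<^sub>C ket (nat (fst k - m), snd k))"
      unfolding laurent_act_def by (intro sum.cong) (auto simp: ket_int_def)
    then show ?case
      unfolding laurent_norm2_def by (simp only: norm_sum_ket[OF finite_keys inj])
  qed
qed

text \<open>The factor coming from \<open>S\<close> has modulus 1, so the degree leaves no trace in
  the limit.\<close>

lemma has_symbol_norm_tendsto:
  assumes "has_symbol F p n"
  shows "((\<lambda>k. (norm (F \<cdot>\<^sub>o ket k))\<^sup>2) \<longlongrightarrow> laurent_norm2 p) deep_nat"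
proof -
  let ?a = "\<lambda>k. sign_int (snd k) ^ n *\<^sub>C laurent_act p k"
  have n: "norm (?a k) = norm (laurent_act p k)" for k
    by (simp add: norm_scaleC norm_power)
  have "((\<lambda>k. norm (F \<cdot>\<^sub>o ket_int k) - norm (laurent_act p k)) \<longlongrightarrow> 0) deep"
  proof (rule Lim_null_comparison)
    show "\<forall>\<^sub>F k in deep. norm (norm (F \<cdot>\<^sub>o ket_int k) - norm (laurent_act p k))
        \<le> norm (F \<cdot>\<^sub>o ket_int k - ?a k)"
      using norm_triangle_ineq3[of "F \<cdot>\<^sub>o ket_int k" "?a k" for k] by (simp add: n)
    show "((\<lambda>k. norm (F \<cdot>\<^sub>o ket_int k - ?a k)) \<longlongrightarrow> 0) deep"
      using assms by (simp add: has_symbol_def tendsto_norm_zero)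
  qed
  moreover have "((\<lambda>k. norm (laurent_act p k)) \<longlongrightarrow> sqrt (laurent_norm2 p)) deep"
    using eventually_norm_laurent_act[of p]
    by (rule tendsto_eventually[OF eventually_mono]) (metis norm_ge_zero real_sqrt_unique)
  ultimately have "((\<lambda>k. norm (F \<cdot>\<^sub>o ket_int k)) \<longlongrightarrow> sqrt (laurent_norm2 p)) deep"
    using tendsto_add by fastforce
  then have "((\<lambda>k. (norm (F \<cdot>\<^sub>o ket_int k))\<^sup>2) \<longlongrightarrow> (sqrt (laurent_norm2 p))\<^sup>2) deep"
    by (rule tendsto_power)
  from filterlim_compose[OF this filterlim_deep_nat] show ?thesis
    by (simp add: ket_int_def laurent_norm2_def sum_nonneg)
qed

section \<open>Symbols of weighted shifts\<close>

lemma star_weighted_shift_ket: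
  assumes "\<And>v k. coord (T \<cdot>\<^sub>o v) k = w k * coord v (g k)"
  shows "star T \<cdot>\<^sub>o ket k = cnj (w k) *\<^sub>C ket (g k)"
proof (rule cinner_ext)
  fix u
  show "cinner (star T \<cdot>\<^sub>o ket k) u = cinner (cnj (w k) *\<^sub>C ket (g k)) u"
    by (simp add: cinner_star_left cinner_scaleC_left cinner_ket_left assms)
qed

lemma weighted_shift_ket:
  assumes "\<And>v k. coord (T \<cdot>\<^sub>o v) k = w k * coord v (g k)" "inj g"
  shows "T \<cdot>\<^sub>o ket (g k) = w k *\<^sub>C ket k"
  by (rule ell2_eqI) (auto simp: assms coord_ket inj_eq)

text \<open>The offset \<open>m\<close> lets the bound refer to the row of the image: with
  \<open>m = 1\<close>, the value at row \<open>i + 1\<close> is estimated by the weight at row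
  \<open>i\<close>.\<close>

lemma tendsto_deepI:
  fixes f :: "int \<times> int \<Rightarrow> 'b::real_normed_vector"
  assumes "r \<longlonglongrightarrow> 0" and "\<And>i j. norm (f (int (i + m), j)) \<le> r i"
  shows "(f \<longlongrightarrow> 0) deep"
proof (rule Lim_null_comparison)
  have "filterlim (\<lambda>i. nat (i - int m)) sequentially at_top"
    unfolding filterlim_at_top
  proof
    fix Z
    show "\<forall>\<^sub>F i in at_top. Z \<le> nat (i - int m)"
      using eventually_ge_at_top[of "int Z + int m"] by eventually_elim simp
  qed
  then have "filterlim (\<lambda>k::int\<times>int. nat (fst k - int m)) sequentially deep"
    unfolding deep_def by (rule filterlim_compose) (rule filterlim_filtercomap)
  then show "((\<lambda>k. r (nat (fst k - int m))) \<longlongrightarrow> 0) deep"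
    by (rule filterlim_compose[OF assms(1)])
  have "\<forall>\<^sub>F k::int\<times>int in deep. int m \<le> fst k"
    unfolding deep_def by (intro eventually_filtercomapI eventually_ge_at_top)
  then show "\<forall>\<^sub>F k in deep. norm (f k) \<le> r (nat (fst k - int m))"
  proof eventually_elim
    case (elim k)
    then show ?case
      using assms(2)[of "nat (fst k - int m)" "snd k"] by (cases k) simp
  qed
qed

text \<open>On basis vectors the error is a single scaled basis vector, with factor
  \<open>w (i, j) - sign_int j ^ n * c\<close>. For the adjoint the factor is the complex conjugate,
  because \<open>sign_int\<close> is real.\<close>

lemma has_star_symbol_lowering:
  assumes T: "\<And>v k. coord (T \<cdot>\<^sub>o v) k = w k * coord v (Suc (fst k), snd k)"
    and r: "r \<longlonglongrightarrow> 0" and w: "\<And>i j. cmod (w (i, j) - sign_int j ^ n * c) \<le> r i"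
  shows "has_star_symbol T (Poly_Mapping.single 1 c) n"
proof -
  let ?g = "\<lambda>k::nat\<times>int. (Suc (fst k), snd k)"
  have Tk: "T \<cdot>\<^sub>o ket (Suc i, j) = w (i, j) *\<^sub>C ket (i, j)" for i j
    using weighted_shift_ket[of T w ?g "(i, j)"] T by (simp add: inj_def prod_eq_iff)
  have "has_symbol T (Poly_Mapping.single 1 c) n"
    unfolding has_symbol_def
  proof (rule tendsto_deepI[where m=1, OF r])
    fix i j
    have "T \<cdot>\<^sub>o ket_int (int (i + 1), j) - sign_int (snd (int (i + 1), j)) ^ n *\<^sub>C
        laurent_act (Poly_Mapping.single 1 c) (int (i + 1), j) = (w (i, j) - sign_int j ^ n * c) *\<^sub>C ket (i, j)"
      by (rule ell2_eqI) (simp add: ket_int_def laurent_act_single nat_add_distrib Tk algebra_simps)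
    then show "norm (T \<cdot>\<^sub>o ket_int (int (i + 1), j) - sign_int (snd (int (i + 1), j)) ^ n *\<^sub>C
        laurent_act (Poly_Mapping.single 1 c) (int (i + 1), j)) \<le> r i"
      using w by (simp add: norm_scaleC)
  qed
  moreover have "has_symbol (star T) (laurent_star (Poly_Mapping.single 1 c)) n"
    unfolding has_symbol_def
  proof (rule tendsto_deepI[where m=0, OF r])
    fix i j
    have "star T \<cdot>\<^sub>o ket_int (int (i + 0), j) - sign_int (snd (int (i + 0), j)) ^ n *\<^sub>C
        laurent_act (laurent_star (Poly_Mapping.single 1 c)) (int (i + 0), j) =
        cnj (w (i, j) - sign_int j ^ n * c) *\<^sub>C ket (Suc i, j)"
      by (rule ell2_eqI)
        (simp add: ket_int_def laurent_act_single nat_add_distrib star_weighted_shift_ket[OF T]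
          sign_int_def algebra_simps)
    then show "norm (star T \<cdot>\<^sub>o ket_int (int (i + 0), j) - sign_int (snd (int (i + 0), j)) ^ n *\<^sub>C
        laurent_act (laurent_star (Poly_Mapping.single 1 c)) (int (i + 0), j)) \<le> r i"
      using w by (simp only: norm_scaleC norm_ket complex_mod_cnj mult_1_right)
  qed
  ultimately show ?thesis
    by (simp add: has_star_symbol_def)
qed

lemma has_star_symbol_null:
  assumes T: "\<And>v k. coord (T \<cdot>\<^sub>o v) k = w k * coord v (fst k, snd k + 1)"
    and r: "r \<longlonglongrightarrow> 0" and w: "\<And>i j. cmod (w (i, j)) \<le> r i"
  shows "has_star_symbol T 0 n"
proof -
  let ?g = "\<lambda>k::nat\<times>int. (fst k, snd k + 1)"
  have Tk: "T \<cdot>\<^sub>o ket (i, j) = w (i, j - 1) *\<^sub>C ket (i, j - 1)" for i j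
    using weighted_shift_ket[of T w ?g "(i, j - 1)"] T by (simp add: inj_def prod_eq_iff)
  show ?thesis
    unfolding has_star_symbol_def has_symbol_def
    by (intro conjI tendsto_deepI[where m=0, OF r])
      (simp_all add: ket_int_def Tk star_weighted_shift_ket[OF T] norm_scaleC w)
qed


section \<open>Symbols of the generators and of the whole algebra\<close>

lemma dirac_eigenvalue_lower:
  "dirac_eigenvalue (i, j) - dirac_eigenvalue (Suc i, j) = (if 0 \<le> j then - 1 else 1)"
  by (simp add: dirac_eigenvalue_def)

text \<open>Equality occurs at \<open>j = - 1\<close>, where \<open>S\<close> changes sign;
  elsewhere the difference is just \<open>- 1\<close>.\<close>

lemma dirac_eigenvalue_right:
  "\<bar>dirac_eigenvalue (i, j) - dirac_eigenvalue (i, j + 1)\<bar> \<le> 2 * int i + 1"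
  by (simp add: dirac_eigenvalue_def)

lemma representation_alpha:
  assumes q: "0 < q" "q < 1" and rep: "SUq2_representation q \<alpha> \<beta> \<pi>"
  shows "\<exists>B. has_commutator (\<pi> \<alpha>) B \<and> has_star_symbol (\<pi> \<alpha>) (Poly_Mapping.single 1 1) 0 \<and>
    has_star_symbol B (Poly_Mapping.single 1 (- 1)) 1"
proof -
  \<comment> \<open>Coordinates pull back: \<open>\<alpha>\<close> lowers basis vectors, so
    coordinate \<open>k\<close> of the image reads the coordinate of \<open>v\<close> one row
    higher.\<close>
  define g where "g k = (Suc (fst k), snd k)" for k :: "nat \<times> int"
  define f where "f i = sqrt (1 - q ^ (2 * Suc i))" for i
  define w where "w k = complex_of_real (f (fst k))" for k :: "nat \<times> int"
  define w' where "w' k = of_int (dirac_eigenvalue k - dirac_eigenvalue (g k)) * w k" for k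
  have g: "inj g"
    by (auto simp: g_def inj_def prod_eq_iff)
  have f: "0 \<le> f i" "f i \<le> 1" for i
    using q power_le_one[of q "2 * Suc i"] by (auto simp: f_def simp del: power_Suc mult_Suc_right)
  have w: "cmod (w k) \<le> 1" for k
    using f by (simp add: w_def)
  have w'_eq: "w' (i, j) = - sign_int j * f i" for i j
    by (simp only: w'_def g_def w_def dirac_eigenvalue_lower fst_conv snd_conv) (simp add: sign_int_def)
  have w': "cmod (w' k) \<le> 1" for k
    using f by (cases k) (simp add: w'_eq norm_mult)
  have T: "coord (\<pi> \<alpha> \<cdot>\<^sub>o v) k = w k * coord v (g k)" for v k
  proof (rule weighted_shift_unique[OF g w])
    show "\<pi> \<alpha> \<cdot>\<^sub>o ket (g k) = w k *\<^sub>C ket k" for k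
      using rep by (cases k) (simp add: SUq2_representation_def g_def w_def f_def)
    show "\<pi> \<alpha> \<cdot>\<^sub>o ket k = 0" if "k \<notin> range g" for k
    proof -
      have "fst k = 0"
      proof (rule ccontr)
        assume "fst k \<noteq> 0"
        then have "k = g (fst k - 1, snd k)"
          by (simp add: g_def)
        with that show False by blast
      qed
      then show ?thesis
        using rep by (cases k) (simp add: SUq2_representation_def)
    qed
  qed
  obtain B where B: "\<And>v k. coord (B \<cdot>\<^sub>o v) k = w' k * coord v (g k)"
    using weighted_shift_exists[of g w' 1] g w' by blast
  have r: "(\<lambda>i. 1 - f i) \<longlonglongrightarrow> 0"
  proof -
    have "(\<lambda>i. q ^ (2 * Suc i)) \<longlonglongrightarrow> 0"
      using LIMSEQ_power_zero[of "q\<^sup>2"] q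
      by (subst power_mult, intro LIMSEQ_Suc) (simp add: power_less_one_iff abs_square_less_1)
    then have "(\<lambda>i. 1 - f i) \<longlonglongrightarrow> 1 - sqrt (1 - 0)"
      unfolding f_def by (intro tendsto_intros)
    then show ?thesis by simp
  qed
  have "has_commutator (\<pi> \<alpha>) B"
    by (rule has_commutator_weighted_shift[OF T]) (simp add: B w'_def)
  moreover have "has_star_symbol (\<pi> \<alpha>) (Poly_Mapping.single 1 1) 0"
  proof (rule has_star_symbol_lowering[OF T[unfolded g_def] r])
    show "cmod (w (i, j) - sign_int j ^ 0 * 1) \<le> 1 - f i" for i j
      using f[of i] norm_of_real[of "f i - 1", where 'a = complex] by (simp add: w_def)
  qed
  moreover have "has_star_symbol B (Poly_Mapping.single 1 (- 1)) 1"
  proof (rule has_star_symbol_lowering[OF B[unfolded g_def] r])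
    fix i j
    have "w' (i, j) - sign_int j ^ 1 * - 1 = sign_int j * complex_of_real (1 - f i)"
      by (simp add: w'_eq algebra_simps)
    then have "cmod (w' (i, j) - sign_int j ^ 1 * - 1) = \<bar>1 - f i\<bar>"
      by (simp only: norm_mult norm_of_real cmod_sign_int mult_1_left)
    then show "cmod (w' (i, j) - sign_int j ^ 1 * - 1) \<le> 1 - f i"
      using f[of i] by simp
  qed
  ultimately show ?thesis by blast
qed

lemma representation_beta:
  assumes q: "0 < q" "q < 1" and rep: "SUq2_representation q \<alpha> \<beta> \<pi>"
  shows "\<exists>B. has_commutator (\<pi> \<beta>) B \<and> has_star_symbol (\<pi> \<beta>) 0 0 \<and> has_star_symbol B 0 1"
proof -
  define g where "g k = (fst k, snd k + 1)" for k :: "nat \<times> int"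
  define w where "w k = complex_of_real (q ^ fst k)" for k :: "nat \<times> int"
  define w' where "w' k = of_int (dirac_eigenvalue k - dirac_eigenvalue (g k)) * w k" for k
  \<comment> \<open>This is \<open>(2 * i + 1) * q ^ i\<close>, the largest jump of the eigenvalue
    times the weight of \<open>\<beta>\<close>. It bounds the weight itself as well, so one sequence
    serves both \<open>\<beta>\<close> and its commutator.\<close>
  define r where "r i = 2 * (real i * q ^ i) + q ^ i" for i
  have g: "inj g"
    by (auto simp: g_def inj_def prod_eq_iff)
  have w: "cmod (w k) \<le> 1" for k
    using q by (simp add: w_def norm_power power_le_one)
  have w'_le: "cmod (w' (i, j)) \<le> r i" for i j
  proof -
    have "real_of_int \<bar>dirac_eigenvalue (i, j) - dirac_eigenvalue (i, j + 1)\<bar> \<le> real_of_int (2 * int i + 1)"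
      using dirac_eigenvalue_right[of i j] by (simp only: of_int_le_iff)
    then have "real_of_int \<bar>dirac_eigenvalue (i, j) - dirac_eigenvalue (i, j + 1)\<bar> * q ^ i
        \<le> (2 * real i + 1) * q ^ i"
      using q by (intro mult_right_mono) auto
    moreover have "cmod (w' (i, j)) = real_of_int \<bar>dirac_eigenvalue (i, j) - dirac_eigenvalue (i, j + 1)\<bar> * q ^ i"
      using q unfolding w'_def g_def w_def
      by (simp only: norm_mult norm_of_int norm_of_real fst_conv snd_conv of_int_abs) simp
    ultimately show ?thesis
      by (simp add: r_def algebra_simps)
  qed
  have r: "r \<longlonglongrightarrow> 0"
  proof -
    have "r \<longlonglongrightarrow> 2 * 0 + 0"
      unfolding r_def using q
      by (intro tendsto_intros LIMSEQ_power_zero powser_times_n_limit_0) auto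
    then show ?thesis by simp
  qed
  have "Bseq r"
    using convergentI[OF r] by (rule convergent_imp_Bseq)
  then obtain b where "\<And>i. norm (r i) \<le> b"
    unfolding Bseq_def by blast
  then have w': "cmod (w' k) \<le> b" for k
    using w'_le[of "fst k" "snd k"] by (metis abs_ge_self order_trans prod.collapse real_norm_def)
  have T: "coord (\<pi> \<beta> \<cdot>\<^sub>o v) k = w k * coord v (g k)" for v k
  proof (rule weighted_shift_unique[OF g w])
    show "\<pi> \<beta> \<cdot>\<^sub>o ket (g k) = w k *\<^sub>C ket k" for k
      using rep by (cases k) (simp add: SUq2_representation_def g_def w_def)
    show "\<pi> \<beta> \<cdot>\<^sub>o ket k = 0" if "k \<notin> range g" for k
    proof -
      have "k = g (fst k, snd k - 1)"
        by (simp add: g_def)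
      with that show ?thesis by blast
    qed
  qed
  obtain B where B: "\<And>v k. coord (B \<cdot>\<^sub>o v) k = w' k * coord v (g k)"
    using weighted_shift_exists[of g w' b] g w' by blast
  have "has_commutator (\<pi> \<beta>) B"
    by (rule has_commutator_weighted_shift[OF T]) (simp add: B w'_def)
  moreover have "has_star_symbol (\<pi> \<beta>) 0 0"
  proof (rule has_star_symbol_null[OF T[unfolded g_def] r])
    show "cmod (w (i, j)) \<le> r i" for i j
      using q by (simp add: w_def r_def norm_power)
  qed
  moreover have "has_star_symbol B 0 1"
    by (rule has_star_symbol_null[OF B[unfolded g_def] r w'_le])
  ultimately show ?thesis by blast
qed

text \<open>The induction over the generation of the algebra carries some commutator
  \<open>B\<close> together with all three facts. The definite description
  \<open>dirac_commutator\<close> is identified with \<open>B\<close> only at the end, so it never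
  has to be computed on sums, products or adjoints.\<close>

lemma representation_symbol:
  assumes q: "0 < q" "q < 1" and rep: "SUq2_representation q \<alpha> \<beta> \<pi>"
    and sigma: "circle_restriction \<alpha> \<beta> \<sigma>" and a: "a \<in> star_subalgebra {\<alpha>, \<beta>}"
  shows "has_commutator (\<pi> a) (dirac_commutator (\<pi> a)) \<and> has_star_symbol (\<pi> a) (\<sigma> a) 0 \<and>
    has_star_symbol (dirac_commutator (\<pi> a)) (laurent_deriv (\<sigma> a)) 1"
proof -
  let ?A = "star_subalgebra {\<alpha>, \<beta>}"
  have pi: "\<pi> (x + y) = \<pi> x + \<pi> y" "\<pi> (x * y) = \<pi> x * \<pi> y" "\<pi> (c *\<^sub>C x) = c *\<^sub>C \<pi> x"
    "\<pi> (star x) = star (\<pi> x)" "\<pi> 1 = 1" for x y c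
    using rep by (auto simp: SUq2_representation_def star_hom_def)
  have sg: "\<sigma> (x + y) = \<sigma> x + \<sigma> y" "\<sigma> (x * y) = \<sigma> x * \<sigma> y"
    "\<sigma> (c *\<^sub>C x) = Poly_Mapping.single 0 c * \<sigma> x" "\<sigma> (star x) = laurent_star (\<sigma> x)"
    if "x \<in> ?A" "y \<in> ?A" for x y c
    using sigma that by (auto simp: circle_restriction_def Let_def)
  have sg0: "\<sigma> 1 = 1" "\<sigma> \<alpha> = Poly_Mapping.single 1 1" "\<sigma> \<beta> = 0"
    using sigma by (auto simp: circle_restriction_def Let_def)
  have "\<exists>B. has_commutator (\<pi> a) B \<and> has_star_symbol (\<pi> a) (\<sigma> a) 0 \<and>
    has_star_symbol B (laurent_deriv (\<sigma> a)) 1"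
    using a
  proof induction
    case (generator x)
    then consider "x = \<alpha>" | "x = \<beta>" by blast
    then show ?case
      using representation_alpha[OF q rep] representation_beta[OF q rep]
      by cases (simp_all add: sg0)
  next
    case unit
    show ?case
      using has_commutator_one has_star_symbol_one has_star_symbol_zero by (auto simp: pi sg0)
  next
    case (add x y)
    then show ?case
      by (metis pi(1) sg(1) has_commutator_add has_star_symbol_add laurent_deriv_add)
  next
    case (mult x y)
    from mult.IH obtain B C where
      B: "has_commutator (\<pi> x) B" "has_star_symbol (\<pi> x) (\<sigma> x) 0" "has_star_symbol B (laurent_deriv (\<sigma> x)) 1" and
      C: "has_commutator (\<pi> y) C" "has_star_symbol (\<pi> y) (\<sigma> y) 0" "has_star_symbol C (laurent_deriv (\<sigma> y)) 1"
      by blast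
    have "has_star_symbol (\<pi> x * C + B * \<pi> y) (laurent_deriv (\<sigma> (x * y))) 1"
      using has_star_symbol_add[OF has_star_symbol_mult[OF B(2) C(3)]] has_star_symbol_mult[OF B(3) C(2)]
      by (simp add: sg mult.hyps laurent_deriv_mult)
    then show ?case
      using has_commutator_mult[OF B(1) C(1)] has_star_symbol_mult[OF B(2) C(2)]
      by (auto simp: pi sg mult.hyps)
  next
    case (scaleC x c)
    then show ?case
      by (metis pi(3) sg(3) has_commutator_scaleC has_star_symbol_scaleC laurent_deriv_scale)
  next
    case (star x)
    then obtain B where
      B: "has_commutator (\<pi> x) B" "has_star_symbol (\<pi> x) (\<sigma> x) 0" "has_star_symbol B (laurent_deriv (\<sigma> x)) 1"
      by blast
    have "has_star_symbol (- star B) (laurent_deriv (\<sigma> (star x))) 1"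
      using has_star_symbol_uminus[OF has_star_symbol_star[OF B(3)]]
      by (simp add: sg(4)[OF star.hyps star.hyps] laurent_deriv_star)
    then show ?case
      using has_commutator_star[OF B(1)] has_star_symbol_star[OF B(2)]
      by (auto simp: pi sg(4)[OF star.hyps star.hyps])
  qed
  then show ?thesis
    using dirac_commutator_eq by blast
qed

section \<open>Averages with respect to the heat kernel\<close>

definition heat_weight :: "real \<Rightarrow> nat \<times> int \<Rightarrow> real" where
  "heat_weight \<epsilon> k = exp (- \<epsilon> * (of_int (dirac_eigenvalue k))\<^sup>2)"

definition heat_total :: "real \<Rightarrow> real" where
  "heat_total \<epsilon> = (\<Sum>\<^sub>\<infinity>k. heat_weight \<epsilon> k)"

definition heat_row :: "real \<Rightarrow> nat \<Rightarrow> real" where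
  "heat_row \<epsilon> i = (\<Sum>\<^sub>\<infinity>j. heat_weight \<epsilon> (i, j))"

lemma heat_weight_nonneg [simp]: "0 \<le> heat_weight \<epsilon> k"
  by (simp add: heat_weight_def)

lemma summable_on_geometric_nat:
  fixes r :: real
  assumes "0 \<le> r" "r < 1"
  shows "(\<lambda>n::nat. r ^ n) summable_on UNIV"
  by (rule norm_summable_imp_summable_on) (use assms in \<open>simp add: norm_power summable_geometric\<close>)

lemma summable_on_geometric_int:
  fixes r :: real
  assumes "0 \<le> r" "r < 1"
  shows "(\<lambda>d::int. r ^ nat \<bar>d\<bar>) summable_on UNIV"
proof -
  have "(\<lambda>d::int. r ^ nat \<bar>d\<bar>) summable_on range int"
    by (subst summable_on_reindex) (use summable_on_geometric_nat[OF assms] in \<open>auto simp: o_def\<close>)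
  moreover have "(\<lambda>d::int. r ^ nat \<bar>d\<bar>) summable_on range (\<lambda>n. - int n)"
    by (subst summable_on_reindex) (use summable_on_geometric_nat[OF assms] in \<open>auto simp: o_def inj_def\<close>)
  ultimately have "(\<lambda>d::int. r ^ nat \<bar>d\<bar>) summable_on (range int \<union> range (\<lambda>n. - int n))"
    by (rule summable_on_union)
  moreover have "d \<in> range int \<union> range (\<lambda>n. - int n)" for d
    by (cases d rule: int_cases2) auto
  then have "range int \<union> range (\<lambda>n. - int n) = UNIV"
    by blast
  ultimately show ?thesis by simp
qed

text \<open>For an integer \<open>d\<close> the square is at least \<open>\<bar>d\<bar>\<close>,
  which lets a geometric series dominate the Gaussian.\<close>

lemma exp_square_le_geometric:
  fixes d :: int and \<epsilon> :: real
  assumes "0 < \<epsilon>" "n \<le> nat \<bar>d\<bar>"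
  shows "exp (- \<epsilon> * (of_int d)\<^sup>2) \<le> exp (- \<epsilon>) ^ n"
proof -
  have "\<bar>d\<bar> * 1 \<le> \<bar>d\<bar> * \<bar>d\<bar>"
  proof (cases "d = 0")
    case False
    then show ?thesis by (intro mult_left_mono) linarith+
  qed simp
  then have "int n \<le> d\<^sup>2"
    using assms(2) by (simp add: power2_eq_square abs_mult_self_eq)
  then have "real n \<le> (of_int d)\<^sup>2"
    by (metis of_int_le_iff of_int_of_nat_eq of_int_power)
  then have "\<epsilon> * real n \<le> \<epsilon> * (of_int d)\<^sup>2"
    using assms(1) by simp
  then show ?thesis
    by (simp add: exp_of_nat_mult[symmetric] mult.commute)
qed

lemma abs_dirac_eigenvalue: "\<bar>dirac_eigenvalue (i, j)\<bar> = int i + \<bar>j\<bar>"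
  by (simp add: dirac_eigenvalue_def)

lemma summable_on_exp_square:
  fixes \<epsilon> :: real
  assumes "0 < \<epsilon>"
  shows "(\<lambda>d::int. exp (- \<epsilon> * (of_int d)\<^sup>2)) summable_on UNIV"
  by (rule summable_on_comparison_test[OF summable_on_geometric_int[of "exp (- \<epsilon>)"]])
    (use assms in \<open>auto intro: exp_square_le_geometric[simplified]\<close>)

lemma inj_dirac_eigenvalue_row: "inj (\<lambda>j. dirac_eigenvalue (i, j))"
  by (auto simp: inj_def dirac_eigenvalue_def split: if_splits)

text \<open>Nonnegative second indices give the eigenvalues from \<open>i\<close> upwards, negative
  ones those below \<open>- i\<close>. The gap is half-open since \<open>S\<close> is positive at
  index 0.\<close>

lemma range_dirac_eigenvalue_row: "range (\<lambda>j. dirac_eigenvalue (i, j)) = UNIV - {- int i..<int i}"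
proof (intro equalityI subsetI)
  fix d assume "d \<in> UNIV - {- int i..<int i}"
  then have "d = dirac_eigenvalue (i, if 0 \<le> d then d - int i else d + int i)"
    by (auto simp: dirac_eigenvalue_def)
  then show "d \<in> range (\<lambda>j. dirac_eigenvalue (i, j))"
    by blast
qed (auto simp: dirac_eigenvalue_def split: if_splits)

text \<open>Every row sums the same Gaussian over distinct integers, row \<open>i\<close> merely
  omitting the \<open>2 * i\<close> integers of its gap. All comparisons between rows rest on
  this.\<close>

lemma heat_row_split:
  assumes "0 < \<epsilon>"
  shows "heat_row \<epsilon> 0 = heat_row \<epsilon> i + (\<Sum>d\<in>{- int i..<int i}. exp (- \<epsilon> * (of_int d)\<^sup>2))"
proof -
  let ?g = "\<lambda>d::int. exp (- \<epsilon> * (of_int d)\<^sup>2)"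
  have row: "heat_row \<epsilon> i = infsum ?g (UNIV - {- int i..<int i})" for i
    unfolding heat_row_def heat_weight_def range_dirac_eigenvalue_row[symmetric]
    by (subst infsum_reindex) (auto simp: inj_dirac_eigenvalue_row o_def)
  show ?thesis
    unfolding row
    by (subst (2) infsum_Diff[OF summable_on_exp_square[OF assms]]) auto
qed

lemma heat_row_le: "0 < \<epsilon> \<Longrightarrow> heat_row \<epsilon> i \<le> heat_row \<epsilon> 0"
  using heat_row_split[of \<epsilon> i] by (simp add: sum_nonneg)

lemma heat_row_ge:
  assumes "0 < \<epsilon>"
  shows "heat_row \<epsilon> 0 \<le> heat_row \<epsilon> i + 2 * real i"
proof -
  have "(\<Sum>d\<in>{- int i..<int i}. exp (- \<epsilon> * (of_int d)\<^sup>2)) \<le> (\<Sum>d\<in>{- int i..<int i}. 1)"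
    using assms by (intro sum_mono) simp
  then show ?thesis
    using heat_row_split[OF assms, of i] by simp
qed

lemma heat_row_antimono:
  assumes "0 < \<epsilon>" "i \<le> n"
  shows "heat_row \<epsilon> n \<le> heat_row \<epsilon> i"
proof -
  have "(\<Sum>d\<in>{- int i..<int i}. exp (- \<epsilon> * (of_int d)\<^sup>2)) \<le> (\<Sum>d\<in>{- int n..<int n}. exp (- \<epsilon> * (of_int d)\<^sup>2))"
    using assms(2) by (intro sum_mono2) auto
  then show ?thesis
    using heat_row_split[OF assms(1), of i] heat_row_split[OF assms(1), of n] by linarith
qed

text \<open>The eigenvalue at \<open>(i, j)\<close> has modulus \<open>i + \<bar>j\<bar>\<close>, so
  a product of two geometric series dominates.\<close>

lemma heat_weight_summable:
  assumes "0 < \<epsilon>"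
  shows "heat_weight \<epsilon> summable_on UNIV"
proof -
  define r where "r = exp (- \<epsilon>)"
  have r: "0 \<le> r" "r < 1"
    using assms by (auto simp: r_def)
  define G where "G = (\<Sum>\<^sub>\<infinity>j::int. r ^ nat \<bar>j\<bar>)"
  have "(\<lambda>(i, j). r ^ i * r ^ nat \<bar>j\<bar>) summable_on ((UNIV :: nat set) \<times> (UNIV :: int set))"
  proof (rule summable_on_SigmaI)
    show "((\<lambda>j. case (i, j) of (i, j) \<Rightarrow> r ^ i * r ^ nat \<bar>j\<bar>) has_sum r ^ i * G) UNIV" for i
      unfolding G_def
      by simp (intro has_sum_cmult_right has_sum_infsum summable_on_geometric_int r)
    show "(\<lambda>i::nat. r ^ i * G) summable_on UNIV"
      by (intro summable_on_cmult_left summable_on_geometric_nat r)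
  qed (use r in auto)
  then have "(\<lambda>(i, j). r ^ i * r ^ nat \<bar>j\<bar>) summable_on (UNIV :: (nat \<times> int) set)"
    by simp
  then show ?thesis
  proof (rule summable_on_comparison_test)
    fix k :: "nat \<times> int"
    obtain i j where k: "k = (i, j)" by fastforce
    have "heat_weight \<epsilon> k \<le> r ^ (i + nat \<bar>j\<bar>)"
      unfolding heat_weight_def r_def k
      by (rule exp_square_le_geometric[OF assms]) (simp add: abs_dirac_eigenvalue nat_add_distrib)
    then show "heat_weight \<epsilon> k \<le> (case k of (i, j) \<Rightarrow> r ^ i * r ^ nat \<bar>j\<bar>)"
      by (simp add: k power_add)
  qed simp
qed

lemma infsum_heat_weight_rows:
  assumes "0 < \<epsilon>" "finite I"
  shows "infsum (heat_weight \<epsilon>) (I \<times> UNIV) = (\<Sum>i\<in>I. heat_row \<epsilon> i)"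
proof -
  have "heat_weight \<epsilon> summable_on (I \<times> UNIV)"
    by (rule summable_on_subset_banach[OF heat_weight_summable[OF assms(1)]]) simp
  then have "infsum (heat_weight \<epsilon>) (I \<times> UNIV) = (\<Sum>\<^sub>\<infinity>i\<in>I. heat_row \<epsilon> i)"
    unfolding heat_row_def by (subst infsum_Sigma_banach) auto
  then show ?thesis
    using assms(2) by simp
qed

lemma heat_rows_le_total:
  assumes "0 < \<epsilon>" "finite I"
  shows "(\<Sum>i\<in>I. heat_row \<epsilon> i) \<le> heat_total \<epsilon>"
  unfolding infsum_heat_weight_rows[OF assms, symmetric] heat_total_def
  by (rule infsum_mono2)
    (auto intro: heat_weight_summable[OF assms(1)] summable_on_subset_banach[OF heat_weight_summable[OF assms(1)]])

lemma heat_total_pos: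
  assumes "0 < \<epsilon>"
  shows "0 < heat_total \<epsilon>"
proof -
  have "(\<Sum>k\<in>{(0, 0)}. heat_weight \<epsilon> k) \<le> heat_total \<epsilon>"
    unfolding heat_total_def
    by (rule finite_sum_le_infsum) (use heat_weight_summable[OF assms] in auto)
  moreover have "0 < heat_weight \<epsilon> (0, 0)"
    by (simp add: heat_weight_def)
  ultimately show ?thesis by simp
qed

lemma heat_total_at_top: "filterlim heat_total at_top (at_right 0)"
  unfolding filterlim_at_top_gt[where c=0]
proof (intro allI impI)
  fix Z :: real assume "0 < Z"
  \<comment> \<open>The factor 2 makes \<open>M\<close> strictly larger than \<open>Z\<close>; each
    of the \<open>M\<close> terms chosen from row 0 tends to 1.\<close>
  obtain M :: nat where M: "2 * Z \<le> real M"
    using real_arch_simple by blast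
  have "((\<lambda>\<epsilon>. \<Sum>j\<in>{..<M}. heat_weight \<epsilon> (0, int j)) \<longlongrightarrow> (\<Sum>j\<in>{..<M}. exp (- 0 * (real j)\<^sup>2))) (at_right 0)"
  proof (rule tendsto_sum)
    fix j
    have "heat_weight \<epsilon> (0, int j) = exp (- \<epsilon> * (real j)\<^sup>2)" for \<epsilon>
      by (simp add: heat_weight_def dirac_eigenvalue_def)
    then show "((\<lambda>\<epsilon>. heat_weight \<epsilon> (0, int j)) \<longlongrightarrow> exp (- 0 * (real j)\<^sup>2)) (at_right 0)"
      by (simp only:) (intro tendsto_intros)
  qed
  then have "((\<lambda>\<epsilon>. \<Sum>j\<in>{..<M}. heat_weight \<epsilon> (0, int j)) \<longlongrightarrow> real M) (at_right 0)"
    by simp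
  moreover have "Z < real M"
    using M \<open>0 < Z\<close> by linarith
  ultimately have "\<forall>\<^sub>F \<epsilon> in at_right 0. Z < (\<Sum>j\<in>{..<M}. heat_weight \<epsilon> (0, int j))"
    by (rule order_tendstoD(1))
  moreover have "\<forall>\<^sub>F \<epsilon> in at_right (0::real). 0 < \<epsilon>"
    by (simp add: eventually_at_right_less)
  ultimately show "\<forall>\<^sub>F \<epsilon> in at_right 0. Z \<le> heat_total \<epsilon>"
  proof eventually_elim
    case (elim \<epsilon>)
    have "(\<Sum>j\<in>{..<M}. heat_weight \<epsilon> (0, int j)) = sum (heat_weight \<epsilon>) ((\<lambda>j. (0, int j)) ` {..<M})"
      by (subst sum.reindex) (auto simp: inj_on_def)
    also have "\<dots> \<le> heat_total \<epsilon>"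
      unfolding heat_total_def
      by (rule finite_sum_le_infsum) (use heat_weight_summable elim in auto)
    finally show ?case
      using elim by linarith
  qed
qed

text \<open>For fixed \<open>N\<close>, each of the first \<open>N\<close> rows weighs at least as
  much as row \<open>N\<close>, so row \<open>N\<close> carries at most \<open>1 / N\<close> of the
  total. Row 0 exceeds it by at most \<open>2 * N\<close>, which is negligible because the total
  diverges.\<close>

lemma heat_row_negligible: "((\<lambda>\<epsilon>. heat_row \<epsilon> 0 / heat_total \<epsilon>) \<longlongrightarrow> 0) (at_right 0)"
proof (rule tendstoI)
  fix e :: real assume "0 < e"
  obtain N :: nat where N: "0 < N" "1 / real N < e / 2"
    using nat_approx_posE[of "e / 2"] \<open>0 < e\<close> by (metis half_gt_zero zero_less_Suc)
  have "((\<lambda>\<epsilon>. 2 * real N / heat_total \<epsilon>) \<longlongrightarrow> 0) (at_right 0)"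
    by (rule tendsto_divide_0[OF tendsto_const filterlim_at_top_imp_at_infinity[OF heat_total_at_top]])
  then have "\<forall>\<^sub>F \<epsilon> in at_right 0. 2 * real N / heat_total \<epsilon> < e / 2"
    by (rule order_tendstoD(2)) (use \<open>0 < e\<close> in simp)
  moreover have "\<forall>\<^sub>F \<epsilon> in at_right (0::real). 0 < \<epsilon>"
    by (simp add: eventually_at_right_less)
  ultimately show "\<forall>\<^sub>F \<epsilon> in at_right 0. dist (heat_row \<epsilon> 0 / heat_total \<epsilon>) 0 < e"
  proof eventually_elim
    case (elim \<epsilon>)
    note Z = heat_total_pos[OF elim(2)]
    have "real N * heat_row \<epsilon> N = (\<Sum>i\<in>{..<N}. heat_row \<epsilon> N)"
      by simp
    also have "\<dots> \<le> (\<Sum>i\<in>{..<N}. heat_row \<epsilon> i)"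
      by (intro sum_mono heat_row_antimono elim) simp
    also have "\<dots> \<le> heat_total \<epsilon>"
      by (rule heat_rows_le_total) (use elim in auto)
    finally have "heat_row \<epsilon> N / heat_total \<epsilon> \<le> 1 / real N"
      using N(1) Z by (simp add: field_simps)
    moreover have "heat_row \<epsilon> 0 / heat_total \<epsilon> \<le> (heat_row \<epsilon> N + 2 * real N) / heat_total \<epsilon>"
      by (rule divide_right_mono) (use heat_row_ge[OF elim(2)] Z in auto)
    ultimately have "heat_row \<epsilon> 0 / heat_total \<epsilon> < e"
      using N(2) elim(1) by (simp add: add_divide_distrib)
    moreover have "0 \<le> heat_row \<epsilon> 0"
      unfolding heat_row_def by (intro infsum_nonneg) simp
    ultimately show ?case
      using Z by simp
  qed
qed

lemma heat_average_summable:
  fixes n :: "nat \<times> int \<Rightarrow> real"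
  assumes "0 < \<epsilon>" "\<And>k. \<bar>n k\<bar> \<le> b"
  shows "(\<lambda>k. heat_weight \<epsilon> k * n k) summable_on UNIV"
proof (rule abs_summable_summable, rule summable_on_comparison_test)
  show "(\<lambda>k. heat_weight \<epsilon> k * b) summable_on UNIV"
    by (intro summable_on_cmult_left heat_weight_summable assms)
qed (auto simp: abs_mult assms intro!: mult_left_mono)

text \<open>From some row \<open>I\<close> on, the values are close to \<open>c\<close> throughout
  each row. The first \<open>I\<close> rows contribute at most a constant times \<open>I\<close>
  copies of row 0, whose relative weight vanishes.\<close>

lemma heat_average_tendsto:
  fixes n :: "nat \<times> int \<Rightarrow> real"
  assumes b: "\<And>k. \<bar>n k\<bar> \<le> b"
    and lim: "\<And>e. 0 < e \<Longrightarrow> \<exists>I. \<forall>i\<ge>I. \<forall>j. \<bar>n (i, j) - c\<bar> \<le> e"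
  shows "((\<lambda>\<epsilon>. (\<Sum>\<^sub>\<infinity>k. heat_weight \<epsilon> k * n k) / heat_total \<epsilon>) \<longlongrightarrow> c) (at_right 0)"
proof (rule tendstoI)
  fix e :: real assume e: "0 < e"
  obtain I where I: "\<And>i j. I \<le> i \<Longrightarrow> \<bar>n (i, j) - c\<bar> \<le> e / 2"
    using lim[of "e / 2"] e by auto
  define B where "B = b + \<bar>c\<bar>"
  have B: "\<bar>n k - c\<bar> \<le> B" for k
    using b[of k] by (simp add: B_def)
  then have B0: "0 \<le> B"
    by (meson abs_ge_zero order_trans)
  have "((\<lambda>\<epsilon>. B * real I * (heat_row \<epsilon> 0 / heat_total \<epsilon>)) \<longlongrightarrow> 0) (at_right 0)"
    by (intro tendsto_mult_right_zero heat_row_negligible)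
  then have "\<forall>\<^sub>F \<epsilon> in at_right 0. B * real I * (heat_row \<epsilon> 0 / heat_total \<epsilon>) < e / 2"
    by (rule order_tendstoD(2)) (use e in simp)
  moreover have "\<forall>\<^sub>F \<epsilon> in at_right (0::real). 0 < \<epsilon>"
    by (simp add: eventually_at_right_less)
  ultimately show "\<forall>\<^sub>F \<epsilon> in at_right 0. dist ((\<Sum>\<^sub>\<infinity>k. heat_weight \<epsilon> k * n k) / heat_total \<epsilon>) c < e"
  proof eventually_elim
    case (elim \<epsilon>)
    let ?w = "heat_weight \<epsilon>" and ?Z = "heat_total \<epsilon>" and ?H = "{..<I} \<times> (UNIV :: int set)"
    note Z = heat_total_pos[OF elim(2)]
    note sw = heat_weight_summable[OF elim(2)]
    have sn: "(\<lambda>k. ?w k * n k) summable_on UNIV"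
      by (rule heat_average_summable[OF elim(2) b])
    have sd: "(\<lambda>k. ?w k * \<bar>n k - c\<bar>) summable_on UNIV"
      by (rule heat_average_summable[OF elim(2), of _ B]) (simp add: B)
    have sH: "(\<lambda>k. if k \<in> ?H then ?w k else 0) summable_on UNIV"
      by (rule summable_on_comparison_test[OF sw]) auto
    have eq: "(\<Sum>\<^sub>\<infinity>k. ?w k * (n k - c)) = (\<Sum>\<^sub>\<infinity>k. ?w k * n k) - c * ?Z"
    proof -
      have "(\<Sum>\<^sub>\<infinity>k. ?w k * (n k - c)) = (\<Sum>\<^sub>\<infinity>k. ?w k * n k + (- c) * ?w k)"
        by (simp add: algebra_simps)
      also have "\<dots> = (\<Sum>\<^sub>\<infinity>k. ?w k * n k) + (\<Sum>\<^sub>\<infinity>k. (- c) * ?w k)"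
        by (intro infsum_add sn summable_on_cmult_right sw)
      finally show ?thesis
        using infsum_cmult_right'[of "- c" "heat_weight \<epsilon>" UNIV] by (simp add: heat_total_def)
    qed
    have "\<bar>\<Sum>\<^sub>\<infinity>k. ?w k * (n k - c)\<bar> \<le> (\<Sum>\<^sub>\<infinity>k. ?w k * \<bar>n k - c\<bar>)"
      using norm_infsum_bound[of "\<lambda>k. ?w k * (n k - c)" UNIV] sd by (simp add: abs_mult)
    also have "\<dots> \<le> (\<Sum>\<^sub>\<infinity>k. e / 2 * ?w k + B * (if k \<in> ?H then ?w k else 0))"
    proof (rule infsum_mono[OF sd])
      show "(\<lambda>k. e / 2 * ?w k + B * (if k \<in> ?H then ?w k else 0)) summable_on UNIV"
        by (intro summable_on_add summable_on_cmult_right sw sH)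
      fix k
      show "?w k * \<bar>n k - c\<bar> \<le> e / 2 * ?w k + B * (if k \<in> ?H then ?w k else 0)"
      proof (cases "k \<in> ?H")
        case True
        have "?w k * \<bar>n k - c\<bar> \<le> ?w k * B"
          by (intro mult_left_mono B) simp
        moreover have "0 \<le> e / 2 * ?w k"
          using e by simp
        ultimately show ?thesis
          using True by (simp add: mult.commute[of B])
      next
        case False
        then have "\<bar>n k - c\<bar> \<le> e / 2"
          using I[of "fst k" "snd k"] by (cases k) auto
        then have "?w k * \<bar>n k - c\<bar> \<le> ?w k * (e / 2)"
          by (intro mult_left_mono) auto
        with False show ?thesis
          by (simp add: mult.commute)
      qed
    qed
    also have "\<dots> = e / 2 * ?Z + B * (\<Sum>\<^sub>\<infinity>k. if k \<in> ?H then ?w k else 0)"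
      unfolding heat_total_def infsum_cmult_right'[symmetric]
      by (intro infsum_add summable_on_cmult_right sw sH)
    also have "(\<Sum>\<^sub>\<infinity>k. if k \<in> ?H then ?w k else 0) = infsum ?w ?H"
      by (rule infsum_cong_neutral) auto
    also have "\<dots> = (\<Sum>i<I. heat_row \<epsilon> i)"
      by (rule infsum_heat_weight_rows) (use elim in auto)
    also have "e / 2 * ?Z + B * (\<Sum>i<I. heat_row \<epsilon> i) \<le> e / 2 * ?Z + B * (\<Sum>i<I. heat_row \<epsilon> 0)"
      by (intro add_left_mono mult_left_mono sum_mono heat_row_le elim B0)
    finally have "\<bar>\<Sum>\<^sub>\<infinity>k. ?w k * (n k - c)\<bar> / ?Z \<le> (e / 2 * ?Z + B * (real I * heat_row \<epsilon> 0)) / ?Z"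
      using Z by (intro divide_right_mono) auto
    also have "\<dots> = e / 2 + B * real I * (heat_row \<epsilon> 0 / ?Z)"
      using Z by (simp add: add_divide_distrib)
    also have "\<dots> < e"
      using elim(1) by linarith
    also have "\<bar>\<Sum>\<^sub>\<infinity>k. ?w k * (n k - c)\<bar> / ?Z = \<bar>(\<Sum>\<^sub>\<infinity>k. ?w k * n k) / ?Z - c\<bar>"
    proof -
      have "(\<Sum>\<^sub>\<infinity>k. ?w k * n k) / ?Z - c = (\<Sum>\<^sub>\<infinity>k. ?w k * (n k - c)) / ?Z"
        using Z unfolding eq by (simp add: diff_divide_distrib)
      then show ?thesis
        by (simp only: abs_divide abs_of_pos[OF Z])
    qed
    finally show ?case
      by (simp add: dist_real_def)
  qed
qed

section \<open>Linear maps on the free algebra\<close>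

text \<open>Scalars enter through a map \<open>\<rho>\<close>, later required to be central, so that
  one construction serves the differential, the grading, the operators and the symbols.\<close>

definition linear_extension :: "(complex \<Rightarrow> 'b::ring_1) \<Rightarrow> ('a letter list \<Rightarrow> 'b) \<Rightarrow> 'a expr \<Rightarrow> 'b" where
  "linear_extension \<rho> h x = (\<Sum>w\<in>Poly_Mapping.keys x. \<rho> (Poly_Mapping.lookup x w) * h w)"

locale scalar_embedding =
  fixes \<rho> :: "complex \<Rightarrow> 'b::ring_1"
  assumes scalar_add: "\<rho> (c + d) = \<rho> c + \<rho> d"
    and scalar_mult: "\<rho> (c * d) = \<rho> c * \<rho> d"
    and scalar_central: "\<rho> c * y = y * \<rho> c"
begin

lemma scalar_zero: "\<rho> 0 = 0"
  using scalar_add[of 0 0] by simp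

lemma linear_extension_add:
  "linear_extension \<rho> h (x + y) = linear_extension \<rho> h x + linear_extension \<rho> h y"
  unfolding linear_extension_def
  by (rule setsum_keys_plus_distrib) (auto simp: scalar_zero scalar_add distrib_right)

lemma linear_extension_zero: "linear_extension \<rho> h 0 = 0"
  by (simp add: linear_extension_def)

lemma linear_extension_single: "linear_extension \<rho> h (Poly_Mapping.single w c) = \<rho> c * h w"
  by (cases "c = 0") (auto simp: linear_extension_def scalar_zero)

lemma linear_extension_uminus: "linear_extension \<rho> h (- x) = - linear_extension \<rho> h x"
  using linear_extension_add[of h x "- x"] by (simp add: linear_extension_zero eq_neg_iff_add_eq_0 add.commute)

lemma linear_extension_diff:
  "linear_extension \<rho> h (x - y) = linear_extension \<rho> h x - linear_extension \<rho> h y"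
  using linear_extension_add[of h x "- y"] by (simp add: linear_extension_uminus)

lemma linear_extension_mult:
  assumes "\<And>u v. h (u @ v) = h u * h v"
  shows "linear_extension \<rho> h (x * y) = linear_extension \<rho> h x * linear_extension \<rho> h y"
proof (induction x rule: poly_mapping_additive_induct)
  case (single u c)
  show ?case
  proof (induction y rule: poly_mapping_additive_induct)
    case (single v d)
    have "\<rho> d * (y * z) = y * (\<rho> d * z)" for y z
      by (simp only: mult.assoc[symmetric] scalar_central[of d y])
    then have "\<rho> c * \<rho> d * (h u * h v) = \<rho> c * h u * (\<rho> d * h v)"
      by (simp only: mult.assoc)
    then show ?case
      by (simp add: mult_single linear_extension_single plus_list_def assms scalar_mult)
  qed (simp add: distrib_left linear_extension_add)
qed (simp add: distrib_right linear_extension_add)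

end

lemma single_Nil_central: "Poly_Mapping.single [] c * x = x * Poly_Mapping.single [] (c::complex)"
  by (induction x rule: poly_mapping_additive_induct)
    (simp_all add: mult_single plus_list_def distrib_left distrib_right mult.commute)

lemma one_expr: "(1 :: 'a expr) = Poly_Mapping.single [] 1"
  by (simp flip: single_one add: zero_list_def)

interpretation expr_scalars: scalar_embedding "Poly_Mapping.single [] :: complex \<Rightarrow> 'a expr"
  by standard (simp_all add: single_add mult_single plus_list_def one_expr single_Nil_central)

lemma gen_mult_single: "gen l * Poly_Mapping.single w c = Poly_Mapping.single (l # w) c"
  by (simp add: gen_def mult_single plus_list_def)

section \<open>The differential is a graded derivation\<close>

definition word_sign :: "'a letter list \<Rightarrow> complex" where
  "word_sign w = (- 1) ^ length (filter (\<lambda>l. case l of Elem _ \<Rightarrow> False | Diff _ \<Rightarrow> True) w)"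

text \<open>The parity automorphism: with it the graded Leibniz rule can be stated for arbitrary
  expressions, not only for homogeneous ones.\<close>

definition grading :: "'a expr \<Rightarrow> 'a expr" where
  "grading = linear_extension (Poly_Mapping.single []) (\<lambda>w. Poly_Mapping.single w (word_sign w))"

lemma expr_diff_eq_linear_extension: "expr_diff = linear_extension (Poly_Mapping.single []) word_diff"
  by (simp add: fun_eq_iff expr_diff_def linear_extension_def scal_def)

lemmas expr_diff_add = expr_scalars.linear_extension_add[of word_diff, folded expr_diff_eq_linear_extension]
  and expr_diff_uminus = expr_scalars.linear_extension_uminus[of word_diff, folded expr_diff_eq_linear_extension]
  and expr_diff_diff = expr_scalars.linear_extension_diff[of word_diff, folded expr_diff_eq_linear_extension]
  and expr_diff_zero = expr_scalars.linear_extension_zero[of word_diff, folded expr_diff_eq_linear_extension]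
  and expr_diff_single = expr_scalars.linear_extension_single[of word_diff, folded expr_diff_eq_linear_extension]

lemma grading_add: "grading (x + y) = grading x + grading y"
  and grading_uminus: "grading (- x) = - grading x"
  and grading_diff: "grading (x - y) = grading x - grading y"
  and grading_zero: "grading 0 = 0"
  by (simp_all add: grading_def expr_scalars.linear_extension_add expr_scalars.linear_extension_uminus
      expr_scalars.linear_extension_diff expr_scalars.linear_extension_zero)

lemma grading_single: "grading (Poly_Mapping.single w c) = Poly_Mapping.single w (c * word_sign w)"
  by (simp add: grading_def expr_scalars.linear_extension_single mult_single plus_list_def)

lemma grading_mult: "grading (x * y) = grading x * grading y"
  unfolding grading_def
  by (rule expr_scalars.linear_extension_mult) (simp add: mult_single plus_list_def word_sign_def power_add)

lemma word_diff_append: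
  "word_diff (u @ v) = word_diff u * Poly_Mapping.single v 1 + Poly_Mapping.single u (word_sign u) * word_diff v"
proof (induction u)
  case Nil
  then show ?case by (simp add: word_sign_def flip: one_expr)
next
  case (Cons l u)
  show ?case
  proof (cases l)
    case (Elem a)
    have "word_sign (l # u) = word_sign u"
      by (simp add: word_sign_def Elem)
    then show ?thesis
      using Cons by (simp add: Elem algebra_simps mult_single plus_list_def flip: gen_mult_single)
  next
    case (Diff a)
    have "word_sign (l # u) = - word_sign u"
      by (simp add: word_sign_def Diff)
    then show ?thesis
      using Cons by (simp add: Diff algebra_simps single_uminus flip: gen_mult_single)
  qed
qed

lemma expr_diff_mult: "expr_diff (x * y) = expr_diff x * y + grading x * expr_diff y"
proof (induction x rule: poly_mapping_additive_induct)
  case (single u c)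
  show ?case
  proof (induction y rule: poly_mapping_additive_induct)
    case (single v d)
    let ?s = "Poly_Mapping.single [] :: complex \<Rightarrow> 'a expr"
    have lc: "?s d * (y * z) = y * (?s d * z)" for y z :: "'a expr"
      by (simp only: mult.assoc[symmetric] single_Nil_central[of d y])
    have "?s c * ?s d * (word_diff u * Poly_Mapping.single v 1) = ?s c * word_diff u * (?s d * Poly_Mapping.single v 1)"
      by (simp only: mult.assoc lc)
    moreover have "?s d * Poly_Mapping.single v 1 = Poly_Mapping.single v d"
      by (simp add: mult_single plus_list_def)
    moreover have "?s c * ?s d * (Poly_Mapping.single u (word_sign u) * word_diff v) =
        (?s c * Poly_Mapping.single u (word_sign u)) * (?s d * word_diff v)"
      by (simp only: mult.assoc lc)
    moreover have "?s c * Poly_Mapping.single u (word_sign u) = Poly_Mapping.single u (c * word_sign u)"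
      by (simp add: mult_single plus_list_def)
    moreover have "?s (c * d) = ?s c * ?s d"
      by (simp add: mult_single plus_list_def)
    ultimately show ?case
      by (simp only: mult_single[of u c v d] plus_list_def expr_diff_single grading_single word_diff_append distrib_left)
  qed (simp add: distrib_left expr_diff_add algebra_simps)
qed (simp add: distrib_right expr_diff_add grading_add algebra_simps)

lemma expr_diff_gen_Elem [simp]: "expr_diff (gen (Elem a)) = gen (Diff a)"
  and expr_diff_gen_Diff [simp]: "expr_diff (gen (Diff a)) = 0"
  and expr_diff_one [simp]: "expr_diff 1 = 0"
  by (simp_all add: gen_def one_expr expr_diff_single mult_single plus_list_def)

lemma grading_gen_Elem [simp]: "grading (gen (Elem a)) = gen (Elem a)"
  and grading_gen_Diff [simp]: "grading (gen (Diff a)) = - gen (Diff a)"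
  and grading_one [simp]: "grading 1 = 1"
  by (simp_all add: gen_def one_expr grading_single word_sign_def single_uminus)

lemma scal_uminus: "scal c (- x) = - scal c x"
  and scal_zero: "scal c 0 = 0"
  by (simp_all add: scal_def)

lemma expr_diff_scal: "expr_diff (scal c x) = scal c (expr_diff x)"
  by (simp add: scal_def expr_diff_mult expr_diff_single grading_single word_sign_def)

lemma grading_scal: "grading (scal c x) = scal c (grading x)"
  by (simp add: scal_def grading_mult grading_single word_sign_def)

lemma word_diff_map_Diff: "word_diff (map Diff as) = 0"
  by (induction as) auto

section \<open>The universal differential graded algebra\<close>

locale unital_subalgebra =
  fixes A :: "'a::cstar_algebra set"
  assumes one_closed: "1 \<in> A"
    and add_closed: "a \<in> A \<Longrightarrow> b \<in> A \<Longrightarrow> a + b \<in> A"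
    and mult_closed: "a \<in> A \<Longrightarrow> b \<in> A \<Longrightarrow> a * b \<in> A"
    and scaleC_closed: "a \<in> A \<Longrightarrow> c *\<^sub>C a \<in> A"
begin

abbreviation exprs :: "'a expr set" where
  "exprs \<equiv> carrier (free_ring A)"

abbreviation cls :: "'a expr \<Rightarrow> 'a expr set" where
  "cls \<equiv> expr_class A"

lemma exprs_iff: "x \<in> exprs \<longleftrightarrow> (\<forall>w\<in>Poly_Mapping.keys x. set w \<subseteq> Elem ` A \<union> Diff ` A)"
  by (simp add: free_ring_def)

lemma exprs_add: "x \<in> exprs \<Longrightarrow> y \<in> exprs \<Longrightarrow> x + y \<in> exprs"
  using keys_add[of x y] by (force simp: exprs_iff)

lemma exprs_uminus: "x \<in> exprs \<Longrightarrow> - x \<in> exprs"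
  by (simp add: exprs_iff in_keys_iff)

lemma exprs_diff: "x \<in> exprs \<Longrightarrow> y \<in> exprs \<Longrightarrow> x - y \<in> exprs"
  using exprs_add[of x "- y"] exprs_uminus[of y] by simp

lemma exprs_mult: "x \<in> exprs \<Longrightarrow> y \<in> exprs \<Longrightarrow> x * y \<in> exprs"
  using keys_mult[of x y] by (force simp: exprs_iff plus_list_def)

lemma exprs_zero: "0 \<in> exprs"
  by (simp add: exprs_iff)

lemma exprs_single: "set w \<subseteq> Elem ` A \<union> Diff ` A \<Longrightarrow> Poly_Mapping.single w c \<in> exprs"
  by (auto simp: exprs_iff)

lemma exprs_one: "1 \<in> exprs"
  by (simp add: one_expr exprs_single)

lemma exprs_gen: "a \<in> A \<Longrightarrow> gen (Elem a) \<in> exprs" "a \<in> A \<Longrightarrow> gen (Diff a) \<in> exprs"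
  by (auto simp: gen_def intro!: exprs_single)

lemma exprs_scal: "x \<in> exprs \<Longrightarrow> scal c x \<in> exprs"
  by (simp add: scal_def exprs_mult exprs_single)

lemmas exprs_closed = exprs_add exprs_uminus exprs_diff exprs_mult exprs_zero exprs_one exprs_gen exprs_scal

lemma exprs_sum: "(\<And>i. i \<in> I \<Longrightarrow> f i \<in> exprs) \<Longrightarrow> sum f I \<in> exprs"
  by (induction I rule: infinite_finite_induct) (auto intro: exprs_closed)

lemma exprs_word_diff: "set w \<subseteq> Elem ` A \<union> Diff ` A \<Longrightarrow> word_diff w \<in> exprs"
  by (induction w rule: word_diff.induct) (auto intro!: exprs_closed exprs_single)

lemma exprs_linear_extension:
  assumes "x \<in> exprs" "\<And>w. set w \<subseteq> Elem ` A \<union> Diff ` A \<Longrightarrow> h w \<in> exprs"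
  shows "linear_extension (Poly_Mapping.single []) h x \<in> exprs"
  unfolding linear_extension_def using assms
  by (auto simp: exprs_iff[of x] intro!: exprs_sum exprs_mult exprs_single)

lemma exprs_expr_diff: "x \<in> exprs \<Longrightarrow> expr_diff x \<in> exprs"
  unfolding expr_diff_eq_linear_extension by (rule exprs_linear_extension[OF _ exprs_word_diff])

lemma exprs_grading: "x \<in> exprs \<Longrightarrow> grading x \<in> exprs"
  unfolding grading_def by (rule exprs_linear_extension[OF _ exprs_single])

lemma free_ring_simps:
  "x \<otimes>\<^bsub>free_ring A\<^esub> y = x * y" "x \<oplus>\<^bsub>free_ring A\<^esub> y = x + y"
  "\<one>\<^bsub>free_ring A\<^esub> = 1" "\<zero>\<^bsub>free_ring A\<^esub> = 0"
  by (simp_all add: free_ring_def)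

lemma ring_free_ring: "ring (free_ring A)"
proof (rule ringI)
  show "abelian_group (free_ring A)"
  proof (rule abelian_groupI)
    fix x assume "x \<in> exprs"
    then show "\<exists>y\<in>exprs. y \<oplus>\<^bsub>free_ring A\<^esub> x = \<zero>\<^bsub>free_ring A\<^esub>"
      using exprs_uminus[of x] by (auto simp: free_ring_simps intro!: bexI[of _ "- x"])
  qed (auto simp: free_ring_simps exprs_closed add.assoc add.commute)
  show "Group.monoid (free_ring A)"
    by (rule monoidI) (auto simp: free_ring_simps exprs_closed mult.assoc)
qed (auto simp: free_ring_simps algebra_simps)

sublocale free: ring "free_ring A"
  by (rule ring_free_ring)

lemma free_ring_a_inv:
  assumes "x \<in> exprs"
  shows "\<ominus>\<^bsub>free_ring A\<^esub> x = - x"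
  by (rule free.minus_equality) (use assms in \<open>auto simp: free_ring_simps exprs_closed\<close>)

lemma dga_relations_subset: "dga_relations A \<subseteq> exprs"
proof
  fix x assume "x \<in> dga_relations A"
  then show "x \<in> exprs"
    by cases (auto intro!: exprs_closed one_closed add_closed mult_closed scaleC_closed)
qed

lemma ideal_dga_ideal: "ideal (dga_ideal A) (free_ring A)"
  unfolding dga_ideal_def by (rule free.genideal_ideal[OF dga_relations_subset])

sublocale rels: ideal "dga_ideal A" "free_ring A"
  by (rule ideal_dga_ideal)

sublocale Om: ring "Omega A"
  unfolding Omega_def by (rule rels.quotient_is_ring)

lemma dga_relations_in_ideal: "x \<in> dga_relations A \<Longrightarrow> x \<in> dga_ideal A"
  unfolding dga_ideal_def using free.genideal_self[OF dga_relations_subset] by blast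

lemma dga_ideal_exprs: "x \<in> dga_ideal A \<Longrightarrow> x \<in> exprs"
  by (rule rels.a_Hcarr)

lemma dga_ideal_zero: "0 \<in> dga_ideal A"
  using rels.zero_closed by (simp add: free_ring_simps)

lemma dga_ideal_add: "x \<in> dga_ideal A \<Longrightarrow> y \<in> dga_ideal A \<Longrightarrow> x + y \<in> dga_ideal A"
  using rels.a_closed[of x y] by (simp add: free_ring_simps)

lemma dga_ideal_uminus: "x \<in> dga_ideal A \<Longrightarrow> - x \<in> dga_ideal A"
  using rels.a_inv_closed[of x] by (simp add: free_ring_a_inv dga_ideal_exprs)

lemma dga_ideal_diff: "x \<in> dga_ideal A \<Longrightarrow> y \<in> dga_ideal A \<Longrightarrow> x - y \<in> dga_ideal A"
  using dga_ideal_add[of x "- y"] dga_ideal_uminus[of y] by simp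

lemma dga_ideal_mult_left: "x \<in> exprs \<Longrightarrow> y \<in> dga_ideal A \<Longrightarrow> x * y \<in> dga_ideal A"
  using rels.I_l_closed[of y x] by (simp add: free_ring_simps)

lemma dga_ideal_mult_right: "x \<in> exprs \<Longrightarrow> y \<in> dga_ideal A \<Longrightarrow> y * x \<in> dga_ideal A"
  using rels.I_r_closed[of y x] by (simp add: free_ring_simps)

lemma dga_ideal_minimal:
  assumes "\<And>x. x \<in> dga_relations A \<Longrightarrow> x \<in> J" and "J \<subseteq> exprs" and "0 \<in> J"
    and "\<And>x y. x \<in> J \<Longrightarrow> y \<in> J \<Longrightarrow> x + y \<in> J" and "\<And>x. x \<in> J \<Longrightarrow> - x \<in> J"
    and "\<And>x y. x \<in> exprs \<Longrightarrow> y \<in> J \<Longrightarrow> x * y \<in> J" and "\<And>x y. x \<in> exprs \<Longrightarrow> y \<in> J \<Longrightarrow> y * x \<in> J"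
  shows "dga_ideal A \<subseteq> J"
  unfolding dga_ideal_def
proof (rule free.genideal_minimal)
  show "ideal J (free_ring A)"
  proof (rule idealI[OF ring_free_ring])
    show "subgroup J (add_monoid (free_ring A))"
    proof (rule free.add.subgroupI)
      fix x assume "x \<in> J"
      then show "\<ominus>\<^bsub>free_ring A\<^esub> x \<in> J"
        using assms(2,5) free_ring_a_inv by (metis subsetD)
    qed (use assms(2-4) in \<open>auto simp: free_ring_simps\<close>)
  qed (use assms(6,7) in \<open>auto simp: free_ring_simps\<close>)
qed (use assms(1) in blast)

text \<open>The elements sent to 0 form an ideal. This is how operators and symbols descend from the
  free algebra to the quotient.\<close>

lemma dga_ideal_vanish:
  fixes f :: "'a expr \<Rightarrow> 'b::ring_1"
  assumes "\<And>x y. f (x + y) = f x + f y" and "\<And>x y. f (x * y) = f x * f y"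
    and "\<And>x. x \<in> dga_relations A \<Longrightarrow> f x = 0" and "x \<in> dga_ideal A"
  shows "f x = 0"
proof -
  have f0: "f 0 = 0"
    using assms(1)[of 0 0] by simp
  have "f (- y) = - f y" for y
    using assms(1)[of y "- y"] f0 by (simp add: eq_neg_iff_add_eq_0 add.commute)
  then have "dga_ideal A \<subseteq> {x \<in> exprs. f x = 0}"
    using assms(1-3) dga_relations_subset f0 by (intro dga_ideal_minimal) (auto intro: exprs_closed)
  then show ?thesis
    using assms(4) by blast
qed

lemma gen_Elem_one: "gen (Elem 1) - 1 \<in> dga_ideal A"
  by (intro dga_relations_in_ideal dga_relations.intros)

text \<open>Modulo \<open>gen (Elem 1) - 1\<close>, the product rule for \<open>1 * 1\<close> reads
  \<open>\<delta>1 = 2 \<delta>1\<close>. This is needed because \<open>\<delta>\<close> must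
  respect the relation that identifies the two units.\<close>

lemma gen_Diff_one: "gen (Diff 1) \<in> dga_ideal A"
proof -
  let ?e = "gen (Elem (1::'a))" and ?d = "gen (Diff (1::'a))"
  have "?d - (?e * ?d + ?d * ?e) \<in> dga_ideal A"
    using dga_relations.intros(7)[of 1 A 1] one_closed by (intro dga_relations_in_ideal) simp
  moreover have "(?e - 1) * ?d + ?d * (?e - 1) \<in> dga_ideal A"
    by (intro dga_ideal_add dga_ideal_mult_left dga_ideal_mult_right gen_Elem_one exprs_gen one_closed)
  ultimately have "?d - (?e * ?d + ?d * ?e) + ((?e - 1) * ?d + ?d * (?e - 1)) \<in> dga_ideal A"
    by (rule dga_ideal_add)
  then have "- ?d \<in> dga_ideal A"
    by (simp add: algebra_simps)
  from dga_ideal_uminus[OF this] show ?thesis by simp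
qed

text \<open>The differential turns the linear and product relations between elements into the
  matching relations between differentials, and it annihilates the latter: for the product rule the
  two terms \<open>\<delta>a \<delta>b\<close> cancel by the sign in \<open>grading\<close>. The
  unit relation leads to \<open>gen_Diff_one\<close>.\<close>

lemma expr_diff_relation:
  assumes "x \<in> dga_relations A"
  shows "grading x \<in> dga_ideal A" and "expr_diff x \<in> dga_ideal A"
proof -
  note simps = grading_add grading_diff grading_mult grading_scal expr_diff_add expr_diff_diff
    expr_diff_mult expr_diff_scal
  have rel: "x \<in> dga_ideal A"
    by (rule dga_relations_in_ideal[OF assms])
  have neg: "- x \<in> dga_ideal A"
    by (rule dga_ideal_uminus[OF rel])
  have "grading x \<in> dga_ideal A \<and> expr_diff x \<in> dga_ideal A"
    using assms
  proof cases
    case (1 a b)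
    then show ?thesis
      using rel dga_relations.intros(5)[of a A b] by (simp add: simps dga_relations_in_ideal)
  next
    case (2 a c)
    then show ?thesis
      using rel dga_relations.intros(6)[of a A c] by (simp add: simps dga_relations_in_ideal)
  next
    case (3 a b)
    then show ?thesis
      using rel dga_relations.intros(7)[of a A b] by (simp add: simps dga_relations_in_ideal add.commute)
  next
    case 4
    then show ?thesis
      using rel gen_Diff_one by (simp add: simps)
  next
    case (5 a b)
    then have "grading x = - x" "expr_diff x = 0"
      by (simp_all add: simps)
    then show ?thesis
      using neg dga_ideal_zero by simp
  next
    case (6 a c)
    then have "grading x = - x" "expr_diff x = 0"
      by (simp_all add: simps scal_uminus scal_zero)
    then show ?thesis
      using neg dga_ideal_zero by simp
  next
    case (7 a b)
    then have "grading x = - x" "expr_diff x = 0"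
      by (simp_all add: simps)
    then show ?thesis
      using neg dga_ideal_zero by simp
  qed
  then show "grading x \<in> dga_ideal A" and "expr_diff x \<in> dga_ideal A"
    by auto
qed

lemma expr_diff_ideal:
  assumes "x \<in> dga_ideal A"
  shows "expr_diff x \<in> dga_ideal A"
proof -
  \<comment> \<open>Stability under \<open>grading\<close> is included because differentiating
    \<open>y * x\<close> with \<open>y\<close> in the ideal produces \<open>grading y\<close> as a
    left factor.\<close>
  let ?J = "{x \<in> dga_ideal A. grading x \<in> dga_ideal A \<and> expr_diff x \<in> dga_ideal A}"
  have "dga_ideal A \<subseteq> ?J"
  proof (rule dga_ideal_minimal)
    show "x \<in> ?J" if "x \<in> dga_relations A" for x
      using that by (simp add: dga_relations_in_ideal expr_diff_relation)
    show "?J \<subseteq> exprs"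
      using dga_ideal_exprs by blast
    show "0 \<in> ?J"
      by (simp add: dga_ideal_zero grading_zero expr_diff_zero)
    show "x + y \<in> ?J" if "x \<in> ?J" "y \<in> ?J" for x y
      using that by (simp add: dga_ideal_add grading_add expr_diff_add)
    show "- x \<in> ?J" if "x \<in> ?J" for x
      using that by (simp add: dga_ideal_uminus grading_uminus expr_diff_uminus)
    show "x * y \<in> ?J" "y * x \<in> ?J" if "x \<in> exprs" "y \<in> ?J" for x y
      using that exprs_grading[OF that(1)] exprs_expr_diff[OF that(1)]
      by (simp_all add: dga_ideal_mult_left dga_ideal_mult_right dga_ideal_add grading_mult expr_diff_mult)
  qed
  then show ?thesis
    using assms by blast
qed

lemma expr_class_iff: "y \<in> cls x \<longleftrightarrow> y - x \<in> dga_ideal A"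
proof
  assume "y - x \<in> dga_ideal A"
  then show "y \<in> cls x"
    unfolding expr_class_def a_r_coset_def' free_ring_simps by (force intro: bexI[of _ "y - x"])
qed (auto simp: expr_class_def a_r_coset_def' free_ring_simps)

lemma expr_class_self: "x \<in> cls x"
  by (simp add: expr_class_iff dga_ideal_zero)

lemma expr_class_eq_iff: "cls x = cls y \<longleftrightarrow> x - y \<in> dga_ideal A"
proof
  assume "x - y \<in> dga_ideal A"
  moreover have "z - x \<in> dga_ideal A \<longleftrightarrow> z - y \<in> dga_ideal A" if "x - y \<in> dga_ideal A" for z
    using dga_ideal_add[of "z - x" "x - y"] dga_ideal_diff[of "z - y" "x - y"] that by auto
  ultimately show "cls x = cls y"
    by (auto simp: expr_class_iff)
next
  assume "cls x = cls y"
  then show "x - y \<in> dga_ideal A"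
    using expr_class_self[of x] by (simp add: expr_class_iff)
qed

lemma carrier_Omega: "carrier (Omega A) = cls ` exprs"
  unfolding Omega_def FactRing_def A_RCOSETS_def' expr_class_def a_r_coset_def' by auto

lemma Omega_mult: "x \<in> exprs \<Longrightarrow> y \<in> exprs \<Longrightarrow> cls x \<otimes>\<^bsub>Omega A\<^esub> cls y = cls (x * y)"
  using rels.rcoset_mult_add[of x y] by (simp add: Omega_def FactRing_def expr_class_def free_ring_simps)

lemma Omega_add: "x \<in> exprs \<Longrightarrow> y \<in> exprs \<Longrightarrow> cls x \<oplus>\<^bsub>Omega A\<^esub> cls y = cls (x + y)"
  using rels.a_rcos_sum[of x y] by (simp add: Omega_def FactRing_def expr_class_def free_ring_simps)

lemma Omega_zero: "\<zero>\<^bsub>Omega A\<^esub> = cls 0"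
  by (auto simp: Omega_def FactRing_def expr_class_iff)

lemma Omega_uminus:
  assumes "x \<in> exprs"
  shows "\<ominus>\<^bsub>Omega A\<^esub> cls x = cls (- x)"
  by (rule Om.minus_equality)
    (use assms in \<open>auto simp: carrier_Omega Omega_add Omega_zero exprs_uminus\<close>)

lemma delta_class:
  assumes "x \<in> exprs"
  shows "delta A (cls x) = cls (expr_diff x)"
proof -
  have "cls (expr_diff y) = cls (expr_diff x)" if "y \<in> cls x" for y
    using that expr_diff_ideal[of "y - x"] by (simp add: expr_class_iff expr_class_eq_iff expr_diff_diff)
  then show ?thesis
    unfolding delta_def using expr_class_self[of x] by blast
qed

section \<open>Normal forms of homogeneous forms\<close>

definition form_word :: "'a \<Rightarrow> 'a list \<Rightarrow> 'a expr" where
  "form_word a0 as = Poly_Mapping.single (Elem a0 # map Diff as) 1"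

lemma form_word_exprs: "a0 \<in> A \<Longrightarrow> set as \<subseteq> A \<Longrightarrow> form_word a0 as \<in> exprs"
  unfolding form_word_def by (rule exprs_single) auto

lemma elementary_form_eq:
  assumes "a0 \<in> A" "set as \<subseteq> A"
  shows "elementary_form A a0 as = cls (form_word a0 as)"
  using assms(2)
proof (induction as rule: rev_induct)
  case Nil
  then show ?case
    by (simp add: elementary_form_def elem_form_def form_word_def gen_def)
next
  case (snoc a as)
  then have "elementary_form A a0 (as @ [a]) = cls (form_word a0 as) \<otimes>\<^bsub>Omega A\<^esub> cls (gen (Diff a))"
    using delta_class[of "gen (Elem a)"]
    by (simp add: elementary_form_def elem_form_def exprs_gen)
  also have "\<dots> = cls (form_word a0 as * gen (Diff a))"
    using snoc assms(1) by (intro Omega_mult) (auto intro: form_word_exprs exprs_gen)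
  finally show ?case
    by (simp add: form_word_def gen_def mult_single plus_list_def)
qed

text \<open>The differential of a word has no leading element, so \<open>1\<close> is put in front
  to restore the normal form; the two expressions agree only modulo the ideal.\<close>

lemma expr_diff_form_word:
  assumes "a0 \<in> A" "set as \<subseteq> A"
  shows "cls (expr_diff (form_word a0 as)) = cls (form_word 1 (a0 # as))"
proof -
  let ?w = "Poly_Mapping.single (Diff a0 # map Diff as) 1 :: 'a expr"
  have "expr_diff (form_word a0 as) = ?w"
    using gen_mult_single[of "Diff a0" "map Diff as" 1]
    by (simp add: form_word_def expr_diff_single word_diff_map_Diff flip: one_expr)
  moreover have "form_word 1 (a0 # as) = gen (Elem 1) * ?w"
    by (simp add: form_word_def gen_mult_single)
  moreover have "(gen (Elem 1) - 1) * ?w \<in> dga_ideal A"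
    by (rule dga_ideal_mult_right[OF _ gen_Elem_one], rule exprs_single) (use assms in auto)
  ultimately have "cls (form_word 1 (a0 # as)) = cls (expr_diff (form_word a0 as))"
    by (simp only: expr_class_eq_iff left_diff_distrib mult_1_left)
  then show ?thesis ..
qed

text \<open>Representatives of the forms of degree \<open>n\<close>, built to mirror the rules of
  \<open>generate\<close>. Complex coefficients are absorbed by \<open>a0\<close>, so sums and
  negatives suffice.\<close>

inductive_set form_exprs :: "nat \<Rightarrow> 'a expr set" for n where
  zero: "0 \<in> form_exprs n"
| word: "a0 \<in> A \<Longrightarrow> set as \<subseteq> A \<Longrightarrow> length as = n \<Longrightarrow> form_word a0 as \<in> form_exprs n"
| neg_word: "a0 \<in> A \<Longrightarrow> set as \<subseteq> A \<Longrightarrow> length as = n \<Longrightarrow> - form_word a0 as \<in> form_exprs n"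
| add: "x \<in> form_exprs n \<Longrightarrow> y \<in> form_exprs n \<Longrightarrow> x + y \<in> form_exprs n"

lemma form_exprs_uminus: "x \<in> form_exprs n \<Longrightarrow> - x \<in> form_exprs n"
proof (induction rule: form_exprs.induct)
  case (add x y)
  then show ?case
    using form_exprs.add[of "- x" n "- y"] by simp
qed (auto intro: form_exprs.intros)

lemma form_exprs_diff: "x \<in> form_exprs n \<Longrightarrow> y \<in> form_exprs n \<Longrightarrow> x - y \<in> form_exprs n"
  using form_exprs.add[of x n "- y"] form_exprs_uminus[of y n] by simp

lemma form_exprs_exprs: "x \<in> form_exprs n \<Longrightarrow> x \<in> exprs"
  by (induction rule: form_exprs.induct) (auto intro: exprs_closed form_word_exprs)

lemma Omega_deg_eq: "Omega_deg A n = cls ` form_exprs n"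
proof (intro equalityI subsetI)
  let ?S = "{elementary_form A a0 as | a0 as. a0 \<in> A \<and> set as \<subseteq> A \<and> length as = n}"
  fix \<omega> assume "\<omega> \<in> Omega_deg A n"
  then have "\<omega> \<in> generate (add_monoid (Omega A)) ?S"
    by (simp add: Omega_deg_def)
  then show "\<omega> \<in> cls ` form_exprs n"
  proof induction
    case one
    then show ?case
      by (auto simp: Omega_zero intro: form_exprs.zero)
  next
    case (incl h)
    then show ?case
      by (auto simp: elementary_form_eq intro: form_exprs.word)
  next
    case (inv h)
    then obtain a0 as where h: "a0 \<in> A" "set as \<subseteq> A" "length as = n" "h = cls (form_word a0 as)"
      by (auto simp: elementary_form_eq)
    then have "inv\<^bsub>add_monoid (Omega A)\<^esub> h = cls (- form_word a0 as)"
      using Omega_uminus[OF form_word_exprs[of a0 as]] by (simp add: a_inv_def)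
    then show ?case
      using h by (auto intro: form_exprs.neg_word)
  next
    case (eng h1 h2)
    then show ?case
      by (auto simp: Omega_add form_exprs_exprs intro!: imageI form_exprs.add)
  qed
next
  let ?G = "generate (add_monoid (Omega A)) {elementary_form A a0 as | a0 as. a0 \<in> A \<and> set as \<subseteq> A \<and> length as = n}"
  fix \<omega> assume "\<omega> \<in> cls ` form_exprs n"
  then obtain x where x: "x \<in> form_exprs n" "\<omega> = cls x" by blast
  have gen: "cls (form_word a0 as) \<in> {elementary_form A a0 as | a0 as. a0 \<in> A \<and> set as \<subseteq> A \<and> length as = n}"
    if "a0 \<in> A" "set as \<subseteq> A" "length as = n" for a0 as
    unfolding mem_Collect_eq using that elementary_form_eq[of a0 as] by metis
  from x(1) have "cls x \<in> ?G"
  proof induction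
    case zero
    then show ?case
      using generate.one[of "add_monoid (Omega A)"] by (simp add: Omega_zero)
  next
    case (word a0 as)
    then show ?case
      by (intro generate.incl gen)
  next
    case (neg_word a0 as)
    then have "inv\<^bsub>add_monoid (Omega A)\<^esub> (cls (form_word a0 as)) = cls (- form_word a0 as)"
      using Omega_uminus[OF form_word_exprs[of a0 as]] by (simp add: a_inv_def)
    moreover have "inv\<^bsub>add_monoid (Omega A)\<^esub> (cls (form_word a0 as)) \<in> ?G"
      using neg_word by (intro generate.inv gen)
    ultimately show ?case by simp
  next
    case (add x y)
    then show ?case
      using generate.eng[OF add.IH] by (simp add: Omega_add form_exprs_exprs)
  qed
  then show "\<omega> \<in> Omega_deg A n"
    by (simp add: x Omega_deg_def)
qed

end

section \<open>Operators and symbols of expressions\<close>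

interpretation laurent_scalars: scalar_embedding "Poly_Mapping.single 0 :: complex \<Rightarrow> laurent"
  by standard (simp_all add: single_add mult_single mult.commute)

interpretation op_scalars: scalar_embedding "\<lambda>c. c *\<^sub>C (1 :: 'i bounded_op)"
  by standard (simp_all add: scaleC_add_left scaleC_mult_left scaleC_mult_right scaleC_scaleC mult.commute)

lemma expr_op_eq_linear_extension:
  "expr_op \<pi> = linear_extension (\<lambda>c. c *\<^sub>C 1) (\<lambda>w. prod_list (map (letter_op \<pi>) w))"
  by (simp add: fun_eq_iff expr_op_def linear_extension_def scaleC_mult_left)

fun letter_symbol :: "('a \<Rightarrow> laurent) \<Rightarrow> 'a letter \<Rightarrow> laurent" where
  "letter_symbol \<sigma> (Elem a) = \<sigma> a"
| "letter_symbol \<sigma> (Diff a) = laurent_deriv (\<sigma> a)"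

text \<open>The power of \<open>S\<close> is dropped and remembered by the degree alone, which
  leaves a ring homomorphism into a commutative ring.\<close>

definition expr_symbol :: "('a \<Rightarrow> laurent) \<Rightarrow> 'a expr \<Rightarrow> laurent" where
  "expr_symbol \<sigma> = linear_extension (Poly_Mapping.single 0) (\<lambda>w. prod_list (map (letter_symbol \<sigma>) w))"

lemma expr_op_add: "expr_op \<pi> (x + y) = expr_op \<pi> x + expr_op \<pi> y"
  and expr_op_diff: "expr_op \<pi> (x - y) = expr_op \<pi> x - expr_op \<pi> y"
  and expr_op_uminus: "expr_op \<pi> (- x) = - expr_op \<pi> x"
  and expr_op_zero: "expr_op \<pi> 0 = 0"
  and expr_op_single: "expr_op \<pi> (Poly_Mapping.single w c) = c *\<^sub>C prod_list (map (letter_op \<pi>) w)"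
  by (simp_all add: expr_op_eq_linear_extension op_scalars.linear_extension_add
      op_scalars.linear_extension_diff op_scalars.linear_extension_uminus op_scalars.linear_extension_zero
      op_scalars.linear_extension_single scaleC_mult_left)

lemma expr_op_mult: "expr_op \<pi> (x * y) = expr_op \<pi> x * expr_op \<pi> y"
  unfolding expr_op_eq_linear_extension by (rule op_scalars.linear_extension_mult) simp

lemma expr_op_gen [simp]: "expr_op \<pi> (gen l) = letter_op \<pi> l"
  and expr_op_one [simp]: "expr_op \<pi> 1 = 1"
  by (simp_all add: gen_def one_expr expr_op_single)

lemma expr_op_scal: "expr_op \<pi> (scal c x) = c *\<^sub>C expr_op \<pi> x"
  by (simp add: scal_def expr_op_mult expr_op_single scaleC_mult_left)

lemma expr_symbol_add: "expr_symbol \<sigma> (x + y) = expr_symbol \<sigma> x + expr_symbol \<sigma> y"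
  and expr_symbol_diff: "expr_symbol \<sigma> (x - y) = expr_symbol \<sigma> x - expr_symbol \<sigma> y"
  and expr_symbol_uminus: "expr_symbol \<sigma> (- x) = - expr_symbol \<sigma> x"
  and expr_symbol_zero: "expr_symbol \<sigma> 0 = 0"
  and expr_symbol_single: "expr_symbol \<sigma> (Poly_Mapping.single w c) =
    Poly_Mapping.single 0 c * prod_list (map (letter_symbol \<sigma>) w)"
  by (simp_all add: expr_symbol_def laurent_scalars.linear_extension_add
      laurent_scalars.linear_extension_diff laurent_scalars.linear_extension_uminus
      laurent_scalars.linear_extension_zero laurent_scalars.linear_extension_single)

lemma expr_symbol_mult: "expr_symbol \<sigma> (x * y) = expr_symbol \<sigma> x * expr_symbol \<sigma> y"
  unfolding expr_symbol_def by (rule laurent_scalars.linear_extension_mult) simp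

lemma expr_symbol_gen [simp]: "expr_symbol \<sigma> (gen l) = letter_symbol \<sigma> l"
  and expr_symbol_one [simp]: "expr_symbol \<sigma> 1 = 1"
  by (simp_all add: gen_def one_expr expr_symbol_single)

lemma expr_symbol_scal: "expr_symbol \<sigma> (scal c x) = Poly_Mapping.single 0 c * expr_symbol \<sigma> x"
  by (simp add: scal_def expr_symbol_mult expr_symbol_single)

lemma expr_symbol_form_word:
  "expr_symbol \<sigma> (Poly_Mapping.single (Elem a0 # map Diff as) 1) = \<sigma> a0 * (\<Prod>a\<leftarrow>as. laurent_deriv (\<sigma> a))"
  by (simp add: expr_symbol_single o_def)

section \<open>The inner product on forms\<close>

lemma op_trace_heat:
  assumes "0 < \<epsilon>"
  shows "op_trace (heat \<epsilon>) = complex_of_real (heat_total \<epsilon>)"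
proof -
  have "op_trace (heat \<epsilon>) = (\<Sum>\<^sub>\<infinity>k. complex_of_real (heat_weight \<epsilon> k))"
    unfolding op_trace_def
    by (intro infsum_cong) (simp add: coord_heat[OF assms] cinner_ket_left coord_ket heat_weight_def)
  then show ?thesis
    using infsumI[OF has_sum_of_real[OF has_sum_infsum[OF heat_weight_summable[OF assms]]]]
    by (simp add: heat_total_def)
qed

lemma op_trace_square_heat:
  assumes "0 < \<epsilon>"
  shows "op_trace (star F * F * heat \<epsilon>) =
    complex_of_real (\<Sum>\<^sub>\<infinity>k. heat_weight \<epsilon> k * (norm (F \<cdot>\<^sub>o ket k))\<^sup>2)"
proof -
  have b: "\<bar>(norm (F \<cdot>\<^sub>o ket k))\<^sup>2\<bar> \<le> (norm F)\<^sup>2" for k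
    using norm_apply_op_le[of F "ket k"] by (simp add: power_mono)
  have "cinner (F \<cdot>\<^sub>o ket k) (F \<cdot>\<^sub>o ket k) = complex_of_real ((norm (F \<cdot>\<^sub>o ket k))\<^sup>2)" for k
    by (simp only: cinner_self norm_ell2_square)
  then have "op_trace (star F * F * heat \<epsilon>) =
      (\<Sum>\<^sub>\<infinity>k. complex_of_real (heat_weight \<epsilon> k * (norm (F \<cdot>\<^sub>o ket k))\<^sup>2))"
    unfolding op_trace_def
    by (intro infsum_cong)
      (simp add: heat_ket[OF assms] cinner_star_right apply_op_scaleC cinner_scaleC_right
        heat_weight_def del: scaleC_of_real of_real_power)
  then show ?thesis
    using infsumI[OF has_sum_of_real[OF has_sum_infsum[OF heat_average_summable[OF assms b]]]]
    by simp
qed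

text \<open>The quotient is bounded and has an ordinary limit at 0, so every generalized limit takes
  that value.\<close>

lemma generalized_limit_heat_average:
  assumes L: "generalized_limit L" and F: "has_symbol F p n"
  shows "L (\<lambda>\<epsilon>. op_trace (star F * F * heat \<epsilon>) / op_trace (heat \<epsilon>)) = complex_of_real (laurent_norm2 p)"
proof -
  let ?n = "\<lambda>k. (norm (F \<cdot>\<^sub>o ket k))\<^sup>2"
  define f where "f \<epsilon> = op_trace (star F * F * heat \<epsilon>) / op_trace (heat \<epsilon>)" for \<epsilon>
  define r where "r \<epsilon> = (\<Sum>\<^sub>\<infinity>k. heat_weight \<epsilon> k * ?n k) / heat_total \<epsilon>" for \<epsilon>
  have b: "\<bar>?n k\<bar> \<le> (norm F)\<^sup>2" for k
    using norm_apply_op_le[of F "ket k"] by (simp add: power_mono)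
  have fr: "f \<epsilon> = complex_of_real (r \<epsilon>)" if "0 < \<epsilon>" for \<epsilon>
    using that by (simp add: f_def r_def op_trace_heat op_trace_square_heat)
  have rb: "0 \<le> r \<epsilon> \<and> r \<epsilon> \<le> (norm F)\<^sup>2" if e: "0 < \<epsilon>" for \<epsilon>
  proof -
    note Z = heat_total_pos[OF e]
    have "(\<Sum>\<^sub>\<infinity>k. heat_weight \<epsilon> k * ?n k) \<le> (\<Sum>\<^sub>\<infinity>k. heat_weight \<epsilon> k * (norm F)\<^sup>2)"
      by (intro infsum_mono heat_average_summable[OF e b] summable_on_cmult_left heat_weight_summable[OF e])
        (use b in \<open>auto intro!: mult_left_mono\<close>)
    also have "\<dots> = heat_total \<epsilon> * (norm F)\<^sup>2"
      by (simp add: heat_total_def infsum_cmult_left')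
    finally have "r \<epsilon> \<le> (norm F)\<^sup>2"
      using Z by (simp add: r_def pos_divide_le_eq mult.commute)
    moreover have "0 \<le> (\<Sum>\<^sub>\<infinity>k. heat_weight \<epsilon> k * ?n k)"
      by (intro infsum_nonneg) simp
    ultimately show ?thesis
      using Z by (simp add: r_def)
  qed
  have "bounded (f ` {0<..})"
    unfolding bounded_iff
  proof (intro exI ballI)
    fix z assume "z \<in> f ` {0<..}"
    then obtain \<epsilon> where "0 < \<epsilon>" "z = complex_of_real (r \<epsilon>)"
      using fr by auto
    then show "norm z \<le> (norm F)\<^sup>2"
      using rb[of \<epsilon>] by simp
  qed
  moreover have "(r \<longlongrightarrow> laurent_norm2 p) (at_right 0)"
    unfolding r_def
  proof (rule heat_average_tendsto[OF b])
    fix e :: real assume "0 < e"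
    then have "\<forall>\<^sub>F k in deep_nat. dist (?n k) (laurent_norm2 p) < e"
      using has_symbol_norm_tendsto[OF F] by (simp add: tendsto_iff)
    then obtain P where P: "eventually P sequentially"
      and *: "\<And>k. P (fst k) \<Longrightarrow> dist (?n k) (laurent_norm2 p) < e"
      by (auto simp: deep_nat_def eventually_filtercomap)
    from P obtain I where "\<And>i. I \<le> i \<Longrightarrow> P i"
      by (auto simp: eventually_sequentially)
    with * show "\<exists>I. \<forall>i\<ge>I. \<forall>j. \<bar>?n (i, j) - laurent_norm2 p\<bar> \<le> e"
      by (intro exI[of _ I]) (force simp: dist_real_def intro: less_imp_le)
  qed
  then have "((\<lambda>\<epsilon>. complex_of_real (r \<epsilon>)) \<longlongrightarrow> complex_of_real (laurent_norm2 p)) (at_right 0)"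
    by (rule tendsto_of_real)
  then have "(f \<longlongrightarrow> complex_of_real (laurent_norm2 p)) (at_right 0)"
    by (rule Lim_transform_eventually)
      (use eventually_at_right_less[of "0::real"] in \<open>auto simp: fr elim: eventually_mono\<close>)
  ultimately have "L f = complex_of_real (laurent_norm2 p)"
    using L by (simp add: generalized_limit_def)
  then show ?thesis
    by (simp add: f_def[abs_def])
qed

section \<open>Square integrable forms over the quantum group\<close>

locale SUq2_geometry =
  fixes q :: real
    and \<alpha> \<beta> :: "'a::cstar_algebra"
    and \<pi> :: "'a \<Rightarrow> (nat \<times> int) bounded_op"
    and \<sigma> :: "'a \<Rightarrow> laurent"
    and L :: "(real \<Rightarrow> complex) \<Rightarrow> complex"
  assumes q: "0 < q" "q < 1"
    and representation: "SUq2_representation q \<alpha> \<beta> \<pi>"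
    and sigma: "circle_restriction \<alpha> \<beta> \<sigma>"
    and limit: "generalized_limit L"
begin

abbreviation Af :: "'a set" where
  "Af \<equiv> star_subalgebra {\<alpha>, \<beta>}"

sublocale unital_subalgebra "star_subalgebra {\<alpha>, \<beta>}"
  by standard (auto intro: star_subalgebra.intros)

abbreviation symb :: "'a expr \<Rightarrow> laurent" where
  "symb \<equiv> expr_symbol \<sigma>"

lemma pi_simps:
  "\<pi> (x + y) = \<pi> x + \<pi> y" "\<pi> (x * y) = \<pi> x * \<pi> y" "\<pi> (c *\<^sub>C x) = c *\<^sub>C \<pi> x" "\<pi> 1 = 1"
  using representation by (auto simp: SUq2_representation_def star_hom_def)

lemma sigma_add: "a \<in> Af \<Longrightarrow> b \<in> Af \<Longrightarrow> \<sigma> (a + b) = \<sigma> a + \<sigma> b"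
  and sigma_mult: "a \<in> Af \<Longrightarrow> b \<in> Af \<Longrightarrow> \<sigma> (a * b) = \<sigma> a * \<sigma> b"
  and sigma_scaleC: "a \<in> Af \<Longrightarrow> \<sigma> (c *\<^sub>C a) = Poly_Mapping.single 0 c * \<sigma> a"
  and sigma_star: "a \<in> Af \<Longrightarrow> \<sigma> (star a) = laurent_star (\<sigma> a)"
  and sigma_one: "\<sigma> 1 = 1"
  and sigma_alpha: "\<sigma> \<alpha> = Poly_Mapping.single 1 1"
  and sigma_beta: "\<sigma> \<beta> = 0"
  using sigma by (auto simp: circle_restriction_def Let_def)

lemma sigma_surj: obtains a where "a \<in> Af" "\<sigma> a = p"
proof -
  have "\<sigma> ` Af = UNIV"
    using sigma by (simp add: circle_restriction_def Let_def)
  then show ?thesis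
    using that by (metis UNIV_I imageE)
qed

lemma alpha_closed: "\<alpha> \<in> Af" and beta_closed: "\<beta> \<in> Af"
  by (auto intro: star_subalgebra.generator)

lemma has_commutator_pi: "a \<in> Af \<Longrightarrow> has_commutator (\<pi> a) (dirac_commutator (\<pi> a))"
  using representation_symbol[OF q representation sigma] by blast

lemma expr_op_relation: "x \<in> dga_relations Af \<Longrightarrow> expr_op \<pi> x = 0"
  by (induction rule: dga_relations.induct)
    (simp_all add: expr_op_diff expr_op_add expr_op_mult expr_op_scal pi_simps
      dirac_commutator_eq[OF has_commutator_add[OF has_commutator_pi has_commutator_pi]]
      dirac_commutator_eq[OF has_commutator_mult[OF has_commutator_pi has_commutator_pi]]
      dirac_commutator_eq[OF has_commutator_scaleC[OF has_commutator_pi]])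

lemma symb_relation: "x \<in> dga_relations Af \<Longrightarrow> symb x = 0"
  by (induction rule: dga_relations.induct)
    (simp_all add: expr_symbol_diff expr_symbol_add expr_symbol_mult expr_symbol_scal sigma_add
      sigma_mult sigma_scaleC sigma_one laurent_deriv_add laurent_deriv_mult)

lemma expr_op_cong: "cls x = cls y \<Longrightarrow> expr_op \<pi> x = expr_op \<pi> y"
  using dga_ideal_vanish[OF expr_op_add expr_op_mult expr_op_relation, of "x - y"]
  by (simp add: expr_class_eq_iff expr_op_diff)

lemma symb_cong: "cls x = cls y \<Longrightarrow> symb x = symb y"
  using dga_ideal_vanish[OF expr_symbol_add expr_symbol_mult symb_relation, of "x - y"]
  by (simp add: expr_class_eq_iff expr_symbol_diff)

lemma form_op_class: "form_op \<pi> (cls x) = expr_op \<pi> x"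
proof -
  have "expr_op \<pi> ` cls x = {expr_op \<pi> x}"
  proof -
    have "expr_op \<pi> y = expr_op \<pi> x" if "y \<in> cls x" for y
      using that expr_op_cong by (simp add: expr_class_iff expr_class_eq_iff)
    then show ?thesis
      using expr_class_self[of x] by blast
  qed
  then show ?thesis
    by (simp add: form_op_def)
qed

lemma symb_form_word: "symb (form_word a0 as) = \<sigma> a0 * (\<Prod>a\<leftarrow>as. laurent_deriv (\<sigma> a))"
  unfolding form_word_def by (rule expr_symbol_form_word)

lemma has_symbol_form_word:
  assumes "a0 \<in> Af" "set as \<subseteq> Af"
  shows "has_symbol (expr_op \<pi> (form_word a0 as)) (symb (form_word a0 as)) (length as)"
proof -
  have "has_symbol (prod_list (map (letter_op \<pi>) (map Diff as))) (\<Prod>a\<leftarrow>as. laurent_deriv (\<sigma> a)) (length as)"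
    using assms(2)
  proof (induction as)
    case Nil
    then show ?case by (simp add: has_symbol_one)
  next
    case (Cons a as)
    then have "has_symbol (dirac_commutator (\<pi> a)) (laurent_deriv (\<sigma> a)) 1"
      using representation_symbol[OF q representation sigma] by (simp add: has_star_symbol_def)
    from has_symbol_mult[OF this Cons.IH] Cons.prems show ?case by simp
  qed
  moreover have "has_symbol (\<pi> a0) (\<sigma> a0) 0"
    using representation_symbol[OF q representation sigma assms(1)] by (simp add: has_star_symbol_def)
  ultimately have "has_symbol (\<pi> a0 * prod_list (map (letter_op \<pi>) (map Diff as)))
      (\<sigma> a0 * (\<Prod>a\<leftarrow>as. laurent_deriv (\<sigma> a))) (0 + length as)"
    by (rule has_symbol_mult[rotated])
  then show ?thesis
    unfolding symb_form_word by (simp add: form_word_def expr_op_single)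
qed

lemma has_symbol_form:
  "x \<in> form_exprs n \<Longrightarrow> has_symbol (expr_op \<pi> x) (symb x) n"
proof (induction rule: form_exprs.induct)
  case zero
  then show ?case
    by (simp add: expr_op_zero expr_symbol_zero has_symbol_zero)
next
  case (word a0 as)
  then show ?case
    using has_symbol_form_word by blast
next
  case (neg_word a0 as)
  then show ?case
    using has_symbol_uminus[OF has_symbol_form_word, of a0 as]
    by (simp add: expr_op_uminus expr_symbol_uminus)
next
  case (add x y)
  then show ?case
    by (simp add: expr_op_add expr_symbol_add has_symbol_add)
qed

lemma null_forms_eq: "null_forms Af \<pi> L n = cls ` {x \<in> form_exprs n. symb x = 0}"
proof -
  have "form_inner \<pi> L (cls x) (cls x) = complex_of_real (laurent_norm2 (symb x))" if "x \<in> form_exprs n" for x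
    unfolding form_inner_def form_op_class
    by (rule generalized_limit_heat_average[OF limit has_symbol_form[OF that]])
  then show ?thesis
    unfolding null_forms_def Omega_deg_eq by (auto simp: laurent_norm2_eq_0)
qed

text \<open>Differentials and products of normal forms are again in normal form only modulo the
  ideal, so membership is tested on classes.\<close>

definition represents_form :: "nat \<Rightarrow> 'a expr \<Rightarrow> bool" where
  "represents_form n x \<longleftrightarrow> (\<exists>y\<in>form_exprs n. cls x = cls y)"

lemma represents_formI: "y \<in> form_exprs n \<Longrightarrow> x - y \<in> dga_ideal Af \<Longrightarrow> represents_form n x"
  by (auto simp: represents_form_def expr_class_eq_iff)

lemma represents_form_form: "x \<in> form_exprs n \<Longrightarrow> represents_form n x"
  by (auto simp: represents_form_def)

lemma represents_form_add:
  assumes "represents_form n x" "represents_form n y"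
  shows "represents_form n (x + y)"
proof -
  from assms obtain x' y' where *: "x' \<in> form_exprs n" "y' \<in> form_exprs n"
    "x - x' \<in> dga_ideal Af" "y - y' \<in> dga_ideal Af"
    by (auto simp: represents_form_def expr_class_eq_iff)
  show ?thesis
    by (rule represents_formI[OF form_exprs.add[OF *(1,2)]])
      (use dga_ideal_add[OF *(3,4)] in \<open>simp add: algebra_simps\<close>)
qed

lemma represents_form_uminus:
  assumes "represents_form n x"
  shows "represents_form n (- x)"
proof -
  from assms obtain x' where *: "x' \<in> form_exprs n" "x - x' \<in> dga_ideal Af"
    by (auto simp: represents_form_def expr_class_eq_iff)
  show ?thesis
    by (rule represents_formI[OF form_exprs_uminus[OF *(1)]])
      (use dga_ideal_uminus[OF *(2)] in \<open>simp add: algebra_simps\<close>)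
qed

lemma form_exprs_map_represents:
  assumes "\<And>x y. f (x + y) = f x + f y" "x \<in> form_exprs n"
    and "\<And>a0 as. a0 \<in> Af \<Longrightarrow> set as \<subseteq> Af \<Longrightarrow> length as = n \<Longrightarrow> represents_form m (f (form_word a0 as))"
  shows "represents_form m (f x)"
proof -
  have f0: "f 0 = 0"
    using assms(1)[of 0 0] by simp
  have fm: "f (- y) = - f y" for y
    using assms(1)[of y "- y"] f0 by (simp add: eq_neg_iff_add_eq_0 add.commute)
  show ?thesis
    using assms(2)
    by induction (simp_all add: f0 fm assms(1,3) represents_form_add represents_form_uminus
        represents_form_form form_exprs.zero)
qed

lemma represents_form_diff: "x \<in> form_exprs n \<Longrightarrow> represents_form (Suc n) (expr_diff x)"
proof (rule form_exprs_map_represents[where n=n, OF expr_diff_add])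
  fix a0 as assume "a0 \<in> Af" "set as \<subseteq> Af" "length as = n"
  then show "represents_form (Suc n) (expr_diff (form_word a0 as))"
    unfolding represents_form_def
    by (intro bexI[of _ "form_word 1 (a0 # as)"] expr_diff_form_word form_exprs.word) (auto intro: one_closed)
qed

lemma represents_form_mult_left:
  assumes "a \<in> Af"
  shows "x \<in> form_exprs n \<Longrightarrow> represents_form n (gen (Elem a) * x)"
proof (rule form_exprs_map_represents[where n=n, OF distrib_left])
  fix a0 as assume w: "a0 \<in> Af" "set as \<subseteq> Af" "length as = n"
  let ?w = "Poly_Mapping.single (map Diff as) 1 :: 'a expr"
  have "gen (Elem (a * a0)) - gen (Elem a) * gen (Elem a0) \<in> dga_ideal Af"
    using w assms by (intro dga_relations_in_ideal dga_relations.intros)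
  then have "- ((gen (Elem (a * a0)) - gen (Elem a) * gen (Elem a0)) * ?w) \<in> dga_ideal Af"
    by (intro dga_ideal_uminus dga_ideal_mult_right exprs_single) (use w in auto)
  then show "represents_form n (gen (Elem a) * form_word a0 as)"
    by (intro represents_formI[OF form_exprs.word[of "a * a0" as]])
      (use w assms in \<open>simp_all add: mult_closed form_word_def algebra_simps flip: gen_mult_single\<close>)
qed

text \<open>In degree 1 the product rule absorbs the right factor: \<open>a\<^sub>0
  (\<delta>a\<^sub>1) a = a\<^sub>0 \<delta>(a\<^sub>1 a) - (a\<^sub>0 a\<^sub>1) \<delta>a\<close>.
  Only degrees 0 and 1 are compared with Laurent polynomials as bimodules.\<close>

lemma represents_form_mult_right:
  assumes "a \<in> Af" "n \<le> 1"
  shows "x \<in> form_exprs n \<Longrightarrow> represents_form n (x * gen (Elem a))"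
proof (rule form_exprs_map_represents[where n=n, OF distrib_right])
  fix a0 as assume w: "a0 \<in> Af" "set as \<subseteq> Af" "length as = n"
  then consider "as = []" "n = 0" | a1 where "as = [a1]" "n = 1" "a1 \<in> Af"
    using assms(2) by (cases as) auto
  then show "represents_form n (form_word a0 as * gen (Elem a))"
  proof cases
    case 1
    have "- (gen (Elem (a0 * a)) - gen (Elem a0) * gen (Elem a)) \<in> dga_ideal Af"
      using w assms by (intro dga_ideal_uminus dga_relations_in_ideal dga_relations.intros)
    with 1 show ?thesis
      by (intro represents_formI[OF form_exprs.word[of "a0 * a" as]])
        (use w assms in \<open>simp_all add: mult_closed form_word_def flip: gen_def\<close>)
  next
    case (2 a1)
    let ?e = "\<lambda>a. gen (Elem a) :: 'a expr" and ?d = "\<lambda>a. gen (Diff a) :: 'a expr"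
    have fw: "form_word b [c] = ?e b * ?d c" for b c
      by (simp add: form_word_def gen_def mult_single plus_list_def)
    have y: "form_word a0 [a1 * a] - form_word (a0 * a1) [a] \<in> form_exprs n"
      using 2 w assms by (intro form_exprs_diff form_exprs.word) (auto intro: mult_closed)
    have "?e a0 * (?d (a1 * a) - (?e a1 * ?d a + ?d a1 * ?e a)) \<in> dga_ideal Af"
      using 2 w assms by (intro dga_ideal_mult_left exprs_gen dga_relations_in_ideal dga_relations.intros)
    moreover have "(?e (a0 * a1) - ?e a0 * ?e a1) * ?d a \<in> dga_ideal Af"
      using 2 w assms by (intro dga_ideal_mult_right exprs_gen dga_relations_in_ideal dga_relations.intros)
    ultimately have "(?e (a0 * a1) - ?e a0 * ?e a1) * ?d a -
        ?e a0 * (?d (a1 * a) - (?e a1 * ?d a + ?d a1 * ?e a)) \<in> dga_ideal Af"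
      by (intro dga_ideal_diff)
    with 2 show ?thesis
      by (intro represents_formI[OF y]) (simp add: fw algebra_simps)
  qed
qed

lemma junk_forms_Suc:
  "junk_forms Af \<pi> L (Suc n) =
     cls ` {x + expr_diff y | x y. x \<in> form_exprs (Suc n) \<and> symb x = 0 \<and> y \<in> form_exprs n \<and> symb y = 0}"
    (is "_ = ?R")
proof (intro equalityI subsetI)
  fix \<omega> assume "\<omega> \<in> junk_forms Af \<pi> L (Suc n)"
  then obtain x y where xy: "x \<in> form_exprs (Suc n)" "symb x = 0" "y \<in> form_exprs n" "symb y = 0"
    and "\<omega> = cls x \<oplus>\<^bsub>Omega Af\<^esub> delta Af (cls y)"
    by (auto simp: junk_forms_def null_forms_eq set_add_def')
  moreover have "cls x \<oplus>\<^bsub>Omega Af\<^esub> delta Af (cls y) = cls (x + expr_diff y)"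
    using xy by (simp add: delta_class Omega_add form_exprs_exprs exprs_expr_diff)
  ultimately show "\<omega> \<in> ?R" by blast
next
  fix \<omega> assume "\<omega> \<in> ?R"
  then obtain x y where xy: "x \<in> form_exprs (Suc n)" "symb x = 0" "y \<in> form_exprs n" "symb y = 0"
    and "\<omega> = cls (x + expr_diff y)"
    by blast
  then have "\<omega> = cls x \<oplus>\<^bsub>Omega Af\<^esub> delta Af (cls y)"
    by (simp add: delta_class Omega_add form_exprs_exprs exprs_expr_diff)
  then show "\<omega> \<in> junk_forms Af \<pi> L (Suc n)"
    using xy by (auto simp: junk_forms_def null_forms_eq set_add_def')
qed

section \<open>Degrees 0 and 1: cosets as fibres of the symbol\<close>

lemma coset_class:
  assumes "J \<subseteq> exprs" "x \<in> exprs"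
  shows "cls ` J +>\<^bsub>Omega Af\<^esub> cls x = cls ` (\<lambda>j. j + x) ` J"
  using assms by (force simp: a_r_coset_def' Omega_add image_iff)

text \<open>In degrees 0 and 1 these sets turn out to be the cosets themselves, so the desired
  isomorphism is the inverse of \<open>fibre n\<close>.\<close>

definition fibre :: "nat \<Rightarrow> laurent \<Rightarrow> 'a expr set set" where
  "fibre n p = cls ` {x \<in> form_exprs n. symb x = p}"

text \<open>In degree 0 the symbol of the differential depends on the symbol of the form alone, so
  null forms have null differentials. From degree 1 on this is false.\<close>

lemma symb_diff_degree_0:
  assumes "x \<in> form_exprs 0"
  shows "symb (expr_diff x) = laurent_deriv (symb x)"
proof -
  have word: "symb (expr_diff (form_word a0 [])) = laurent_deriv (symb (form_word a0 []))" for a0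
    by (simp add: form_word_def flip: gen_def)
  have uminus: "laurent_deriv (- p) = - laurent_deriv p" for p
    by (rule poly_mapping_eqI) (simp add: lookup_laurent_deriv)
  show ?thesis
    using assms
    by induction (simp_all add: word uminus expr_diff_zero expr_symbol_zero expr_diff_uminus
        expr_symbol_uminus expr_diff_add expr_symbol_add laurent_deriv_add)
qed

lemma junk_forms_low:
  assumes "n \<le> 1"
  shows "junk_forms Af \<pi> L n = fibre n 0"
proof (cases "n = 0")
  case True
  have "cls x \<oplus>\<^bsub>Omega Af\<^esub> delta Af \<zero>\<^bsub>Omega Af\<^esub> = cls x" if "x \<in> form_exprs 0" for x
    using that by (simp add: Omega_zero delta_class Omega_add expr_diff_zero exprs_zero form_exprs_exprs)
  with True show ?thesis
    by (force simp: junk_forms_def null_forms_eq set_add_def' fibre_def)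
next
  case False
  with assms have n: "n = Suc 0" by simp
  show ?thesis
    unfolding n junk_forms_Suc fibre_def
  proof (intro equalityI subsetI)
    fix \<omega> assume "\<omega> \<in> cls ` {x + expr_diff y | x y.
      x \<in> form_exprs (Suc 0) \<and> symb x = 0 \<and> y \<in> form_exprs 0 \<and> symb y = 0}"
    then obtain x y where xy: "x \<in> form_exprs (Suc 0)" "symb x = 0" "y \<in> form_exprs 0" "symb y = 0"
      and \<omega>: "\<omega> = cls (x + expr_diff y)"
      by blast
    have "represents_form (Suc 0) (x + expr_diff y)"
      by (intro represents_form_add represents_form_form represents_form_diff xy)
    then obtain z where z: "z \<in> form_exprs (Suc 0)" "cls (x + expr_diff y) = cls z"
      by (auto simp: represents_form_def)
    moreover have "symb z = 0"
      using symb_cong[OF z(2)] xy by (simp add: expr_symbol_add symb_diff_degree_0)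
    ultimately show "\<omega> \<in> cls ` {x \<in> form_exprs (Suc 0). symb x = 0}"
      using \<omega> by blast
  next
    fix \<omega> assume "\<omega> \<in> cls ` {x \<in> form_exprs (Suc 0). symb x = 0}"
    then obtain x where "x \<in> form_exprs (Suc 0)" "symb x = 0" "\<omega> = cls (x + expr_diff 0)"
      by (auto simp: expr_diff_zero)
    then show "\<omega> \<in> cls ` {x + expr_diff y | x y.
      x \<in> form_exprs (Suc 0) \<and> symb x = 0 \<and> y \<in> form_exprs 0 \<and> symb y = 0}"
      using form_exprs.zero expr_symbol_zero by blast
  qed
qed

text \<open>Since the junk forms are the fibre over 0, translating them by a form of symbol
  \<open>p\<close> fills the whole fibre over \<open>p\<close>.\<close>

lemma coset_low:
  assumes "n \<le> 1" "represents_form n x"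
  shows "junk_forms Af \<pi> L n +>\<^bsub>Omega Af\<^esub> cls x = fibre n (symb x)"
proof -
  obtain y where y: "y \<in> form_exprs n" "cls x = cls y"
    using assms(2) by (auto simp: represents_form_def)
  have "(\<lambda>j. j + y) ` {j \<in> form_exprs n. symb j = 0} = {z \<in> form_exprs n. symb z = symb y}"
  proof (intro equalityI subsetI)
    fix z assume "z \<in> {z \<in> form_exprs n. symb z = symb y}"
    then have "z - y \<in> {j \<in> form_exprs n. symb j = 0}"
      using y by (simp add: form_exprs_diff expr_symbol_diff)
    then show "z \<in> (\<lambda>j. j + y) ` {j \<in> form_exprs n. symb j = 0}"
      by (rule rev_image_eqI) simp
  qed (use y in \<open>auto simp: form_exprs.add expr_symbol_add\<close>)
  moreover have "cls ` {j \<in> form_exprs n. symb j = 0} +>\<^bsub>Omega Af\<^esub> cls y =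
      cls ` (\<lambda>j. j + y) ` {j \<in> form_exprs n. symb j = 0}"
    by (rule coset_class) (use y in \<open>auto intro: form_exprs_exprs\<close>)
  ultimately show ?thesis
    using symb_cong[OF y(2)] y(2) by (simp add: junk_forms_low[OF assms(1)] fibre_def)
qed

lemma symb_surj_low:
  assumes "n \<le> 1"
  obtains x where "x \<in> form_exprs n" "symb x = p"
proof (cases "n = 0")
  case True
  obtain a where a: "a \<in> Af" "\<sigma> a = p"
    by (rule sigma_surj)
  show ?thesis
    by (rule that[of "form_word a []"]) (use a True in \<open>auto intro: form_exprs.word simp: symb_form_word\<close>)
next
  case False
  \<comment> \<open>The factor \<open>- z\<^sup>-\<^sup>1\<close> is the inverse of the symbol
    \<open>- z\<close> of \<open>\<delta>\<alpha>\<close>.\<close>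
  obtain a where a: "a \<in> Af" "\<sigma> a = p * Poly_Mapping.single (- 1) (- 1)"
    by (rule sigma_surj)
  show ?thesis
  proof (rule that[of "form_word a [\<alpha>]"])
    show "form_word a [\<alpha>] \<in> form_exprs n"
      using a False assms by (intro form_exprs.word) (auto simp: alpha_closed)
    show "symb (form_word a [\<alpha>]) = p"
      by (simp add: symb_form_word a sigma_alpha mult.assoc mult_single)
  qed
qed

lemma inj_fibre:
  assumes "n \<le> 1"
  shows "inj (fibre n)"
proof (rule injI)
  fix p p' assume eq: "fibre n p = fibre n p'"
  obtain x where x: "x \<in> form_exprs n" "symb x = p"
    by (rule symb_surj_low[OF assms])
  then have "cls x \<in> fibre n p'"
    unfolding eq[symmetric] by (auto simp: fibre_def)
  then obtain y where "symb y = p'" "cls x = cls y"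
    by (auto simp: fibre_def)
  with x show "p = p'"
    using symb_cong by blast
qed

lemma carrier_Omega_D_low:
  assumes "n \<le> 1"
  shows "carrier (Omega_D Af \<pi> L n) = range (fibre n)"
proof -
  have "carrier (Omega_D Af \<pi> L n) = (\<lambda>x. fibre n (symb x)) ` form_exprs n"
    using coset_low[OF assms represents_form_form]
    by (simp add: Omega_D_def Let_def Omega_deg_eq image_image cong: image_cong_simp)
  also have "\<dots> = range (fibre n)"
  proof -
    have "p \<in> symb ` form_exprs n" for p
      by (rule symb_surj_low[OF assms, of p]) auto
    then have "symb ` form_exprs n = UNIV"
      by blast
    then show ?thesis
      using image_image[of "fibre n" symb "form_exprs n"] by simp
  qed
  finally show ?thesis .
qed

lemma set_add_fibre:
  assumes "n \<le> 1"
  shows "fibre n p <+>\<^bsub>Omega Af\<^esub> fibre n p' = fibre n (p + p')"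
proof (intro equalityI subsetI)
  fix \<omega> assume "\<omega> \<in> fibre n p <+>\<^bsub>Omega Af\<^esub> fibre n p'"
  then show "\<omega> \<in> fibre n (p + p')"
    by (auto simp: set_add_def' fibre_def Omega_add form_exprs_exprs form_exprs.add expr_symbol_add
        intro!: imageI)
next
  fix \<omega> assume "\<omega> \<in> fibre n (p + p')"
  then obtain z where z: "z \<in> form_exprs n" "symb z = p + p'" "\<omega> = cls z"
    by (auto simp: fibre_def)
  obtain x where x: "x \<in> form_exprs n" "symb x = p"
    by (rule symb_surj_low[OF assms])
  have "z - x \<in> form_exprs n" "symb (z - x) = p'"
    using x z by (auto simp: form_exprs_diff expr_symbol_diff)
  moreover have "cls z = cls x \<oplus>\<^bsub>Omega Af\<^esub> cls (z - x)"
    using Omega_add[OF form_exprs_exprs[OF x(1)] form_exprs_exprs[OF form_exprs_diff[OF z(1) x(1)]]] by simp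
  ultimately show "\<omega> \<in> fibre n p <+>\<^bsub>Omega Af\<^esub> fibre n p'"
    unfolding set_add_def' fibre_def using x z by blast
qed

lemma left_act_fibre:
  assumes "n \<le> 1" "a \<in> Af"
  shows "left_act (Omega_D Af \<pi> L n) a (fibre n p) = fibre n (\<sigma> a * p)"
proof -
  have "junk_forms Af \<pi> L n +>\<^bsub>Omega Af\<^esub> (elem_form Af a \<otimes>\<^bsub>Omega Af\<^esub> cls x) = fibre n (\<sigma> a * symb x)"
    if "x \<in> form_exprs n" for x
    using coset_low[OF assms(1) represents_form_mult_left[OF assms(2) that]] that assms(2)
    by (simp add: elem_form_def Omega_mult exprs_gen form_exprs_exprs expr_symbol_mult)
  \<comment> \<open>The action is a union over representatives, which is the common value as soon as
    there is a representative.\<close>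
  moreover have "{x \<in> form_exprs n. symb x = p} \<noteq> {}"
    by (rule symb_surj_low[OF assms(1), of p]) auto
  ultimately show ?thesis
    by (auto simp: Omega_D_def Let_def fibre_def[of n p])
qed

lemma right_act_fibre:
  assumes "n \<le> 1" "a \<in> Af"
  shows "right_act (Omega_D Af \<pi> L n) (fibre n p) a = fibre n (p * \<sigma> a)"
proof -
  have "junk_forms Af \<pi> L n +>\<^bsub>Omega Af\<^esub> (cls x \<otimes>\<^bsub>Omega Af\<^esub> elem_form Af a) = fibre n (symb x * \<sigma> a)"
    if "x \<in> form_exprs n" for x
    using coset_low[OF assms(1) represents_form_mult_right[OF assms(2,1) that]] that assms(2)
    by (simp add: elem_form_def Omega_mult exprs_gen form_exprs_exprs expr_symbol_mult)
  moreover have "{x \<in> form_exprs n. symb x = p} \<noteq> {}"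
    by (rule symb_surj_low[OF assms(1), of p]) auto
  ultimately show ?thesis
    by (auto simp: Omega_D_def Let_def fibre_def[of n p])
qed

lemma bimodule_iso_fibre:
  assumes "n \<le> 1"
  shows "bimodule_iso Af (Omega_D Af \<pi> L n) (laurent_bimodule \<sigma>) (inv_into UNIV (fibre n))"
proof -
  note inverse = inv_f_f[OF inj_fibre[OF assms]]
  have "bij_betw (inv_into UNIV (fibre n)) (range (fibre n)) UNIV"
    by (rule bij_betw_inv_into) (simp add: bij_betw_def inj_fibre[OF assms])
  then show ?thesis
    unfolding bimodule_iso_def carrier_Omega_D_low[OF assms]
    using left_act_fibre[OF assms] right_act_fibre[OF assms] junk_forms_low[OF assms] set_add_fibre[OF assms]
    by (auto simp: laurent_bimodule_def inverse) (auto simp: Omega_D_def Let_def inverse)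
qed

lemma induced_differential_eq:
  assumes "a \<in> Af"
  shows "induced_differential Af \<pi> L a = fibre 1 (laurent_deriv (\<sigma> a))"
proof -
  have "represents_form (Suc 0) (expr_diff (form_word a []))"
    by (rule represents_form_diff, rule form_exprs.word) (use assms in auto)
  then have "represents_form 1 (gen (Diff a))"
    by (simp add: form_word_def flip: gen_def)
  from coset_low[OF _ this] show ?thesis
    using assms by (simp add: induced_differential_def elem_form_def delta_class exprs_gen)
qed

text \<open>
  In degree at least 2 the differential of the null form
  \<open>a \<delta>(\<alpha>\<^sup>2) (\<delta>\<alpha>)\<^sup>k - 2 a \<alpha> (\<delta>\<alpha>)\<^sup>k\<^sup>+\<^sup>1\<close> has the symbol \<open>- 2 \<sigma>(a) z\<^sup>2 (- z)\<^sup>k\<close>, which is arbitrary.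
\<close>

lemma null_form_with_symb_diff:
  obtains y z where "y \<in> form_exprs (Suc k)" "symb y = 0" "z \<in> form_exprs (Suc (Suc k))"
    "cls (expr_diff y) = cls z" "symb z = p"
proof -
  \<comment> \<open>The factor is the inverse of \<open>- 2 z\<^sup>2 (- z)\<^sup>k\<close>, the
    symbol that accompanies \<open>\<sigma> a\<close> in the end.\<close>
  obtain a where a: "a \<in> Af" "\<sigma> a = p * Poly_Mapping.single (- int k - 2) (- (1 / 2) * (- 1) ^ k)"
    by (rule sigma_surj)
  define u1 where "u1 = \<alpha> * \<alpha> # replicate k \<alpha>"
  define u2 where "u2 = \<alpha> # replicate k \<alpha>"
  \<comment> \<open>By the rule \<open>\<partial>(z\<^sup>2) = 2 z \<partial>z\<close>, this
    coefficient makes the symbols of the two words of \<open>y\<close> cancel.\<close>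
  define b where "b = (- 2) *\<^sub>C (a * \<alpha>)"
  define Z where "Z = (Poly_Mapping.single 1 1 :: laurent)"
  define W where "W = (- Z) ^ k"
  have u: "set u1 \<subseteq> Af" "set u2 \<subseteq> Af" "length u1 = Suc k" "length u2 = Suc k" "b \<in> Af"
    by (auto simp: u1_def u2_def b_def alpha_closed mult_closed scaleC_closed a)
  have sigma_alpha_Z: "\<sigma> \<alpha> = Z"
    by (simp add: Z_def sigma_alpha)
  have dZ: "laurent_deriv Z = - Z"
    by (simp add: Z_def single_uminus)
  have two: "(- 2 :: laurent) = Poly_Mapping.single 0 (- 2)"
    by (simp add: single_uminus)
  have sb: "\<sigma> b = - 2 * (\<sigma> a * Z)"
    unfolding two by (simp add: b_def sigma_scaleC sigma_mult a(1) alpha_closed mult_closed sigma_alpha_Z)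
  have dsb: "laurent_deriv (\<sigma> b) = - 2 * (\<sigma> a * - Z + laurent_deriv (\<sigma> a) * Z)"
    unfolding sb by (simp only: two laurent_deriv_scale laurent_deriv_mult[of "\<sigma> a" Z] dZ)
  have du1: "(\<Prod>x\<leftarrow>u1. laurent_deriv (\<sigma> x)) = - 2 * (Z * Z) * W"
    by (simp add: u1_def W_def sigma_mult alpha_closed sigma_alpha_Z laurent_deriv_mult dZ)
  have du2: "(\<Prod>x\<leftarrow>u2. laurent_deriv (\<sigma> x)) = - Z * W"
    by (simp add: u2_def W_def sigma_alpha_Z dZ)
  define y where "y = form_word a u1 + form_word b u2"
  define z where "z = form_word 1 (a # u1) + form_word 1 (b # u2)"
  show ?thesis
  proof (rule that)
    show "y \<in> form_exprs (Suc k)"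
      unfolding y_def by (intro form_exprs.add form_exprs.word a u)
    show "z \<in> form_exprs (Suc (Suc k))"
      unfolding z_def by (intro form_exprs.add form_exprs.word one_closed) (use a u in auto)
    show "symb y = 0"
      by (simp add: y_def expr_symbol_add symb_form_word du1 du2 sb algebra_simps)
    have "expr_diff (form_word a u1) - form_word 1 (a # u1) \<in> dga_ideal Af"
      "expr_diff (form_word b u2) - form_word 1 (b # u2) \<in> dga_ideal Af"
      using expr_diff_form_word a u by (simp_all add: expr_class_eq_iff)
    from dga_ideal_add[OF this] show "cls (expr_diff y) = cls z"
      by (simp add: y_def z_def expr_class_eq_iff expr_diff_add algebra_simps)
    have "symb z = laurent_deriv (\<sigma> a) * (- 2 * (Z * Z) * W) + laurent_deriv (\<sigma> b) * (- Z * W)"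
      by (simp add: z_def expr_symbol_add symb_form_word du1 du2 sigma_one)
    \<comment> \<open>The terms with \<open>laurent_deriv (\<sigma> a)\<close> cancel. What survives
      comes from differentiating the \<open>\<alpha>\<close> inside \<open>b\<close>, which has no
      counterpart in the first word.\<close>
    also have "\<dots> = - 2 * (\<sigma> a * (Z * Z * W))"
      unfolding dsb by (simp add: algebra_simps)
    also have "W = Poly_Mapping.single (int k) ((- 1) ^ k)"
      unfolding W_def Z_def by (induction k) (simp_all add: mult_single flip: single_uminus)
    also have "\<sigma> a * (Z * Z * Poly_Mapping.single (int k) ((- 1) ^ k)) = p * Poly_Mapping.single 0 (- (1 / 2))"
      by (simp add: a(2) Z_def mult_single mult.assoc)
    also have "- 2 * (p * Poly_Mapping.single 0 (- (1 / 2))) = p"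
      unfolding two by (simp add: mult.left_commute[of _ p] mult_single)
    finally show "symb z = p" .
  qed
qed

text \<open>Given a form \<open>x\<close>, choose a null form \<open>y\<close> of one degree less
  whose differential has the symbol of \<open>x\<close>. Then \<open>x - \<delta>y\<close> is null,
  so \<open>x\<close> is junk.\<close>

lemma junk_forms_high:
  assumes "2 \<le> n"
  shows "junk_forms Af \<pi> L n = cls ` form_exprs n"
proof -
  obtain k where n: "n = Suc (Suc k)"
    using assms by (metis Suc_le_D numeral_2_eq_2 Suc_le_mono)
  show ?thesis
    unfolding n junk_forms_Suc
  proof (intro equalityI subsetI)
    fix \<omega> assume "\<omega> \<in> cls ` {x + expr_diff y | x y. x \<in> form_exprs (Suc (Suc k)) \<and> symb x = 0 \<and>
      y \<in> form_exprs (Suc k) \<and> symb y = 0}"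
    then obtain x y where "x \<in> form_exprs (Suc (Suc k))" "y \<in> form_exprs (Suc k)" "\<omega> = cls (x + expr_diff y)"
      by blast
    moreover from this have "represents_form (Suc (Suc k)) (x + expr_diff y)"
      by (intro represents_form_add represents_form_form represents_form_diff)
    ultimately show "\<omega> \<in> cls ` form_exprs (Suc (Suc k))"
      by (auto simp: represents_form_def)
  next
    fix \<omega> assume "\<omega> \<in> cls ` form_exprs (Suc (Suc k))"
    then obtain x where x: "x \<in> form_exprs (Suc (Suc k))" "\<omega> = cls x"
      by blast
    obtain y z where yz: "y \<in> form_exprs (Suc k)" "symb y = 0" "z \<in> form_exprs (Suc (Suc k))"
      "cls (expr_diff y) = cls z" "symb z = symb x"
      by (rule null_form_with_symb_diff)
    have "x - (x - z + expr_diff y) \<in> dga_ideal Af"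
      using yz(4) dga_ideal_uminus[of "expr_diff y - z"] by (simp add: expr_class_eq_iff)
    then have "cls x = cls (x - z + expr_diff y)"
      by (simp only: expr_class_eq_iff)
    moreover have "x - z \<in> form_exprs (Suc (Suc k))" "symb (x - z) = 0"
      using x yz by (auto simp: form_exprs_diff expr_symbol_diff)
    ultimately show "\<omega> \<in> cls ` {x + expr_diff y | x y. x \<in> form_exprs (Suc (Suc k)) \<and> symb x = 0 \<and>
      y \<in> form_exprs (Suc k) \<and> symb y = 0}"
      using x yz by blast
  qed
qed

lemma Omega_D_high:
  assumes "2 \<le> n"
  shows "carrier (Omega_D Af \<pi> L n) = {bimod_zero (Omega_D Af \<pi> L n)}"
proof -
  have "cls ` form_exprs n +>\<^bsub>Omega Af\<^esub> cls x = cls ` form_exprs n" if x: "x \<in> form_exprs n" for x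
  proof -
    have "y \<in> (\<lambda>j. j + x) ` form_exprs n" if "y \<in> form_exprs n" for y
      by (rule rev_image_eqI[of "y - x"]) (simp_all add: form_exprs_diff that x)
    then have "(\<lambda>j. j + x) ` form_exprs n = form_exprs n"
      using x form_exprs.add by blast
    then show ?thesis
      using coset_class[of "form_exprs n" x] form_exprs_exprs x by auto
  qed
  then have "(\<lambda>x. cls ` form_exprs n +>\<^bsub>Omega Af\<^esub> cls x) ` form_exprs n = (\<lambda>x. cls ` form_exprs n) ` form_exprs n"
    by (intro image_cong refl)
  also have "\<dots> = {cls ` form_exprs n}"
    using form_exprs.zero by blast
  finally show ?thesis
    by (simp add: Omega_D_def Let_def junk_forms_high[OF assms] Omega_deg_eq image_image)
qed

section \<open>Symbols of the basis monomials\<close>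

lemma power_closed: "a \<in> Af \<Longrightarrow> a ^ n \<in> Af"
  by (induction n) (auto intro: star_subalgebra.intros)

lemma sigma_power: "a \<in> Af \<Longrightarrow> \<sigma> (a ^ n) = \<sigma> a ^ n"
  by (induction n) (simp_all add: sigma_one sigma_mult power_closed)

lemma monomial_closed: "signed_power \<alpha> i * \<beta> ^ j * star \<beta> ^ k \<in> Af"
  unfolding signed_power_def
  by (auto intro!: star_subalgebra.mult power_closed alpha_closed beta_closed intro: star_subalgebra.star)

lemma sigma_signed_power: "\<sigma> (signed_power \<alpha> i) = Poly_Mapping.single i 1"
proof -
  have p: "Poly_Mapping.single m (1::complex) ^ n = Poly_Mapping.single (int n * m) 1" for m n
    by (induction n) (simp_all add: mult_single algebra_simps)
  show ?thesis
    by (simp add: signed_power_def sigma_power sigma_star alpha_closed star_subalgebra.star sigma_alpha p)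
qed

lemma sigma_monomial:
  "\<sigma> (signed_power \<alpha> i * \<beta> ^ j * star \<beta> ^ k) = (if j = 0 \<and> k = 0 then Poly_Mapping.single i 1 else 0)"
proof -
  have sp: "signed_power \<alpha> i \<in> Af"
    using monomial_closed[of i 0 0] by simp
  have sb: "star \<beta> \<in> Af"
    by (rule star_subalgebra.star[OF beta_closed])
  have "\<sigma> (signed_power \<alpha> i * \<beta> ^ j * star \<beta> ^ k) = Poly_Mapping.single i 1 * 0 ^ j * 0 ^ k"
    using sp sb beta_closed
    by (simp add: sigma_mult star_subalgebra.mult power_closed sigma_power sigma_star sigma_beta sigma_signed_power)
  then show ?thesis
    by (simp add: power_0_left)
qed

end

theorem theorem4p2:
  fixes q :: real
    and \<alpha> \<beta> :: "'a::cstar_algebra"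
    and \<pi> :: "'a \<Rightarrow> (nat \<times> int) bounded_op"
    and \<sigma> :: "'a \<Rightarrow> laurent"
    and L :: "(real \<Rightarrow> complex) \<Rightarrow> complex"
    and Af :: "'a set"
  assumes q: "0 < q" "q < 1"
    and universal: "universal_SUq2 q \<alpha> \<beta>"
    and representation: "SUq2_representation q \<alpha> \<beta> \<pi>"
    and Af: "Af = star_subalgebra {\<alpha>, \<beta>}"
    and sigma: "circle_restriction \<alpha> \<beta> \<sigma>"
    and limit: "generalized_limit L"
  shows "(\<forall>n\<ge>2. carrier (Omega_D Af \<pi> L n) = {bimod_zero (Omega_D Af \<pi> L n)}) \<and>
    (\<exists>\<Phi>. bimodule_iso Af (Omega_D Af \<pi> L 0) (laurent_bimodule \<sigma>) \<Phi>) \<and>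
    (\<exists>\<Phi>. bimodule_iso Af (Omega_D Af \<pi> L 1) (laurent_bimodule \<sigma>) \<Phi> \<and>
       (\<forall>(i::int) (j::nat) (k::nat).
          \<Phi> (induced_differential Af \<pi> L (signed_power \<alpha> i * \<beta> ^ j * star \<beta> ^ k)) =
            (if j = 0 \<and> k = 0 then Poly_Mapping.single i (- of_int i) else 0)))"
proof -
  interpret SUq2_geometry q \<alpha> \<beta> \<pi> \<sigma> L
    by standard fact+
  \<comment> \<open>The inverse of \<open>fibre 1\<close> reads off the symbol of a coset, so the
    differential becomes \<open>\<sigma>\<close> followed by \<open>laurent_deriv\<close>; on
    \<open>z\<^sup>i\<close> the latter gives the factor \<open>- i\<close>.\<close>
  have "inv_into UNIV (fibre 1) (induced_differential Af \<pi> L (signed_power \<alpha> i * \<beta> ^ j * star \<beta> ^ k)) =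
      (if j = 0 \<and> k = 0 then Poly_Mapping.single i (- of_int i) else 0)" for i j k
    unfolding Af induced_differential_eq[OF monomial_closed]
    by (simp add: inv_f_f[OF inj_fibre] sigma_monomial)
  then show ?thesis
    using Omega_D_high bimodule_iso_fibre[of 0] bimodule_iso_fibre[of 1] unfolding Af by blast
qed

end
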